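(* For every finite connected weightless, loopless graph $G$, the set $M^{\mathrm{alg}}(G)$ contains a special curve.
   Context: Fix an algebraically closed field $k$. A curve is a reduced one-dimensional projective scheme over $k$ with only nodal singularities. Its dual graph has the irreducible components as vertices, the nodes as edges (each node joins the components on which its branches lie; a node of a single component gives a loop), and the weight of a vertex is the genus of the normalization of the component. $M^{\mathrm{alg}}(G)$ is the set of isomorphism classes of curves $X=\bigcup_{v\in V}C_v$ with dual graph $G$, where $V$ is the vertex set of $G$; weightless means all weights are zero. If $G$ is weightless and loopless, every $C_v\cong\mathbb P^1$. Multiple edges are allowed. Let $H$ be the set of half-edges of $G$; each edge consists of two half-edges $h,\overline h$, where $h\mapsto\overline h$ is a fixed-point-free involution of $H$. Let $H_{v,w}$ be the set of half-edges $h$ adjacent to $v$ such that $\overline h$ is adjacent to $w$. A curve $X\in M^{\mathrm{alg}}(G)$ is described as $X=\bigl(\bigsqcup_{v\in V}C_v\bigr)/\{p_h=p_{\overline h},\ \forall h\in H\}$, where the points $p_h\in C_v$, for $h$ adjacent to $v$, are distinct. Put $P_{v,w}=\{p_h: h\in H_{v,w}\}\subset C_v$. $X$ is special if there is a collection of isomorphisms of pointed curves $\phi_{v,w}:(C_v;P_{v,w})\to(C_w;P_{w,v})$, for all $v,w\in V$, such that for all $u,v,w\in V$ and $h\in H_{v,w}$: (a) $\phi_{v,w}(p_h)=p_{\overline h}$; (b) $\phi_{v,w}^{-1}=\phi_{w,v}$; (c) $\phi_{v,u}=\phi_{w,u}\circ\phi_{v,w}$. *)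

theory Defs
  imports
    "HOL-Computational_Algebra.Computational_Algebra"
    "HOL-Library.Function_Algebras"
begin

section \<open>Projective algebraic sets over an algebraically closed field\<close>

text \<open>
  Over an algebraically closed field, reduced projective schemes and their morphisms are the same
  thing as projective algebraic sets with their Zariski topology and sheaf of regular functions,
  and that classical language is used throughout.

  A point of projective space is the set of nonzero multiples of a nonzero vector. Vectors are
  sequences, and \<open>proj_space n\<close> consists of the points whose coordinates vanish beyond index \<open>n\<close>,
  so that \<open>proj_space n\<close> is a coordinate subspace of \<open>proj_space (Suc n)\<close>. An algebraic set
  therefore does not have to remember its ambient dimension.
\<close>

type_synonym 'k ppoint = "(nat \<Rightarrow> 'k) set"

definition line :: "(nat \<Rightarrow> 'k::field) \<Rightarrow> 'k ppoint" where
  "line x = {(\<lambda>i. c * x i) | c. c \<noteq> 0}"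

definition proj_space :: "nat \<Rightarrow> 'k::field ppoint set" where
  "proj_space n = line ` {x. (\<exists>i. x i \<noteq> 0) \<and> (\<forall>i>n. x i = 0)}"

text \<open>
  Homogeneous polynomials of degree \<open>d\<close> in the variables \<open>x\<^sub>0, \<dots>, x\<^sub>N\<close> for some \<open>N\<close>, as functions
  (an algebraically closed field is infinite). On \<open>proj_space n\<close> only \<open>x\<^sub>0, \<dots>, x\<^sub>n\<close> matter.
\<close>

definition form :: "nat \<Rightarrow> ((nat \<Rightarrow> 'k::field) \<Rightarrow> 'k) \<Rightarrow> bool" where
  "form d F \<longleftrightarrow> (\<exists>N A c. finite A \<and> (\<forall>a\<in>A. (\<Sum>i\<le>N. a i) = d) \<and>
     F = (\<lambda>x. \<Sum>a\<in>A. c a * (\<Prod>i\<le>N. x i ^ (a i :: nat))))"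

definition proj_algebraic :: "'k::field ppoint set \<Rightarrow> bool" where
  "proj_algebraic X \<longleftrightarrow> (\<exists>n T. (\<forall>F\<in>T. \<exists>d. form d F) \<and>
     X = {p \<in> proj_space n. \<forall>F\<in>T. \<forall>x\<in>p. F x = 0})"

text \<open>The Zariski topology on a subset of some projective space.\<close>

definition zclosed :: "'k::field ppoint set \<Rightarrow> 'k ppoint set \<Rightarrow> bool" where
  "zclosed X Z \<longleftrightarrow> (\<exists>W. proj_algebraic W \<and> Z = X \<inter> W)"

definition zopen :: "'k::field ppoint set \<Rightarrow> 'k ppoint set \<Rightarrow> bool" where
  "zopen X U \<longleftrightarrow> (\<exists>W. proj_algebraic W \<and> U = X - W)"

definition zirreducible :: "'k::field ppoint set \<Rightarrow> bool" where
  "zirreducible X \<longleftrightarrow> X \<noteq> {} \<and>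
     (\<forall>Z W. zclosed X Z \<and> zclosed X W \<and> X = Z \<union> W \<longrightarrow> X = Z \<or> X = W)"

definition components :: "'k::field ppoint set \<Rightarrow> 'k ppoint set set" where
  "components X = {C. C \<subseteq> X \<and> zirreducible C \<and>
     (\<forall>D. C \<subseteq> D \<and> D \<subseteq> X \<and> zirreducible D \<longrightarrow> D = C)}"

definition irreducible_chain :: "'k::field ppoint set \<Rightarrow> nat \<Rightarrow> bool" where
  "irreducible_chain X d \<longleftrightarrow> (\<exists>Z :: nat \<Rightarrow> 'k ppoint set.
     (\<forall>i\<le>d. zclosed X (Z i) \<and> zirreducible (Z i)) \<and> (\<forall>i<d. Z i \<subset> Z (Suc i)))"

definition has_dimension :: "'k::field ppoint set \<Rightarrow> nat \<Rightarrow> bool" where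
  "has_dimension X d \<longleftrightarrow> irreducible_chain X d \<and> \<not> irreducible_chain X (Suc d)"


section \<open>Regular functions, morphisms and local rings\<close>

definition regular_at :: "'k::field ppoint set \<Rightarrow> 'k ppoint \<Rightarrow> ('k ppoint \<Rightarrow> 'k) \<Rightarrow> bool" where
  "regular_at X p f \<longleftrightarrow> (\<exists>U d F G. zopen X U \<and> p \<in> U \<and> form d F \<and> form d G \<and>
     (\<forall>q\<in>U. \<forall>x\<in>q. G x \<noteq> 0 \<and> f q = F x / G x))"

definition morphism ::
    "'k::field ppoint set \<Rightarrow> 'k ppoint set \<Rightarrow> ('k ppoint \<Rightarrow> 'k ppoint) \<Rightarrow> bool" where
  "morphism X Y \<phi> \<longleftrightarrow> \<phi> ` X \<subseteq> Y \<and>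
     (\<forall>V. zopen Y V \<longrightarrow> zopen X {p \<in> X. \<phi> p \<in> V}) \<and>
     (\<forall>V f. zopen Y V \<and> (\<forall>q\<in>V. regular_at Y q f) \<longrightarrow>
        (\<forall>p\<in>X. \<phi> p \<in> V \<longrightarrow> regular_at X p (\<lambda>p. f (\<phi> p))))"

definition isomorphism ::
    "'k::field ppoint set \<Rightarrow> 'k ppoint set \<Rightarrow> ('k ppoint \<Rightarrow> 'k ppoint) \<Rightarrow> bool" where
  "isomorphism X Y \<phi> \<longleftrightarrow>
     bij_betw \<phi> X Y \<and> morphism X Y \<phi> \<and> morphism Y X (inv_into X \<phi>)"

text \<open>
  The local ring of \<open>X\<close> at \<open>p\<close> is the ring of all functions \<open>f\<close> with \<open>regular_at X p f\<close> modulo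
  the relation \<open>germ_eq X p\<close>; values away from \<open>p\<close> are irrelevant. The sets below are
  preimages, in that ring of functions, of the maximal ideal and of its powers.
\<close>

definition germ_eq ::
    "'k::field ppoint set \<Rightarrow> 'k ppoint \<Rightarrow> ('k ppoint \<Rightarrow> 'k) \<Rightarrow> ('k ppoint \<Rightarrow> 'k) \<Rightarrow> bool" where
  "germ_eq X p f g \<longleftrightarrow> (\<exists>U. zopen X U \<and> p \<in> U \<and> (\<forall>q\<in>U. f q = g q))"

definition max_ideal :: "'k::field ppoint set \<Rightarrow> 'k ppoint \<Rightarrow> ('k ppoint \<Rightarrow> 'k) set" where
  "max_ideal X p = {f. regular_at X p f \<and> f p = 0}"

definition max_ideal_power ::
    "'k::field ppoint set \<Rightarrow> 'k ppoint \<Rightarrow> nat \<Rightarrow> ('k ppoint \<Rightarrow> 'k) set" where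
  "max_ideal_power X p j = {f. \<exists>(r::nat) c g.
     (\<forall>i<r. regular_at X p (c i)) \<and> (\<forall>i<r. \<forall>l<j. g i l \<in> max_ideal X p) \<and>
     germ_eq X p f (\<lambda>q. \<Sum>i<r. c i q * (\<Prod>l<j. g i l q))}"

text \<open>
  Regularity of a local ring of dimension one: its maximal ideal is principal. This is only used
  for points of sets all of whose components are one-dimensional.
\<close>

definition regular_point :: "'k::field ppoint set \<Rightarrow> 'k ppoint \<Rightarrow> bool" where
  "regular_point X p \<longleftrightarrow> p \<in> X \<and> (\<exists>u\<in>max_ideal X p. \<forall>f\<in>max_ideal X p.
     \<exists>h. regular_at X p h \<and> germ_eq X p f (\<lambda>q. u q * h q))"

text \<open>
  The power series ring \<open>k[[x,y]]\<close> is rendered as the type of power series over power series.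
  \<open>in_fps_power j s\<close> says that \<open>s\<close> lies in the ideal \<open>(x,y)\<^sup>j + (xy)\<close>.
\<close>

abbreviation fps_x :: "'k::field fps fps" where
  "fps_x \<equiv> fps_const fps_X"

abbreviation fps_y :: "'k::field fps fps" where
  "fps_y \<equiv> fps_X"

definition in_fps_power :: "nat \<Rightarrow> 'k::field fps fps \<Rightarrow> bool" where
  "in_fps_power j s \<longleftrightarrow> (\<exists>c. fps_x * fps_y dvd s - (\<Sum>i\<le>j. c i * fps_x ^ i * fps_y ^ (j - i)))"

text \<open>
  A node is a point whose completed local ring is isomorphic to \<open>k[[x,y]]/(xy)\<close> as a
  \<open>k\<close>-algebra. As this target is complete, such an isomorphism is the same thing as a
  \<open>k\<close>-algebra homomorphism \<open>\<psi>\<close> from the local ring \<open>O\<close> with maximal ideal \<open>m\<close> to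
  \<open>k[[x,y]]/(xy)\<close> which induces, for every \<open>j\<close>, a bijection from \<open>O/m\<^sup>j\<close> to
  \<open>k[[x,y]]/((x,y)\<^sup>j + (xy))\<close>. Elements of \<open>k[[x,y]]/(xy)\<close> are given by representatives.
\<close>

definition node :: "'k::field ppoint set \<Rightarrow> 'k ppoint \<Rightarrow> bool" where
  "node X p \<longleftrightarrow> p \<in> X \<and> (\<exists>\<psi> :: ('k ppoint \<Rightarrow> 'k) \<Rightarrow> 'k fps fps.
     (\<forall>f g. regular_at X p f \<and> regular_at X p g \<longrightarrow>
        fps_x * fps_y dvd \<psi> (\<lambda>q. f q + g q) - (\<psi> f + \<psi> g) \<and>
        fps_x * fps_y dvd \<psi> (\<lambda>q. f q * g q) - \<psi> f * \<psi> g \<and>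
        (germ_eq X p f g \<longrightarrow> fps_x * fps_y dvd \<psi> f - \<psi> g)) \<and>
     (\<forall>c. fps_x * fps_y dvd \<psi> (\<lambda>q. c) - fps_const (fps_const c)) \<and>
     (\<forall>j. (\<forall>f. regular_at X p f \<longrightarrow> (f \<in> max_ideal_power X p j \<longleftrightarrow> in_fps_power j (\<psi> f))) \<and>
          (\<forall>s. \<exists>f. regular_at X p f \<and> in_fps_power j (\<psi> f - s))))"


section \<open>Nodal curves, normalization and genus\<close>

definition curve :: "'k::field ppoint set \<Rightarrow> bool" where
  "curve X \<longleftrightarrow> proj_algebraic X \<and> X \<noteq> {} \<and> (\<forall>C\<in>components X. has_dimension C 1) \<and>
     (\<forall>p\<in>X. regular_point X p \<or> node X p)"

definition nonsingular_curve :: "'k::field ppoint set \<Rightarrow> bool" where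
  "nonsingular_curve D \<longleftrightarrow> proj_algebraic D \<and> zirreducible D \<and> has_dimension D 1 \<and>
     (\<forall>q\<in>D. regular_point D q)"

text \<open>
  The normalization of an irreducible projective curve is its nonsingular projective model: a
  nonsingular irreducible projective curve with a birational morphism to it.
\<close>

definition normalization ::
    "'k::field ppoint set \<Rightarrow> 'k ppoint set \<Rightarrow> ('k ppoint \<Rightarrow> 'k ppoint) \<Rightarrow> bool" where
  "normalization C D \<nu> \<longleftrightarrow> nonsingular_curve D \<and> morphism D C \<nu> \<and>
     (\<exists>U. U \<noteq> {} \<and> zopen C U \<and> isomorphism {q \<in> D. \<nu> q \<in> U} U \<nu>)"

text \<open>
  The Hilbert function: the dimension of the degree \<open>d\<close> part of the homogeneous coordinate ring,
  realized as functions on the affine cone. The genus \<open>g\<close> is read off from the Hilbert polynomial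
  \<open>e d + 1 - g\<close> (arithmetic genus, which is the genus of a nonsingular irreducible curve).
\<close>

definition hilbert_function :: "'k::field ppoint set \<Rightarrow> nat \<Rightarrow> nat" where
  "hilbert_function X d =
     vector_space.dim (\<lambda>(c::'k) (F :: (nat \<Rightarrow> 'k) \<Rightarrow> 'k) x. c * F x)
       {(\<lambda>x. if line x \<in> X then F x else 0) | F. form d F}"

definition has_genus :: "'k::field ppoint set \<Rightarrow> nat \<Rightarrow> bool" where
  "has_genus D g \<longleftrightarrow> (\<exists>e::int. eventually
     (\<lambda>d. int (hilbert_function D d) = e * int d + 1 - int g) sequentially)"


section \<open>Weighted graphs and dual graphs\<close>

text \<open>
  A half-edge \<open>h\<close> is adjacent to the vertex \<open>base G h\<close>, and \<open>opp G h\<close> is the other half of its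
  edge. Multiple edges and loops are allowed.
\<close>

record ('v, 'h) wgraph =
  verts :: "'v set"
  halves :: "'h set"
  base :: "'h \<Rightarrow> 'v"
  opp :: "'h \<Rightarrow> 'h"
  weight :: "'v \<Rightarrow> nat"

definition finite_graph :: "('v, 'h) wgraph \<Rightarrow> bool" where
  "finite_graph G \<longleftrightarrow> finite (verts G) \<and> finite (halves G) \<and>
     (\<forall>h\<in>halves G. base G h \<in> verts G \<and> opp G h \<in> halves G \<and>
        opp G (opp G h) = h \<and> opp G h \<noteq> h)"

definition connected_graph :: "('v, 'h) wgraph \<Rightarrow> bool" where
  "connected_graph G \<longleftrightarrow> verts G \<noteq> {} \<and>
     (\<forall>v\<in>verts G. \<forall>w\<in>verts G.
        (v, w) \<in> {(base G h, base G (opp G h)) | h. h \<in> halves G}\<^sup>*)"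

definition weightless :: "('v, 'h) wgraph \<Rightarrow> bool" where
  "weightless G \<longleftrightarrow> (\<forall>v\<in>verts G. weight G v = 0)"

definition loopless :: "('v, 'h) wgraph \<Rightarrow> bool" where
  "loopless G \<longleftrightarrow> (\<forall>h\<in>halves G. base G (opp G h) \<noteq> base G h)"

definition half_edges :: "('v, 'h) wgraph \<Rightarrow> 'v \<Rightarrow> 'v \<Rightarrow> 'h set" where
  "half_edges G v w = {h \<in> halves G. base G h = v \<and> base G (opp G h) = w}"

text \<open>
  An identification of the dual graph of \<open>X\<close> with \<open>G\<close>: vertices \<open>v\<close> correspond to irreducible
  components \<open>K v\<close>, with normalization \<open>\<nu> v : C v \<rightarrow> K v\<close> of genus the weight of \<open>v\<close>; half-edges
  correspond to the branches at the nodes of \<open>X\<close>, that is, to the points \<open>p h\<close> over nodes on the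
  disjoint union of the normalizations; and two branches meet in the same node of \<open>X\<close> iff
  they belong to the same edge. Thus \<open>X\<close> is the disjoint union of the \<open>C v\<close> with \<open>p h\<close> and
  \<open>p (opp G h)\<close> identified. If \<open>G\<close> is loopless, each \<open>\<nu> v\<close> is an isomorphism.
\<close>

definition dual_graph_marking ::
    "('v, 'h) wgraph \<Rightarrow> 'k::field ppoint set \<Rightarrow> ('v \<Rightarrow> 'k ppoint set) \<Rightarrow> ('v \<Rightarrow> 'k ppoint set) \<Rightarrow>
      ('v \<Rightarrow> 'k ppoint \<Rightarrow> 'k ppoint) \<Rightarrow> ('h \<Rightarrow> 'k ppoint) \<Rightarrow> bool" where
  "dual_graph_marking G X K C \<nu> p \<longleftrightarrow>
     bij_betw K (verts G) (components X) \<and>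
     (\<forall>v\<in>verts G. normalization (K v) (C v) (\<nu> v) \<and> has_genus (C v) (weight G v)) \<and>
     bij_betw (\<lambda>h. (base G h, p h)) (halves G)
       {(v, q). v \<in> verts G \<and> q \<in> C v \<and> node X (\<nu> v q)} \<and>
     (\<forall>h\<in>halves G. \<forall>h'\<in>halves G.
        \<nu> (base G h) (p h) = \<nu> (base G h') (p h') \<longleftrightarrow> h' = h \<or> h' = opp G h)"

definition curves_with_dual_graph :: "('v, 'h) wgraph \<Rightarrow> 'k::field ppoint set set" where
  "curves_with_dual_graph G = {X. curve X \<and> (\<exists>K C \<nu> p. dual_graph_marking G X K C \<nu> p)}"

definition M_alg :: "('v, 'h) wgraph \<Rightarrow> 'k::field ppoint set set set" where
  "M_alg G = curves_with_dual_graph G //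
     {(X, Y). curve X \<and> curve Y \<and> (\<exists>\<phi>. isomorphism X Y \<phi>)}"


section \<open>Special curves\<close>

definition pointed_isomorphism ::
    "'k::field ppoint set \<Rightarrow> 'k ppoint set \<Rightarrow> 'k ppoint set \<Rightarrow> 'k ppoint set \<Rightarrow>
      ('k ppoint \<Rightarrow> 'k ppoint) \<Rightarrow> bool" where
  "pointed_isomorphism C P D Q \<phi> \<longleftrightarrow> isomorphism C D \<phi> \<and> \<phi> ` P = Q"

definition special :: "('v, 'h) wgraph \<Rightarrow> 'k::field ppoint set \<Rightarrow> bool" where
  "special G X \<longleftrightarrow> (\<exists>K C \<nu> p. dual_graph_marking G X K C \<nu> p \<and>
     (\<exists>\<phi> :: 'v \<Rightarrow> 'v \<Rightarrow> 'k ppoint \<Rightarrow> 'k ppoint.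
       (\<forall>v\<in>verts G. \<forall>w\<in>verts G.
          pointed_isomorphism (C v) (p ` half_edges G v w) (C w) (p ` half_edges G w v) (\<phi> v w)) \<and>
       (\<forall>v\<in>verts G. \<forall>w\<in>verts G. \<forall>h\<in>half_edges G v w. \<phi> v w (p h) = p (opp G h)) \<and>
       (\<forall>v\<in>verts G. \<forall>w\<in>verts G. \<forall>q\<in>C w. inv_into (C v) (\<phi> v w) q = \<phi> w v q) \<and>
       (\<forall>u\<in>verts G. \<forall>v\<in>verts G. \<forall>w\<in>verts G. \<forall>q\<in>C v. \<phi> v u q = \<phi> w u (\<phi> v w q))))"

end

theory Submission
  imports Defs
begin

text \<open>
  Choose distinct parameters \<open>t\<^sub>e \<in> k\<close>, one for each edge \<open>e\<close>, and glue copies of the projective line,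
  one for each vertex, the copies at the ends of \<open>e\<close> being glued along the points with parameter
  \<open>t\<^sub>e\<close>. All the marked curves are then the same, so that the identity maps show the curve to be
  special.

  To realize the curve in projective space, choose polynomials \<open>P\<^sub>v\<close> of one and the same degree
  \<open>m\<close> such that \<open>t\<^sub>e\<close> is a simple root of \<open>P\<^sub>v\<close> for the edges \<open>e\<close> at \<open>v\<close>, and such that two of
  these polynomials have no other common roots. The copy of the projective line that belongs to \<open>v\<close>
  is embedded as a rational normal curve of degree \<open>m\<close> with one additional coordinate, of its own,
  given by \<open>P\<^sub>v\<close>. The copies for \<open>v\<close> and \<open>w\<close> meet exactly in the common roots of \<open>P\<^sub>v\<close> and
  \<open>P\<^sub>w\<close>. There the additional coordinate of \<open>v\<close> is a uniformizer of the first branch and vanishes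
  on the second, so both branches have independent tangents and the point is a node.
\<close>

section \<open>Forms\<close>

text \<open>The first \<open>m + 1\<close> coordinates are the same for all copies, so by themselves
  they would put every copy onto one rational normal curve, and affine points can only be identified
  if they have the same parameter. This is why each edge gets a parameter of its own and why the
  private coordinates alone decide what is glued: for distinct vertices the points with parameter
  \<open>t\<close> coincide iff both polynomials vanish at \<open>t\<close>. At infinity the private
  coordinate is the coefficient at degree \<open>m\<close>, so exact degree \<open>m\<close> keeps
  the copies apart there. The parameter of an edge belongs only to its two ends, so at most two
  branches meet.

  A node is defined by comparing the local ring with power series. Along each branch a regular
  function is a quotient of polynomials, so it can be replaced by its two Taylor expansions, and
  \<open>k[[x,y]]/(xy)\<close> becomes the ring of pairs of series with equal constant terms. The
  marking must list all nodes, so it also has to be shown that a regular point is never a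
  node.\<close>

text \<open>\<open>form\<close> sums over a set of exponent vectors, so equal vectors have to be
  merged: the new coefficient is the sum over a fibre of \<open>e\<close>. Afterwards sums and
  products of forms can be indexed freely.\<close>

lemma form_family:
  assumes "finite I" "\<And>i. i \<in> I \<Longrightarrow> (\<Sum>j\<le>N. e i j) = d"
  shows "form d (\<lambda>x. \<Sum>i\<in>I. c i * (\<Prod>j\<le>N. x j ^ (e i j :: nat)))"
proof -
  have "(\<lambda>x. \<Sum>i\<in>I. c i * (\<Prod>j\<le>N. x j ^ e i j)) =
      (\<lambda>x. \<Sum>a\<in>e ` I. (\<Sum>i\<in>{i\<in>I. e i = a}. c i) * (\<Prod>j\<le>N. x j ^ a j))" (is "?l = ?r")
  proof
    fix x
    have "?l x = (\<Sum>a\<in>e ` I. \<Sum>i\<in>{i\<in>I. e i = a}. c i * (\<Prod>j\<le>N. x j ^ e i j))"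
      by (rule sum.image_gen[OF assms(1)])
    also have "\<dots> = ?r x"
      by (rule sum.cong) (auto simp: sum_distrib_right intro!: sum.cong)
    finally show "?l x = ?r x" .
  qed
  then show ?thesis
    unfolding form_def using assms
    by (intro exI[of _ N] exI[of _ "e ` I"] exI[of _ "\<lambda>a. \<Sum>i\<in>{i\<in>I. e i = a}. c i"]) auto
qed

text \<open>Over a fixed range of variables two forms can be combined termwise. The exponents are a
  family \<open>e\<close> over the index set: the values of \<open>a\<close> beyond its original
  range are arbitrary and must be cut off before the range grows, after which different vectors may
  agree.\<close>

definition form_upto :: "nat \<Rightarrow> nat \<Rightarrow> ((nat \<Rightarrow> 'k::field) \<Rightarrow> 'k) \<Rightarrow> bool" where
  "form_upto N d F \<longleftrightarrow> (\<exists>(A :: (nat \<Rightarrow> nat) set) e c. finite A \<and> (\<forall>a\<in>A. (\<Sum>j\<le>N. e a j) = d) \<and>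
     F = (\<lambda>x. \<Sum>a\<in>A. c a * (\<Prod>j\<le>N. x j ^ (e a j :: nat))))"

lemma form_imp_form_upto:
  assumes "form d F" shows "\<exists>N0. \<forall>N\<ge>N0. form_upto N d F"
proof -
  obtain N0 A c where A: "finite A" "\<forall>a\<in>A. (\<Sum>i\<le>N0. a i) = d"
    and F: "F = (\<lambda>x. \<Sum>a\<in>A. c a * (\<Prod>i\<le>N0. x i ^ (a i :: nat)))"
    using assms unfolding form_def by blast
  have "form_upto N d F" if N: "N \<ge> N0" for N
  proof -
    define e where "e a j = (if j \<le> N0 then a j else 0)" for a :: "nat \<Rightarrow> nat" and j
    have sub: "{..N0} \<subseteq> {..N}" using N by auto
    have 1: "(\<Sum>j\<le>N. e a j) = (\<Sum>j\<le>N0. a j)" for a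
      by (rule sum.mono_neutral_cong_right) (use sub in \<open>auto simp: e_def\<close>)
    have 2: "(\<Prod>j\<le>N. x j ^ e a j) = (\<Prod>j\<le>N0. x j ^ a j)" for a and x :: "nat \<Rightarrow> 'a"
      by (rule prod.mono_neutral_cong_right) (use sub in \<open>auto simp: e_def\<close>)
    show ?thesis unfolding form_upto_def
      by (rule exI[of _ A], rule exI[of _ e], rule exI[of _ c]) (use A F 1 2 in auto)
  qed
  then show ?thesis by blast
qed

lemma form_common_index:
  assumes "form d F" "form d' G"
  shows "\<exists>N. form_upto N d F \<and> form_upto N d' G"
  using form_imp_form_upto[OF assms(1)] form_imp_form_upto[OF assms(2)]
  by (meson le_cases order_refl)

lemma form_add:
  assumes "form d F" "form d G" shows "form d (\<lambda>x. F x + G x)"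
proof -
  obtain N where N: "form_upto N d F" "form_upto N d G" using form_common_index[OF assms] by blast
  obtain A e c where A: "finite (A :: (nat \<Rightarrow> nat) set)" "\<forall>a\<in>A. (\<Sum>j\<le>N. e a j) = d"
    "F = (\<lambda>x. \<Sum>a\<in>A. c a * (\<Prod>j\<le>N. x j ^ (e a j :: nat)))"
    using N(1) unfolding form_upto_def by blast
  obtain B f k where B: "finite (B :: (nat \<Rightarrow> nat) set)" "\<forall>a\<in>B. (\<Sum>j\<le>N. f a j) = d"
    "G = (\<lambda>x. \<Sum>a\<in>B. k a * (\<Prod>j\<le>N. x j ^ (f a j :: nat)))"
    using N(2) unfolding form_upto_def by blast
  have "form d (\<lambda>x. \<Sum>i\<in>A <+> B. case_sum c k i * (\<Prod>j\<le>N. x j ^ (case_sum e f i j)))"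
    by (rule form_family) (use A B in auto)
  then show ?thesis
    unfolding A(3) B(3) using A(1) B(1) by (simp add: sum.Plus o_def)
qed

lemma form_mult:
  assumes "form d F" "form d' G" shows "form (d + d') (\<lambda>x. F x * G x)"
proof -
  obtain N where N: "form_upto N d F" "form_upto N d' G" using form_common_index[OF assms] by blast
  obtain A e c where A: "finite (A :: (nat \<Rightarrow> nat) set)" "\<forall>a\<in>A. (\<Sum>j\<le>N. e a j) = d"
    "F = (\<lambda>x. \<Sum>a\<in>A. c a * (\<Prod>j\<le>N. x j ^ (e a j :: nat)))"
    using N(1) unfolding form_upto_def by blast
  obtain B f k where B: "finite (B :: (nat \<Rightarrow> nat) set)" "\<forall>a\<in>B. (\<Sum>j\<le>N. f a j) = d'"
    "G = (\<lambda>x. \<Sum>a\<in>B. k a * (\<Prod>j\<le>N. x j ^ (f a j :: nat)))"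
    using N(2) unfolding form_upto_def by blast
  have "form (d + d') (\<lambda>x. \<Sum>i\<in>A \<times> B. (c (fst i) * k (snd i)) *
      (\<Prod>j\<le>N. x j ^ (e (fst i) j + f (snd i) j)))"
    by (rule form_family) (use A B in \<open>auto simp: sum.distrib\<close>)
  also have "(\<lambda>x. \<Sum>i\<in>A \<times> B. (c (fst i) * k (snd i)) *
      (\<Prod>j\<le>N. x j ^ (e (fst i) j + f (snd i) j))) = (\<lambda>x. F x * G x)"
    unfolding A(3) B(3) sum_product sum.cartesian_product
    by (intro ext sum.cong) (auto simp: power_add prod.distrib mult_ac)
  finally show ?thesis .
qed

lemma form_const: "form 0 (\<lambda>x. c)"
  using form_family[where I = "{()}" and N = 0 and e = "\<lambda>_ _. 0" and d = 0 and c = "\<lambda>_. c"] by simp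

lemma form_zero: "form d (\<lambda>x. 0)"
  using form_family[where I = "{} :: unit set" and N = 0 and e = "\<lambda>_ _. 0"] by simp

lemma form_var: "form 1 (\<lambda>x :: nat \<Rightarrow> 'k::field. x i)"
proof -
  have "(\<Prod>j\<le>i. x j ^ (if j = i then 1 else 0)) = x i" for x :: "nat \<Rightarrow> 'k"
  proof -
    have "(\<Prod>j\<le>i. x j ^ (if j = i then 1 else 0)) = (\<Prod>j\<le>i. if j = i then x j else 1)"
      by (rule prod.cong) auto
    then show ?thesis by simp
  qed
  then show ?thesis
    using form_family[where I = "{()}" and N = i and e = "\<lambda>_ j. if j = i then 1 else 0"
        and d = 1 and c = "\<lambda>_. 1 :: 'k"] by simp
qed

lemma form_cmult: "form d F \<Longrightarrow> form d (\<lambda>x. c * F x)"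
  using form_mult[OF form_const] by fastforce

lemma form_diff: "form d F \<Longrightarrow> form d G \<Longrightarrow> form d (\<lambda>x. F x - G x)"
  using form_add[of d F "\<lambda>x. (-1) * G x"] form_cmult[of d G "-1"] by simp

lemma form_sum: "(\<And>i. i \<in> I \<Longrightarrow> form d (F i)) \<Longrightarrow> form d (\<lambda>x. \<Sum>i\<in>I. F i x)"
  by (induction I rule: infinite_finite_induct) (auto simp: form_zero intro: form_add)

lemma form_prod:
  assumes "finite I" "\<And>i. i \<in> I \<Longrightarrow> form (d i) (F i)"
  shows "form (\<Sum>i\<in>I. d i) (\<lambda>x. \<Prod>i\<in>I. F i x)"
  using assms by (induction I rule: finite_induct) (auto simp: form_const intro: form_mult)

lemma form_power: "form d F \<Longrightarrow> form (n * d) (\<lambda>x. F x ^ n)"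
  by (induction n) (auto simp: form_const intro: form_mult)

lemma form_compose:
  assumes F: "form d F" and \<Phi>: "\<And>i. form m (\<lambda>x. \<Phi> x i)"
  shows "form (d * m) (\<lambda>x. F (\<Phi> x))"
proof -
  obtain N A c where A: "finite A" "\<forall>a\<in>A. (\<Sum>i\<le>N. a i) = d"
    and F: "F = (\<lambda>x. \<Sum>a\<in>A. c a * (\<Prod>i\<le>N. x i ^ (a i :: nat)))"
    using F unfolding form_def by blast
  have "form (d * m) (\<lambda>x. \<Prod>i\<le>N. \<Phi> x i ^ (a i))" if "a \<in> A" for a
  proof -
    have "form (\<Sum>i\<le>N. a i * m) (\<lambda>x. \<Prod>i\<le>N. \<Phi> x i ^ (a i))"
      by (intro form_prod form_power \<Phi>) auto
    then show ?thesis using A(2) that by (simp add: sum_distrib_right[symmetric])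
  qed
  then show ?thesis unfolding F by (intro form_sum form_cmult)
qed

lemma form_scale:
  assumes "form d F" shows "F (\<lambda>i. c * x i) = c ^ d * F x"
proof -
  obtain N A k where A: "finite A" "\<forall>a\<in>A. (\<Sum>i\<le>N. a i) = d"
    and F: "F = (\<lambda>x. \<Sum>a\<in>A. k a * (\<Prod>i\<le>N. x i ^ (a i :: nat)))"
    using assms unfolding form_def by blast
  have "(\<Prod>i\<le>N. (c * x i) ^ a i) = c ^ d * (\<Prod>i\<le>N. x i ^ a i)" if "a \<in> A" for a
    using A that by (simp add: power_mult_distrib prod.distrib power_sum[symmetric])
  then show ?thesis unfolding F by (simp add: sum_distrib_left mult_ac)
qed

text \<open>Reduces closed sets and regular functions along a curve with polynomial coordinates to
  polynomials in one variable.\<close>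

lemma form_poly_along:
  assumes "form d F" and "\<And>i. \<exists>a. \<forall>\<tau>. c \<tau> i = poly a \<tau>"
  shows "\<exists>A. \<forall>\<tau>. F (c \<tau>) = poly A \<tau>"
proof -
  obtain N A k where F: "F = (\<lambda>x. \<Sum>a\<in>A. k a * (\<Prod>i\<le>N. x i ^ (a i :: nat)))"
    using assms unfolding form_def by blast
  obtain q where q: "\<And>i \<tau>. c \<tau> i = poly (q i) \<tau>" using assms(2) by metis
  show ?thesis
    by (rule exI[of _ "\<Sum>a\<in>A. smult (k a) (\<Prod>i\<le>N. q i ^ a i)"])
       (simp add: F q poly_sum poly_prod)
qed

text \<open>\<open>d\<close> may exceed the degree of \<open>A\<close>, so that numerator and
  denominator of a fraction can be brought to the same degree.\<close>

definition homogenize :: "'k::field poly \<Rightarrow> nat \<Rightarrow> 'k \<Rightarrow> 'k \<Rightarrow> 'k" where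
  "homogenize A d s t = (\<Sum>i\<le>d. coeff A i * s ^ (d - i) * t ^ i)"

lemma form_homogenize:
  assumes "form m L" "form m M" shows "form (d * m) (\<lambda>x. homogenize A d (M x) (L x))"
proof -
  have "form (d * m) (\<lambda>x. coeff A i * (M x ^ (d - i) * L x ^ i))" if "i \<le> d" for i
  proof -
    have "form ((d - i) * m + i * m) (\<lambda>x. M x ^ (d - i) * L x ^ i)"
      by (intro form_mult form_power assms)
    then show ?thesis using that by (intro form_cmult) (simp add: add_mult_distrib[symmetric])
  qed
  then show ?thesis unfolding homogenize_def by (intro form_sum) (simp add: mult.assoc)
qed

lemma homogenize_eq:
  assumes "degree A \<le> d" "s \<noteq> 0" shows "homogenize A d s t = s ^ d * poly A (t / s)"
proof -
  have "poly A (t / s) = (\<Sum>i\<le>d. coeff A i * (t / s) ^ i)"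
    unfolding poly_altdef using assms(1)
    by (intro sum.mono_neutral_left) (auto simp: coeff_eq_0)
  moreover have "s ^ d * (coeff A i * (t / s) ^ i) = coeff A i * s ^ (d - i) * t ^ i" if "i \<le> d" for i
  proof -
    have "s ^ d = s ^ (d - i) * s ^ i" using that by (simp add: power_add[symmetric])
    then show ?thesis using assms(2) by (simp add: field_simps)
  qed
  ultimately show ?thesis unfolding homogenize_def
    by (simp only: sum_distrib_left) (rule sum.cong, simp_all only: atMost_iff)
qed

lemma homogenize_one: "degree A \<le> d \<Longrightarrow> homogenize A d 1 t = poly A t"
  using homogenize_eq[of A d 1 t] by simp

lemma homogenize_zero_left: "homogenize A d 0 t = coeff A d * t ^ d"
proof -
  have "homogenize A d 0 t = (\<Sum>i\<le>d. if i = d then coeff A d * t ^ d else 0)"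
    unfolding homogenize_def by (rule sum.cong) auto
  then show ?thesis by simp
qed

section \<open>Points and algebraic sets\<close>

lemma self_in_line: "x \<in> line x"
  unfolding line_def by (rule CollectI) (rule exI[of _ 1], simp)

lemma in_lineE:
  assumes "y \<in> line x" obtains c where "c \<noteq> 0" "y = (\<lambda>i. c * x i)"
  using assms unfolding line_def by auto

lemma line_eq_scaled: "c \<noteq> 0 \<Longrightarrow> line (\<lambda>i. c * x i) = line x"
  unfolding line_def
proof (intro set_eqI iffI; clarsimp)
  fix d :: 'a assume "c \<noteq> 0" "d \<noteq> 0"
  then show "\<exists>e. (\<lambda>i. d * (c * x i)) = (\<lambda>i. e * x i) \<and> e \<noteq> 0"
    by (intro exI[of _ "d * c"]) (auto simp: mult.assoc)
next
  fix d :: 'a assume "c \<noteq> 0" "d \<noteq> 0"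
  then show "\<exists>e. (\<lambda>i. d * x i) = (\<lambda>i. e * (c * x i)) \<and> e \<noteq> 0"
    by (intro exI[of _ "d / c"]) auto
qed

lemma line_eqE:
  assumes "line x = line y" obtains c where "c \<noteq> 0" "x = (\<lambda>i. c * y i)"
  using self_in_line[of x] assms in_lineE by metis

lemma line_of_mem: "y \<in> line x \<Longrightarrow> line y = line x"
  by (erule in_lineE) (simp add: line_eq_scaled)

lemma line_in_proj_space:
  "line x \<in> proj_space n \<longleftrightarrow> (\<exists>i. x i \<noteq> 0) \<and> (\<forall>i>n. x i = 0)"
proof
  assume "line x \<in> proj_space n"
  then obtain y where "line x = line y" "\<exists>i. y i \<noteq> 0" "\<forall>i>n. y i = 0"
    unfolding proj_space_def by auto
  moreover obtain c where "c \<noteq> 0" "x = (\<lambda>i. c * y i)"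
    using \<open>line x = line y\<close> by (rule line_eqE)
  ultimately show "(\<exists>i. x i \<noteq> 0) \<and> (\<forall>i>n. x i = 0)" by auto
qed (auto simp: proj_space_def)

lemma proj_spaceE:
  assumes "p \<in> proj_space n"
  obtains x where "p = line x" "\<exists>i. x i \<noteq> 0" "\<forall>i>n. x i = 0"
  using assms unfolding proj_space_def by auto

lemma proj_space_mono: "m \<le> n \<Longrightarrow> proj_space m \<subseteq> proj_space n"
  unfolding proj_space_def by (intro image_mono Collect_mono) auto

lemma form_vanishes_on_line:
  assumes "form d F" shows "(\<forall>y\<in>line x. F y = 0) \<longleftrightarrow> F x = 0"
proof
  assume F: "F x = 0"
  then show "\<forall>y\<in>line x. F y = 0" by (auto simp: form_scale[OF assms] elim: in_lineE)
qed (use self_in_line in blast)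

lemma form_ratio_on_line:
  "form d F \<Longrightarrow> form d G \<Longrightarrow> y \<in> line x \<Longrightarrow> F y / G y = F x / G x"
  by (erule in_lineE) (simp add: form_scale)

text \<open>Adjoining the coordinates beyond \<open>n\<close> to the equations makes them cut out
  \<open>W\<close> in every \<open>proj_space m\<close> at once, so the ambient dimension can be
  forgotten.\<close>

lemma proj_algebraicE:
  fixes W :: "'k::field ppoint set"
  assumes "proj_algebraic W"
  obtains n T where "W \<subseteq> proj_space n" "\<forall>F\<in>T. \<exists>d. form d F"
    "\<forall>m x. line x \<in> proj_space m \<longrightarrow> (line x \<in> W \<longleftrightarrow> (\<forall>F\<in>T. F x = 0))"
proof -
  obtain n T where T: "\<forall>F\<in>T. \<exists>d. form d F"
    and W: "W = {p \<in> proj_space n. \<forall>F\<in>T. \<forall>x\<in>p. F x = 0}"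
    using assms unfolding proj_algebraic_def by blast
  let ?T = "T \<union> {\<lambda>x. x i | i. i > n}"
  show ?thesis
  proof (rule that[of n ?T]; (intro allI impI ballI)?)
    fix m and x :: "nat \<Rightarrow> 'k" assume x: "line x \<in> proj_space m"
    have "(\<forall>F\<in>T. \<forall>y\<in>line x. F y = 0) \<longleftrightarrow> (\<forall>F\<in>T. F x = 0)"
      using T form_vanishes_on_line by blast
    moreover have "(\<forall>F\<in>{\<lambda>x. x i | i. i > n}. F x = 0) \<longleftrightarrow> (\<forall>i>n. x i = 0)"
      by auto
    ultimately show "line x \<in> W \<longleftrightarrow> (\<forall>F\<in>?T. F x = 0)"
      using x unfolding W ball_Un by (simp add: line_in_proj_space) blast
  next
    fix F assume "F \<in> ?T"
    then show "\<exists>d. form d F" using T form_var by auto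
  qed (use W in auto)
qed

lemma proj_algebraicI:
  assumes n: "W \<subseteq> proj_space n" and T: "\<And>F. F \<in> T \<Longrightarrow> \<exists>d. form d F"
    and W: "\<And>x. line x \<in> proj_space n \<Longrightarrow> line x \<in> W \<longleftrightarrow> (\<forall>F\<in>T. F x = 0)"
  shows "proj_algebraic W"
proof -
  have "p \<in> W \<longleftrightarrow> (\<forall>F\<in>T. \<forall>x\<in>p. F x = 0)" if p: "p \<in> proj_space n" for p
  proof -
    obtain x where x: "p = line x" using p by (rule proj_spaceE)
    have "(\<forall>F\<in>T. \<forall>y\<in>line x. F y = 0) \<longleftrightarrow> (\<forall>F\<in>T. F x = 0)"
      using T form_vanishes_on_line by blast
    then show ?thesis using W p unfolding x by blast
  qed
  then have "W = {p \<in> proj_space n. \<forall>F\<in>T. \<forall>x\<in>p. F x = 0}"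
    using n by blast
  then show "proj_algebraic W" unfolding proj_algebraic_def using T by blast
qed

lemma proj_algebraic_vanishing:
  assumes "\<forall>F\<in>T. \<exists>d. form d F"
  shows "proj_algebraic {p \<in> proj_space n. \<forall>F\<in>T. \<forall>x\<in>p. F x = 0}"
  using assms unfolding proj_algebraic_def by blast

lemma proj_algebraic_proj_space: "proj_algebraic (proj_space n)"
  using proj_algebraic_vanishing[of "{}" n] by simp

lemma proj_algebraic_empty: "proj_algebraic {}"
  by (rule proj_algebraicI[of _ 0 "{\<lambda>x. 1}"]) (auto intro: form_const)

lemma proj_algebraic_Un:
  assumes "proj_algebraic W" "proj_algebraic W'" shows "proj_algebraic (W \<union> W')"
proof -
  obtain n T where n: "W \<subseteq> proj_space n" and T: "\<forall>F\<in>T. \<exists>d. form d F"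
    and W: "\<forall>m x. line x \<in> proj_space m \<longrightarrow> (line x \<in> W \<longleftrightarrow> (\<forall>F\<in>T. F x = 0))"
    using assms(1) by (rule proj_algebraicE)
  obtain n' T' where n': "W' \<subseteq> proj_space n'" and T': "\<forall>F\<in>T'. \<exists>d. form d F"
    and W': "\<forall>m x. line x \<in> proj_space m \<longrightarrow> (line x \<in> W' \<longleftrightarrow> (\<forall>F\<in>T'. F x = 0))"
    using assms(2) by (rule proj_algebraicE)
  show ?thesis
  proof (rule proj_algebraicI[of _ "max n n'" "(\<lambda>(F, G) x. F x * G x) ` (T \<times> T')"])
    show "W \<union> W' \<subseteq> proj_space (max n n')"
      using n n' proj_space_mono[of n "max n n'"] proj_space_mono[of n' "max n n'"] by auto
    show "\<exists>d. form d F" if "F \<in> (\<lambda>(F, G) x. F x * G x) ` (T \<times> T')" for F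
    proof -
      obtain z where z: "z \<in> T \<times> T'" "F = (\<lambda>(F, G) x. F x * G x) z" using \<open>F \<in> _\<close> by (rule imageE) blast
      obtain d e where "form d (fst z)" "form e (snd z)"
        using bspec[OF T, of "fst z"] bspec[OF T', of "snd z"] z(1) unfolding mem_Times_iff by blast
      then have "form (d + e) (\<lambda>x. fst z x * snd z x)" by (rule form_mult)
      then show ?thesis using z(2) by (auto simp: case_prod_beta)
    qed
    show "line x \<in> W \<union> W' \<longleftrightarrow> (\<forall>F\<in>(\<lambda>(F, G) x. F x * G x) ` (T \<times> T'). F x = 0)"
      if "line x \<in> proj_space (max n n')" for x
      unfolding Un_iff W[rule_format, OF that] W'[rule_format, OF that] by auto
  qed
qed

lemma proj_algebraic_UN:
  "finite I \<Longrightarrow> (\<And>i. i \<in> I \<Longrightarrow> proj_algebraic (W i)) \<Longrightarrow> proj_algebraic (\<Union>i\<in>I. W i)"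
  by (induction I rule: finite_induct) (auto simp: proj_algebraic_empty intro: proj_algebraic_Un)

lemma proj_algebraic_point:
  assumes "p \<in> proj_space n" shows "proj_algebraic {p}"
proof -
  obtain x where x: "p = line x" "\<exists>i. x i \<noteq> 0" "\<forall>i>n. x i = 0" using assms by (rule proj_spaceE)
  \<comment> \<open>These are the 2x2 minors of the matrix with rows \<open>x\<close> and
    \<open>y\<close>; they vanish iff \<open>y\<close> is proportional to \<open>x\<close>.\<close>
  let ?T = "{\<lambda>y. x i * y j - x j * y i | i j. True}"
  have "line y \<in> {p} \<longleftrightarrow> (\<forall>F\<in>?T. F y = 0)" if "line y \<in> proj_space m" for m y
  proof
    assume "line y \<in> {p}"
    then have "line y = line x" using x by simp
    then obtain c where "c \<noteq> 0" "y = (\<lambda>i. c * x i)" by (rule line_eqE)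
    then show "\<forall>F\<in>?T. F y = 0" by auto
  next
    assume *: "\<forall>F\<in>?T. F y = 0"
    have eq: "x i * y j = x j * y i" for i j
    proof -
      have "(\<lambda>y. x i * y j - x j * y i) \<in> ?T" by blast
      from * [rule_format, OF this] show ?thesis by simp
    qed
    obtain k where k: "x k \<noteq> 0" using x by blast
    have y: "y = (\<lambda>j. (y k / x k) * x j)"
      using eq[of k] k by (auto simp: field_simps)
    moreover have "y k \<noteq> 0" using that y by (auto simp: line_in_proj_space)
    ultimately have "line y = line x"
      using line_eq_scaled[of "y k / x k" x] k by simp
    then show "line y \<in> {p}" using x by simp
  qed
  moreover have "\<exists>d. form d F" if "F \<in> ?T" for F
    using that form_diff[OF form_cmult[OF form_var] form_cmult[OF form_var]] by blast
  moreover have "{p} \<subseteq> proj_space n" using assms by simp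
  ultimately show ?thesis by (intro proj_algebraicI[of "{p}" n ?T])
qed

lemma proj_algebraic_finite:
  assumes "finite S" "S \<subseteq> proj_space n" shows "proj_algebraic S"
  using proj_algebraic_UN[of S "\<lambda>p. {p}"] assms proj_algebraic_point by auto

lemma proj_algebraic_hypersurface:
  assumes "form d F" "X \<subseteq> proj_space n"
  obtains W where "proj_algebraic W" "\<And>x. line x \<in> X \<Longrightarrow> line x \<in> W \<longleftrightarrow> F x = 0"
proof (rule that)
  show "proj_algebraic {p \<in> proj_space n. \<forall>F\<in>{F}. \<forall>x\<in>p. F x = 0}"
    using assms(1) by (intro proj_algebraic_vanishing) auto
  show "line x \<in> {p \<in> proj_space n. \<forall>F\<in>{F}. \<forall>x\<in>p. F x = 0} \<longleftrightarrow> F x = 0" if "line x \<in> X" for x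
    using assms form_vanishes_on_line[OF assms(1), of x] that by auto
qed

lemma zopen_self: "zopen X X"
  unfolding zopen_def using proj_algebraic_empty by blast

lemma zopen_Int: "zopen X U \<Longrightarrow> zopen X V \<Longrightarrow> zopen X (U \<inter> V)"
  unfolding zopen_def using proj_algebraic_Un by (metis Diff_Un)

section \<open>Regular functions and morphisms\<close>

lemma regular_atI:
  assumes "X \<subseteq> proj_space n" "p \<in> X" "form d F" "form d G" "proj_algebraic W" "p \<notin> W"
    and "\<And>x. line x \<in> X \<Longrightarrow> line x \<notin> W \<Longrightarrow> G x \<noteq> 0 \<and> f (line x) = F x / G x"
  shows "regular_at X p f"
proof -
  have "G x \<noteq> 0 \<and> f q = F x / G x" if "q \<in> X - W" "x \<in> q" for q x
  proof -
    obtain y where "q = line y" using \<open>q \<in> X - W\<close> assms(1) proj_spaceE by blast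
    then have "q = line x" using that line_of_mem by blast
    then show ?thesis using assms(7)[of x] that by blast
  qed
  then show ?thesis unfolding regular_at_def zopen_def using assms(2-6) by blast
qed

lemma regular_atE:
  assumes "regular_at X p f"
  obtains W d F G where "proj_algebraic W" "p \<in> X" "p \<notin> W" "form d F" "form d G"
    "\<forall>x. line x \<in> X \<longrightarrow> line x \<notin> W \<longrightarrow> G x \<noteq> 0 \<and> f (line x) = F x / G x"
proof -
  obtain U d F G where U: "zopen X U" "p \<in> U" "form d F" "form d G"
    "\<forall>q\<in>U. \<forall>x\<in>q. G x \<noteq> 0 \<and> f q = F x / G x"
    using assms unfolding regular_at_def by blast
  obtain W where "proj_algebraic W" "U = X - W" using U unfolding zopen_def by blast
  then show ?thesis using U self_in_line by (intro that[of W d F G]) auto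
qed

lemma regular_at_cong:
  assumes "\<And>q. q \<in> X \<Longrightarrow> f q = g q" "regular_at X p f" shows "regular_at X p g"
proof -
  obtain U d F G where U: "zopen X U" "p \<in> U" "form d F" "form d G"
    "\<forall>q\<in>U. \<forall>x\<in>q. G x \<noteq> 0 \<and> f q = F x / G x"
    using assms unfolding regular_at_def by blast
  have "U \<subseteq> X" using U unfolding zopen_def by blast
  then have "\<forall>q\<in>U. \<forall>x\<in>q. G x \<noteq> 0 \<and> g q = F x / G x" using U(5) assms(1) by (metis subsetD)
  then show ?thesis unfolding regular_at_def using U by blast
qed

lemma regular_at_const:
  assumes "p \<in> X" shows "regular_at X p (\<lambda>q. c)"
  unfolding regular_at_def
  by (rule exI[of _ X], rule exI[of _ 0], rule exI[of _ "\<lambda>x. c"], rule exI[of _ "\<lambda>x. 1"])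
     (use assms in \<open>simp add: zopen_self form_const\<close>)

lemma regular_at_add:
  assumes "regular_at X p f" "regular_at X p g" shows "regular_at X p (\<lambda>q. f q + g q)"
proof -
  obtain U d F G where U: "zopen X U" "p \<in> U" "form d F" "form d G"
    "\<forall>q\<in>U. \<forall>x\<in>q. G x \<noteq> 0 \<and> f q = F x / G x"
    using assms(1) unfolding regular_at_def by blast
  obtain V e H K where V: "zopen X V" "p \<in> V" "form e H" "form e K"
    "\<forall>q\<in>V. \<forall>x\<in>q. K x \<noteq> 0 \<and> g q = H x / K x"
    using assms(2) unfolding regular_at_def by blast
  have "form (d + e) (\<lambda>x. F x * K x + G x * H x)" "form (d + e) (\<lambda>x. G x * K x)"
    using U V by (auto intro!: form_add form_mult)
  moreover have "\<forall>q\<in>U \<inter> V. \<forall>x\<in>q. G x * K x \<noteq> 0 \<and>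
      f q + g q = (F x * K x + G x * H x) / (G x * K x)"
    using U(5) V(5) by (auto simp: add_frac_eq mult_ac)
  ultimately show ?thesis unfolding regular_at_def
    using zopen_Int[OF U(1) V(1)] U(2) V(2) by blast
qed

lemma regular_at_mult:
  assumes "regular_at X p f" "regular_at X p g" shows "regular_at X p (\<lambda>q. f q * g q)"
proof -
  obtain U d F G where U: "zopen X U" "p \<in> U" "form d F" "form d G"
    "\<forall>q\<in>U. \<forall>x\<in>q. G x \<noteq> 0 \<and> f q = F x / G x"
    using assms(1) unfolding regular_at_def by blast
  obtain V e H K where V: "zopen X V" "p \<in> V" "form e H" "form e K"
    "\<forall>q\<in>V. \<forall>x\<in>q. K x \<noteq> 0 \<and> g q = H x / K x"
    using assms(2) unfolding regular_at_def by blast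
  have "form (d + e) (\<lambda>x. F x * H x)" "form (d + e) (\<lambda>x. G x * K x)"
    using U V by (auto intro!: form_mult)
  moreover have "\<forall>q\<in>U \<inter> V. \<forall>x\<in>q. G x * K x \<noteq> 0 \<and> f q * g q = (F x * H x) / (G x * K x)"
    using U(5) V(5) by auto
  ultimately show ?thesis unfolding regular_at_def
    using zopen_Int[OF U(1) V(1)] U(2) V(2) by blast
qed

text \<open>The representative of \<open>q\<close> is arbitrary; for forms \<open>L\<close> and
  \<open>M\<close> of one degree the value does not depend on it.\<close>

definition frac :: "((nat \<Rightarrow> 'k::field) \<Rightarrow> 'k) \<Rightarrow> ((nat \<Rightarrow> 'k) \<Rightarrow> 'k) \<Rightarrow> 'k ppoint \<Rightarrow> 'k" where
  "frac L M q = (let x = SOME x. x \<in> q in L x / M x)"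

lemma frac_line:
  assumes "form d L" "form d M" shows "frac L M (line x) = L x / M x"
proof -
  have "(SOME y. y \<in> line x) \<in> line x" by (rule someI[of "\<lambda>y. y \<in> line x"], rule self_in_line)
  then show ?thesis unfolding frac_def Let_def by (rule form_ratio_on_line[OF assms])
qed

text \<open>Homogenizing \<open>A\<close> and \<open>B\<close> in \<open>(M, L)\<close> to one
  common degree \<open>N\<close> turns the quotient into a quotient of forms of equal degree, as the
  factors \<open>M ^ N\<close> cancel.\<close>

lemma regular_at_ratfun:
  assumes X: "X \<subseteq> proj_space n" "line x \<in> X" and LM: "form d L" "form d M"
    and nz: "M x \<noteq> 0" "poly B (frac L M (line x)) \<noteq> 0"
  shows "regular_at X (line x) (\<lambda>q. poly A (frac L M q) / poly B (frac L M q))"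
proof -
  define N where "N = max (degree A) (degree B)"
  define F where "F = (\<lambda>x. homogenize A N (M x) (L x))"
  define G where "G = (\<lambda>x. homogenize B N (M x) (L x))"
  have F: "form (N * d) F" and G: "form (N * d) G"
    unfolding F_def G_def by (auto intro: form_homogenize LM)
  have e: "F y = M y ^ N * poly A (L y / M y)" "G y = M y ^ N * poly B (L y / M y)" if "M y \<noteq> 0" for y
    unfolding F_def G_def using that by (auto simp: N_def homogenize_eq)
  \<comment> \<open>The zeros of \<open>M\<close> are removed together with those of
    \<open>G\<close>, since \<open>frac L M\<close> only has its intended value where
    \<open>M\<close> is nonzero.\<close>
  obtain W where W: "proj_algebraic W" "\<And>y. line y \<in> X \<Longrightarrow> line y \<in> W \<longleftrightarrow> M y * G y = 0"
    using proj_algebraic_hypersurface[OF form_mult[OF LM(2) G] X(1)] by blast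
  show ?thesis
  proof (rule regular_atI[OF X F G W(1)])
    show "line x \<notin> W" using W(2)[OF X(2)] e(2)[OF nz(1)] nz by (simp add: frac_line[OF LM])
    show "G y \<noteq> 0 \<and> poly A (frac L M (line y)) / poly B (frac L M (line y)) = F y / G y"
      if "line y \<in> X" "line y \<notin> W" for y
    proof -
      have "M y \<noteq> 0" "G y \<noteq> 0" using W(2) that by auto
      then show ?thesis using e[of y] by (simp add: frac_line[OF LM])
    qed
  qed
qed

lemma regular_at_frac:
  assumes "X \<subseteq> proj_space n" "line x \<in> X" "form d L" "form d M" "M x \<noteq> 0"
  shows "regular_at X (line x) (frac L M)"
  using regular_at_ratfun[OF assms, of "[:1:]" "[:0, 1:]"] by simp

text \<open>If the coordinates of \<open>\<Phi>\<close> are forms of one degree, all lines in this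
  union coincide, so no representative has to be chosen.\<close>

definition pmap :: "((nat \<Rightarrow> 'k::field) \<Rightarrow> (nat \<Rightarrow> 'k)) \<Rightarrow> 'k ppoint \<Rightarrow> 'k ppoint" where
  "pmap \<Phi> q = (\<Union>x\<in>q. line (\<Phi> x))"

lemma pmap_line:
  assumes "\<And>i. form m (\<lambda>x. \<Phi> x i)" shows "pmap \<Phi> (line x) = line (\<Phi> x)"
proof -
  have "line (\<Phi> y) = line (\<Phi> x)" if "y \<in> line x" for y
  proof -
    obtain c where c: "c \<noteq> 0" "y = (\<lambda>i. c * x i)" using \<open>y \<in> line x\<close> by (rule in_lineE)
    have "\<Phi> y = (\<lambda>i. c ^ m * \<Phi> x i)" using form_scale[OF assms] c by fastforce
    then show ?thesis using c by (simp add: line_eq_scaled)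
  qed
  then show ?thesis unfolding pmap_def using self_in_line[of x] by blast
qed

text \<open>Composition with \<open>\<Phi>\<close> multiplies degrees by \<open>m\<close>. Hence
  equations of closed sets pull back to forms, and a quotient of forms of equal degree pulls back to
  another such quotient.\<close>

lemma morphism_pmap:
  assumes \<Phi>: "\<And>i. form m (\<lambda>x. \<Phi> x i)"
    and X: "X \<subseteq> proj_space n" and Y: "Y \<subseteq> proj_space n'"
    and XY: "\<And>x. line x \<in> X \<Longrightarrow> line (\<Phi> x) \<in> Y"
  shows "morphism X Y (pmap \<Phi>)"
proof -
  note pl = pmap_line[of m \<Phi>, OF \<Phi>]
  have im: "pmap \<Phi> ` X \<subseteq> Y"
  proof clarify
    fix p assume "p \<in> X"
    then obtain x where "p = line x" using X proj_spaceE by blast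
    then show "pmap \<Phi> p \<in> Y" using XY \<open>p \<in> X\<close> by (simp add: pl)
  qed
  have pre: "\<exists>W'. proj_algebraic W' \<and> (\<forall>p\<in>X. p \<in> W' \<longleftrightarrow> pmap \<Phi> p \<in> W)" if W: "proj_algebraic W" for W
  proof -
    obtain m' T where "W \<subseteq> proj_space m'" and T: "\<forall>F\<in>T. \<exists>d. form d F"
      and WT: "\<forall>m x. line x \<in> proj_space m \<longrightarrow> (line x \<in> W \<longleftrightarrow> (\<forall>F\<in>T. F x = 0))"
      using W by (rule proj_algebraicE)
    let ?T = "(\<lambda>F x. F (\<Phi> x)) ` T"
    have T': "\<forall>F\<in>?T. \<exists>d. form d F"
    proof
      fix H assume "H \<in> ?T"
      then obtain F where F: "F \<in> T" "H = (\<lambda>x. F (\<Phi> x))" by blast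
      then obtain d where "form d F" using T by blast
      then have "form (d * m) H" unfolding F(2) by (rule form_compose[OF _ \<Phi>])
      then show "\<exists>d. form d H" by blast
    qed
    have "p \<in> {p \<in> proj_space n. \<forall>F\<in>?T. \<forall>x\<in>p. F x = 0} \<longleftrightarrow> pmap \<Phi> p \<in> W" if p: "p \<in> X" for p
    proof -
      obtain x where x: "p = line x" using X p proj_spaceE by blast
      have "(\<forall>y\<in>line x. F y = 0) \<longleftrightarrow> F x = 0" if "F \<in> ?T" for F
        using bspec[OF T' that] form_vanishes_on_line[of _ F x] by blast
      moreover have "line (\<Phi> x) \<in> W \<longleftrightarrow> (\<forall>F\<in>T. F (\<Phi> x) = 0)"
      proof -
        have "line (\<Phi> x) \<in> proj_space n'" using Y XY p x by auto
        then show ?thesis using WT by simp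
      qed
      ultimately show ?thesis using p X by (simp add: x pl subset_iff)
    qed
    then show ?thesis
      by (intro exI[of _ "{p \<in> proj_space n. \<forall>F\<in>?T. \<forall>x\<in>p. F x = 0}"] conjI ballI
          proj_algebraic_vanishing[OF T'])
  qed
  have "zopen X {p \<in> X. pmap \<Phi> p \<in> V}" if "zopen Y V" for V
  proof -
    obtain W where W: "proj_algebraic W" "V = Y - W" using \<open>zopen Y V\<close> unfolding zopen_def by blast
    obtain W' where W': "proj_algebraic W'" "\<forall>p\<in>X. p \<in> W' \<longleftrightarrow> pmap \<Phi> p \<in> W" using pre[OF W(1)] by blast
    have "{p \<in> X. pmap \<Phi> p \<in> V} = X - W'" using W W' im by blast
    then show ?thesis unfolding zopen_def using W' by blast
  qed
  moreover have "regular_at X p (\<lambda>p. f (pmap \<Phi> p))"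
    if "p \<in> X" and f: "regular_at Y (pmap \<Phi> p) f" for p f
  proof -
    obtain W d F G where W: "proj_algebraic W" "pmap \<Phi> p \<notin> W" "form d F" "form d G"
      "\<forall>x. line x \<in> Y \<longrightarrow> line x \<notin> W \<longrightarrow> G x \<noteq> 0 \<and> f (line x) = F x / G x"
      using f by (rule regular_atE)
    obtain W' where W': "proj_algebraic W'" "\<forall>p\<in>X. p \<in> W' \<longleftrightarrow> pmap \<Phi> p \<in> W" using pre[OF W(1)] by blast
    show ?thesis
    proof (rule regular_atI[OF X \<open>p \<in> X\<close> form_compose[OF W(3) \<Phi>] form_compose[OF W(4) \<Phi>] W'(1)])
      show "p \<notin> W'" using W'(2) W(2) \<open>p \<in> X\<close> by blast
      fix x assume "line x \<in> X" "line x \<notin> W'"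
      then show "G (\<Phi> x) \<noteq> 0 \<and> f (pmap \<Phi> (line x)) = F (\<Phi> x) / G (\<Phi> x)"
        using W(5)[rule_format, of "\<Phi> x"] XY[of x] W'(2) by (simp add: pl)
    qed
  qed
  ultimately show ?thesis unfolding morphism_def using im by blast
qed

lemma morphism_cong:
  assumes "morphism X Y f" "\<And>p. p \<in> X \<Longrightarrow> f p = g p" shows "morphism X Y g"
proof -
  have "f ` X = g ` X" using assms(2) by (rule image_cong[OF refl])
  moreover have "{p \<in> X. f p \<in> V} = {p \<in> X. g p \<in> V}" for V using assms(2) by auto
  moreover have "regular_at X p (\<lambda>p. h (g p))" if "regular_at X p (\<lambda>p. h (f p))" for p h
    using that by (rule regular_at_cong[rotated]) (simp add: assms(2))
  ultimately show ?thesis using assms unfolding morphism_def by metis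
qed

lemma morphism_id: "morphism X X (\<lambda>p. p)"
proof -
  have "{p \<in> X. p \<in> V} = V" if "zopen X V" for V using that unfolding zopen_def by blast
  then show ?thesis unfolding morphism_def by auto
qed

lemma isomorphism_id: "isomorphism X X (\<lambda>p. p)"
proof -
  have "inv_into X (\<lambda>p. p) q = q" if "q \<in> X" for q
    using f_inv_into_f[of q "\<lambda>p. p" X] that by simp
  then show ?thesis unfolding isomorphism_def
    using morphism_cong[OF morphism_id, of X "inv_into X (\<lambda>p. p)"] morphism_id[of X]
    by (simp add: bij_betw_def)
qed

section \<open>Expansions of rational functions\<close>

text \<open>Over a finite field the product of all \<open>[:- a, 1:]\<close>, plus one, would be a
  nonconstant polynomial without roots.\<close>

lemma infinite_UNIV_alg_closed: "infinite (UNIV :: 'k::alg_closed_field set)"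
proof
  assume fin: "finite (UNIV :: 'k set)"
  define p where "p = (\<Prod>a\<in>(UNIV :: 'k set). [:- a, 1:]) + 1"
  have p1: "poly p x = 1" for x
  proof -
    have "(\<Prod>a\<in>(UNIV :: 'k set). poly [:- a, 1:] x) = 0"
      by (rule prod_zero[OF fin]) (auto intro: bexI[of _ x])
    then show ?thesis by (simp add: p_def poly_prod)
  qed
  have "degree (\<Prod>a\<in>(UNIV :: 'k set). [:- a, 1:]) = card (UNIV :: 'k set)"
    by (subst degree_prod_eq_sum_degree) auto
  moreover have "card (UNIV :: 'k set) > 0" using fin by (simp add: card_gt_0_iff)
  ultimately have "degree p > 0" by (simp add: p_def degree_add_eq_left)
  then obtain x where "poly p x = 0" using alg_closed_imp_poly_has_root by blast
  then show False using p1 by simp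
qed

text \<open>The filter of Zariski neighbourhoods of the origin in the affine line.\<close>

definition near0 :: "'k::field filter" where
  "near0 = sup cofinite (principal {0})"

lemma eventually_near0: "eventually P near0 \<longleftrightarrow> P 0 \<and> finite {\<tau>. \<not> P \<tau>}"
  unfolding near0_def eventually_sup eventually_principal eventually_cofinite by auto

lemma poly_nonzero_near0: "poly B 0 \<noteq> 0 \<Longrightarrow> eventually (\<lambda>\<tau>. poly B \<tau> \<noteq> 0) near0"
  unfolding eventually_near0 by (auto intro: poly_roots_finite)

lemma poly_eq_if_near0:
  fixes A B :: "'k::alg_closed_field poly"
  assumes "eventually (\<lambda>\<tau>. poly A \<tau> = poly B \<tau>) near0" shows "A = B"
proof (rule ccontr)
  assume "A \<noteq> B"
  then have "finite {\<tau>. poly (A - B) \<tau> = 0}" by (intro poly_roots_finite) simp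
  moreover have "finite {\<tau>. poly (A - B) \<tau> \<noteq> 0}" using assms by (simp add: eventually_near0)
  ultimately have "finite ({\<tau>. poly (A - B) \<tau> = 0} \<union> {\<tau>. poly (A - B) \<tau> \<noteq> 0})" by blast
  also have "\<dots> = UNIV" by blast
  finally show False using infinite_UNIV_alg_closed by blast
qed

text \<open>The condition is multiplied out to avoid division, and it leaves finitely many nonzero
  arguments free, just as a germ does.\<close>

definition ratfun_at0 :: "('k::field \<Rightarrow> 'k) \<Rightarrow> 'k poly \<Rightarrow> 'k poly \<Rightarrow> bool" where
  "ratfun_at0 g A B \<longleftrightarrow> poly B 0 \<noteq> 0 \<and> eventually (\<lambda>\<tau>. g \<tau> * poly B \<tau> = poly A \<tau>) near0"

text \<open>This is the Taylor series at 0 of a rational function. It exists because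
  \<open>B\<close>, having a nonzero constant term, is invertible as a series; its uniqueness is
  \<open>expansion_eqI\<close>.\<close>

definition expansion :: "('k::field \<Rightarrow> 'k) \<Rightarrow> 'k fps" where
  "expansion g = (SOME s. \<exists>A B. ratfun_at0 g A B \<and> s * fps_of_poly B = fps_of_poly A)"

text \<open>Two fractions for one function satisfy \<open>A * D = C * B\<close> at almost all
  arguments, hence as polynomials since the field is infinite, and so they define the same
  series.\<close>

lemma expansion_eqI:
  fixes g :: "'k::alg_closed_field \<Rightarrow> 'k"
  assumes g: "ratfun_at0 g A B" and s: "s * fps_of_poly B = fps_of_poly A"
  shows "expansion g = s"
proof -
  have "\<exists>A B. ratfun_at0 g A B \<and> expansion g * fps_of_poly B = fps_of_poly A"
    unfolding expansion_def by (rule someI_ex) (use assms in blast)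
  then obtain C D where C: "ratfun_at0 g C D" "expansion g * fps_of_poly D = fps_of_poly C" by blast
  have "eventually (\<lambda>\<tau>. poly (A * D) \<tau> = poly (C * B) \<tau>) near0"
  proof -
    have "eventually (\<lambda>\<tau>. g \<tau> * poly B \<tau> = poly A \<tau>) near0" "eventually (\<lambda>\<tau>. g \<tau> * poly D \<tau> = poly C \<tau>) near0"
      using g C unfolding ratfun_at0_def by auto
    then show ?thesis
    proof eventually_elim
      case (elim \<tau>)
      then show ?case unfolding poly_mult elim[symmetric] by (simp only: mult_ac)
    qed
  qed
  then have "A * D = C * B" by (rule poly_eq_if_near0)
  then have "fps_of_poly A * fps_of_poly D = fps_of_poly C * fps_of_poly B"
    by (metis fps_of_poly_mult)
  then have "s * fps_of_poly (B * D) = expansion g * fps_of_poly (B * D)"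
    unfolding s[symmetric] C(2)[symmetric] fps_of_poly_mult by (simp only: mult_ac)
  moreover have "B * D \<noteq> 0" using g C unfolding ratfun_at0_def by auto
  then have "fps_of_poly (B * D) \<noteq> 0" by simp
  ultimately show ?thesis by simp
qed

lemma expansion_eq:
  fixes g :: "'k::alg_closed_field \<Rightarrow> 'k"
  assumes g: "ratfun_at0 g A B" shows "expansion g * fps_of_poly B = fps_of_poly A"
proof -
  let ?s = "fps_of_poly A * inverse (fps_of_poly B)"
  have "fps_of_poly B $ 0 \<noteq> 0" using g by (simp add: ratfun_at0_def poly_0_coeff_0)
  then have "?s * fps_of_poly B = fps_of_poly A"
    using inverse_mult_eq_1[of "fps_of_poly B"] by (simp add: mult.assoc)
  moreover from this have "expansion g = ?s" by (rule expansion_eqI[OF g])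
  ultimately show ?thesis by simp
qed

lemma ratfun_at0_cong:
  assumes "ratfun_at0 g A B" "eventually (\<lambda>\<tau>. g \<tau> = h \<tau>) near0" shows "ratfun_at0 h A B"
proof -
  have "eventually (\<lambda>\<tau>. g \<tau> * poly B \<tau> = poly A \<tau>) near0" using assms(1) unfolding ratfun_at0_def by blast
  then have "eventually (\<lambda>\<tau>. h \<tau> * poly B \<tau> = poly A \<tau>) near0"
    using assms(2) by eventually_elim simp
  then show ?thesis using assms(1) unfolding ratfun_at0_def by blast
qed

lemma ratfun_at0_poly: "(\<And>\<tau>. g \<tau> = poly A \<tau>) \<Longrightarrow> ratfun_at0 g A 1"
  unfolding ratfun_at0_def by simp

lemma ratfun_at0_const: "ratfun_at0 (\<lambda>\<tau>. c) [:c:] 1"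
  by (rule ratfun_at0_poly) simp

lemma ratfun_at0_add:
  assumes "ratfun_at0 g A B" "ratfun_at0 h C D"
  shows "ratfun_at0 (\<lambda>\<tau>. g \<tau> + h \<tau>) (A * D + C * B) (B * D)"
proof -
  have "eventually (\<lambda>\<tau>. g \<tau> * poly B \<tau> = poly A \<tau>) near0" "eventually (\<lambda>\<tau>. h \<tau> * poly D \<tau> = poly C \<tau>) near0"
    using assms unfolding ratfun_at0_def by auto
  then have "eventually (\<lambda>\<tau>. (g \<tau> + h \<tau>) * poly (B * D) \<tau> = poly (A * D + C * B) \<tau>) near0"
    by eventually_elim (simp add: algebra_simps flip: mult.assoc)
  then show ?thesis using assms unfolding ratfun_at0_def by auto
qed

lemma ratfun_at0_mult:
  assumes "ratfun_at0 g A B" "ratfun_at0 h C D"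
  shows "ratfun_at0 (\<lambda>\<tau>. g \<tau> * h \<tau>) (A * C) (B * D)"
proof -
  have "eventually (\<lambda>\<tau>. g \<tau> * poly B \<tau> = poly A \<tau>) near0" "eventually (\<lambda>\<tau>. h \<tau> * poly D \<tau> = poly C \<tau>) near0"
    using assms unfolding ratfun_at0_def by auto
  then have "eventually (\<lambda>\<tau>. (g \<tau> * h \<tau>) * poly (B * D) \<tau> = poly (A * C) \<tau>) near0"
  proof eventually_elim
    case (elim \<tau>)
    have "(g \<tau> * h \<tau>) * poly (B * D) \<tau> = (g \<tau> * poly B \<tau>) * (h \<tau> * poly D \<tau>)" by (simp add: mult_ac)
    then show ?case unfolding elim by simp
  qed
  then show ?thesis using assms unfolding ratfun_at0_def by auto
qed

lemma expansion_add:
  fixes g h :: "'k::alg_closed_field \<Rightarrow> 'k"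
  assumes "ratfun_at0 g A B" "ratfun_at0 h C D"
  shows "expansion (\<lambda>\<tau>. g \<tau> + h \<tau>) = expansion g + expansion h"
  by (rule expansion_eqI[OF ratfun_at0_add[OF assms]])
     (simp add: fps_of_poly_add fps_of_poly_mult algebra_simps
       flip: expansion_eq[OF assms(1)] expansion_eq[OF assms(2)])

lemma expansion_mult:
  fixes g h :: "'k::alg_closed_field \<Rightarrow> 'k"
  assumes "ratfun_at0 g A B" "ratfun_at0 h C D"
  shows "expansion (\<lambda>\<tau>. g \<tau> * h \<tau>) = expansion g * expansion h"
  by (rule expansion_eqI[OF ratfun_at0_mult[OF assms]])
     (simp add: fps_of_poly_mult mult_ac flip: expansion_eq[OF assms(1)] expansion_eq[OF assms(2)])

lemma expansion_poly:
  fixes g :: "'k::alg_closed_field \<Rightarrow> 'k"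
  assumes "\<And>\<tau>. g \<tau> = poly A \<tau>" shows "expansion g = fps_of_poly A"
  by (rule expansion_eqI[OF ratfun_at0_poly[OF assms]]) simp

lemma expansion_const: "expansion (\<lambda>\<tau>. c :: 'k::alg_closed_field) = fps_const c"
  using expansion_poly[of "\<lambda>_. c" "[:c:]"] by (simp add: fps_of_poly_const)

lemma expansion_cong:
  fixes g h :: "'k::alg_closed_field \<Rightarrow> 'k"
  assumes "ratfun_at0 g A B" "eventually (\<lambda>\<tau>. g \<tau> = h \<tau>) near0"
  shows "expansion h = expansion g"
  by (rule expansion_eqI[OF ratfun_at0_cong[OF assms] expansion_eq[OF assms(1)]])

lemma expansion_nth_0:
  fixes g :: "'k::alg_closed_field \<Rightarrow> 'k"
  assumes "ratfun_at0 g A B" shows "expansion g $ 0 = g 0"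
proof -
  have "(expansion g * fps_of_poly B) $ 0 = fps_of_poly A $ 0" using expansion_eq[OF assms] by simp
  then have "expansion g $ 0 * poly B 0 = g 0 * poly B 0"
    using assms by (simp add: ratfun_at0_def eventually_near0 poly_0_coeff_0)
  then show ?thesis using assms by (simp add: ratfun_at0_def)
qed

text \<open>The first conjunct makes the series meaningful: additivity and multiplicativity of
  \<open>expansion\<close> are available for functions that are fractions near 0.\<close>

definition vanishes_to_order :: "nat \<Rightarrow> ('k::alg_closed_field \<Rightarrow> 'k) \<Rightarrow> bool" where
  "vanishes_to_order j g \<longleftrightarrow> (\<exists>A B. ratfun_at0 g A B) \<and> fps_X ^ j dvd expansion g"

lemma vanishes_to_order_mult:
  "vanishes_to_order i g \<Longrightarrow> vanishes_to_order j h \<Longrightarrow> vanishes_to_order (i + j) (\<lambda>\<tau>. g \<tau> * h \<tau>)"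
  unfolding vanishes_to_order_def
  by (auto simp: expansion_mult power_add intro: mult_dvd_mono ratfun_at0_mult)

lemma vanishes_to_order_add:
  "vanishes_to_order j g \<Longrightarrow> vanishes_to_order j h \<Longrightarrow> vanishes_to_order j (\<lambda>\<tau>. g \<tau> + h \<tau>)"
  unfolding vanishes_to_order_def
  by (auto simp: expansion_add intro: dvd_add ratfun_at0_add)

lemma vanishes_to_order_const: "c = 0 \<or> j = 0 \<Longrightarrow> vanishes_to_order j (\<lambda>\<tau>. c)"
  unfolding vanishes_to_order_def by (auto simp: expansion_const intro: ratfun_at0_const)

lemma vanishes_to_order_sum:
  assumes "\<And>i. i < (r :: nat) \<Longrightarrow> vanishes_to_order j (g i)"
  shows "vanishes_to_order j (\<lambda>\<tau>. \<Sum>i<r. g i \<tau>)"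
  using assms by (induction r) (auto intro: vanishes_to_order_const vanishes_to_order_add)

lemma vanishes_to_order_prod:
  assumes "\<And>i. i < j \<Longrightarrow> vanishes_to_order 1 (g i)"
  shows "vanishes_to_order j (\<lambda>\<tau>. \<Prod>i<j. g i \<tau>)"
  using assms
proof (induction j)
  case (Suc j)
  have "vanishes_to_order (j + 1) (\<lambda>\<tau>. (\<Prod>i<j. g i \<tau>) * g j \<tau>)"
    using Suc by (intro vanishes_to_order_mult) auto
  then show ?case by simp
qed (simp add: vanishes_to_order_const)

lemma fps_X_power_dvd_iff: "fps_X ^ j dvd (s :: 'a::comm_ring_1 fps) \<longleftrightarrow> (\<forall>i<j. s $ i = 0)"
proof
  assume "fps_X ^ j dvd s"
  then obtain t where t: "s = fps_X ^ j * t" by (rule dvdE)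
  show "\<forall>i<j. s $ i = 0" unfolding t by (simp add: fps_X_power_mult_nth)
next
  assume *: "\<forall>i<j. s $ i = 0"
  have "s = fps_X ^ j * fps_shift j s"
    by (rule fps_ext) (use * in \<open>auto simp: fps_X_power_mult_nth\<close>)
  then show "fps_X ^ j dvd s" by (rule dvdI)
qed

section \<open>The ring of power series modulo xy\<close>

text \<open>
  A power series modulo \<open>xy\<close> is determined by its restrictions to the two axes.
\<close>

definition on_x_axis :: "'k::field fps fps \<Rightarrow> 'k fps" where
  "on_x_axis s = s $ 0"

text \<open>The outer series variable is y and the inner one is x. Setting y = 0 therefore takes the
  outer constant coefficient, and setting x = 0 takes the constant term of every
  coefficient.\<close>

definition on_y_axis :: "'k::field fps fps \<Rightarrow> 'k fps" where
  "on_y_axis s = Abs_fps (\<lambda>n. s $ n $ 0)"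

lemma on_axis_add: "on_x_axis (s + t) = on_x_axis s + on_x_axis t"
    "on_y_axis (s + t) = on_y_axis s + on_y_axis t"
  and on_axis_diff: "on_x_axis (s - t) = on_x_axis s - on_x_axis t"
    "on_y_axis (s - t) = on_y_axis s - on_y_axis t"
  by (auto simp: on_x_axis_def on_y_axis_def fps_eq_iff)

lemma on_axis_mult: "on_x_axis (s * t) = on_x_axis s * on_x_axis t"
    "on_y_axis (s * t) = on_y_axis s * on_y_axis t"
  by (auto simp: on_x_axis_def on_y_axis_def fps_eq_iff fps_mult_nth fps_sum_nth)

lemma on_axis_const: "on_x_axis (fps_const a) = a" "on_y_axis (fps_const a) = fps_const (a $ 0)"
  by (auto simp: on_x_axis_def on_y_axis_def fps_eq_iff)

lemma on_axis_y: "on_x_axis fps_y = 0" "on_y_axis fps_y = fps_X"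
  by (auto simp: on_x_axis_def on_y_axis_def fps_eq_iff)

lemma on_axis_one: "on_x_axis 1 = 1" "on_y_axis 1 = 1"
  by (auto simp: on_x_axis_def on_y_axis_def fps_eq_iff)

lemma on_axis_power: "on_x_axis (s ^ n) = on_x_axis s ^ n" "on_y_axis (s ^ n) = on_y_axis s ^ n"
  by (induction n) (auto simp: on_axis_mult on_axis_one)

lemma on_axis_zero: "on_x_axis 0 = 0" "on_y_axis 0 = 0"
  by (auto simp: on_x_axis_def on_y_axis_def fps_eq_iff)

lemma on_axis_sum: "on_x_axis (\<Sum>i\<in>I. s i) = (\<Sum>i\<in>I. on_x_axis (s i))"
    "on_y_axis (\<Sum>i\<in>I. s i) = (\<Sum>i\<in>I. on_y_axis (s i))"
  by (induction I rule: infinite_finite_induct) (auto simp: on_axis_add on_axis_zero)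

text \<open>The ideal (xy) is the kernel of restriction to both axes. Every congruence in the
  definition of a node thus splits into two equations between series in one variable.\<close>

lemma xy_dvd_iff: "fps_x * fps_y dvd s \<longleftrightarrow> on_x_axis s = 0 \<and> on_y_axis s = 0"
proof
  assume "fps_x * fps_y dvd s"
  then obtain t where "s = fps_x * fps_y * t" by (rule dvdE)
  then show "on_x_axis s = 0 \<and> on_y_axis s = 0" by (simp add: on_axis_mult on_axis_y on_axis_const)
next
  assume *: "on_x_axis s = 0 \<and> on_y_axis s = 0"
  have s: "s $ 0 = 0" "s $ n $ 0 = 0" for n
    using * by (auto simp: on_x_axis_def on_y_axis_def fps_eq_iff)
  \<comment> \<open>The quotient drops one y (\<open>Suc n\<close>) and one x
    (\<open>fps_shift 1\<close>) from every monomial.\<close>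
  have "s = fps_x * fps_y * Abs_fps (\<lambda>n. fps_shift 1 (s $ Suc n))"
  proof (intro fps_ext)
    fix n m
    show "s $ n $ m = (fps_x * fps_y * Abs_fps (\<lambda>n. fps_shift 1 (s $ Suc n))) $ n $ m"
      using s by (cases n; cases m) (auto simp: mult.assoc)
  qed
  then show "fps_x * fps_y dvd s" by (rule dvdI)
qed

lemma xy_dvd_diff_iff: "fps_x * fps_y dvd s - t \<longleftrightarrow> on_x_axis s = on_x_axis t \<and> on_y_axis s = on_y_axis t"
  by (simp add: xy_dvd_iff on_axis_diff)

text \<open>This is a(x) + b(y) - b(0), a lift of a pair of series on the axes that agree at the
  origin.\<close>

definition axes_glue :: "'k::field fps \<Rightarrow> 'k fps \<Rightarrow> 'k fps fps" where
  "axes_glue a b = fps_const a + (Abs_fps (\<lambda>n. fps_const (b $ n)) - fps_const (fps_const (b $ 0)))"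

lemma on_axis_glue:
  assumes "a $ 0 = b $ 0" shows "on_x_axis (axes_glue a b) = a" "on_y_axis (axes_glue a b) = b"
  using assms by (auto simp: axes_glue_def on_x_axis_def on_y_axis_def fps_eq_iff)

text \<open>Modulo xy only pure powers matter: on the x-axis the summand \<open>i = j\<close>
  survives, on the y-axis the summand \<open>i = 0\<close>. For \<open>j > 0\<close> these two
  coefficients are different and can be chosen independently, so the condition is divisibility by
  the \<open>j\<close>-th power on each axis.\<close>

lemma in_fps_power_iff:
  "in_fps_power j s \<longleftrightarrow> j = 0 \<or> (\<forall>i<j. on_x_axis s $ i = 0 \<and> on_y_axis s $ i = 0)"
proof (cases "j = 0")
  case True
  have "in_fps_power 0 s" unfolding in_fps_power_def by (rule exI[of _ "\<lambda>_. s"]) simp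
  then show ?thesis using True by simp
next
  case False
  have x: "on_x_axis (\<Sum>i\<le>j. c i * fps_x ^ i * fps_y ^ (j - i)) = on_x_axis (c j) * fps_X ^ j" for c :: "nat \<Rightarrow> 'a fps fps"
  proof -
    have "on_x_axis (\<Sum>i\<le>j. c i * fps_x ^ i * fps_y ^ (j - i)) = (\<Sum>i\<le>j. if i = j then on_x_axis (c j) * fps_X ^ j else 0)"
      unfolding on_axis_sum by (rule sum.cong) (auto simp: on_axis_mult on_axis_power on_axis_const on_axis_y power_0_left)
    then show ?thesis by simp
  qed
  have y: "on_y_axis (\<Sum>i\<le>j. c i * fps_x ^ i * fps_y ^ (j - i)) = on_y_axis (c 0) * fps_X ^ j" for c :: "nat \<Rightarrow> 'a fps fps"
  proof -
    have "on_y_axis (\<Sum>i\<le>j. c i * fps_x ^ i * fps_y ^ (j - i)) = (\<Sum>i\<le>j. if i = 0 then on_y_axis (c 0) * fps_X ^ j else 0)"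
      unfolding on_axis_sum by (rule sum.cong) (auto simp: on_axis_mult on_axis_power on_axis_const on_axis_y power_0_left)
    then show ?thesis by simp
  qed
  have "in_fps_power j s \<longleftrightarrow> (\<exists>c. on_x_axis s = on_x_axis (c j) * fps_X ^ j \<and> on_y_axis s = on_y_axis (c 0) * fps_X ^ j)"
    unfolding in_fps_power_def xy_dvd_diff_iff x y by simp
  also have "\<dots> \<longleftrightarrow> fps_X ^ j dvd on_x_axis s \<and> fps_X ^ j dvd on_y_axis s"
  proof
    assume "fps_X ^ j dvd on_x_axis s \<and> fps_X ^ j dvd on_y_axis s"
    then obtain a b where ab: "on_x_axis s = fps_X ^ j * a" "on_y_axis s = fps_X ^ j * b" by (meson dvdE)
    define c where "c i = (if i = j then fps_const a else Abs_fps (\<lambda>n. fps_const (b $ n)))" for i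
    have "on_x_axis (c j) = a" by (simp add: c_def on_axis_const)
    moreover have "on_y_axis (c 0) = b" using False by (simp add: c_def on_y_axis_def fps_eq_iff)
    ultimately show "\<exists>c. on_x_axis s = on_x_axis (c j) * fps_X ^ j \<and> on_y_axis s = on_y_axis (c 0) * fps_X ^ j"
      using ab by (intro exI[of _ c]) (simp add: mult.commute)
  qed auto
  finally show ?thesis using False by (simp add: fps_X_power_dvd_iff) blast
qed

section \<open>Regular points and nodes\<close>

lemma vanishes_to_order_cong:
  assumes "vanishes_to_order j g" "eventually (\<lambda>\<tau>. g \<tau> = h \<tau>) near0"
  shows "vanishes_to_order j h"
proof -
  obtain A B where "ratfun_at0 g A B" using assms(1) unfolding vanishes_to_order_def by blast
  from ratfun_at0_cong[OF this assms(2)] expansion_cong[OF this assms(2)] show ?thesis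
    using assms(1) unfolding vanishes_to_order_def by auto
qed

text \<open>
  Near \<open>p\<close> the set \<open>X\<close> is a union of smooth branches \<open>line (c i \<tau>)\<close> through \<open>p\<close> which are
  parameterized by one and the same affine coordinate \<open>\<tau> = L / M\<close>.
\<close>

locale branches =
  fixes X :: "'k::alg_closed_field ppoint set" and n :: nat and p :: "'k ppoint"
    and I :: "'i set" and c :: "'i \<Rightarrow> 'k \<Rightarrow> nat \<Rightarrow> 'k" and L M :: "(nat \<Rightarrow> 'k) \<Rightarrow> 'k" and W :: "'k ppoint set"
  assumes X: "X \<subseteq> proj_space n" and finite_I: "finite I" and I_nonempty: "I \<noteq> {}"
    and polynomial: "i \<in> I \<Longrightarrow> \<exists>a. \<forall>\<tau>. c i \<tau> j = poly a \<tau>"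
    and in_X: "i \<in> I \<Longrightarrow> line (c i \<tau>) \<in> X"
    and origin: "i \<in> I \<Longrightarrow> line (c i 0) = p"
    and form_L: "form 1 L" and form_M: "form 1 M"
    and M_eq: "i \<in> I \<Longrightarrow> M (c i \<tau>) = 1" and L_eq: "i \<in> I \<Longrightarrow> L (c i \<tau>) = \<tau>"
    and W: "proj_algebraic W" "p \<notin> W" "X - W \<subseteq> (\<Union>i\<in>I. range (\<lambda>\<tau>. line (c i \<tau>)))"
begin

lemma p_in_X: "p \<in> X"
proof -
  obtain i where "i \<in> I" using I_nonempty by blast
  then show ?thesis using in_X[of i 0] origin by simp
qed

lemma frac_branch: "i \<in> I \<Longrightarrow> frac L M (line (c i \<tau>)) = \<tau>"
  by (simp add: frac_line[OF form_L form_M] M_eq L_eq)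

lemma frac_p: "frac L M p = 0"
proof -
  obtain i where "i \<in> I" using I_nonempty by blast
  then show ?thesis using frac_branch[of i 0] origin by simp
qed

lemma form_along_branch:
  assumes "i \<in> I" "form d F" obtains A where "\<forall>\<tau>. F (c i \<tau>) = poly A \<tau>"
  using form_poly_along[OF assms(2), of "c i"] polynomial[OF assms(1)] by blast

text \<open>Some equation of \<open>V\<close> is nonzero at \<open>p\<close>. Along the branch it
  becomes a polynomial with nonzero value at 0, hence with finitely many roots.\<close>

lemma branch_avoids_closed:
  assumes i: "i \<in> I" and V: "proj_algebraic V" "p \<notin> V"
  shows "eventually (\<lambda>\<tau>. line (c i \<tau>) \<notin> V) near0"
proof -
  obtain m T where T: "V \<subseteq> proj_space m" "\<forall>F\<in>T. \<exists>d. form d F"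
    "\<forall>m x. line x \<in> proj_space m \<longrightarrow> (line x \<in> V \<longleftrightarrow> (\<forall>F\<in>T. F x = 0))"
    using V(1) by (rule proj_algebraicE)
  have on: "line (c i \<tau>) \<in> proj_space n" for \<tau> using in_X[OF i] X by blast
  have "line (c i 0) \<notin> V" using V(2) origin[OF i] by simp
  then obtain F where F: "F \<in> T" "F (c i 0) \<noteq> 0" using T(3) on by blast
  obtain d where "form d F" using T(2) F(1) by blast
  then obtain A where A: "\<forall>\<tau>. F (c i \<tau>) = poly A \<tau>" using form_along_branch[OF i] by blast
  have "eventually (\<lambda>\<tau>. poly A \<tau> \<noteq> 0) near0" using F(2) A by (intro poly_nonzero_near0) simp
  then show ?thesis
  proof (rule eventually_mono)
    fix \<tau> assume "poly A \<tau> \<noteq> 0"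
    then have "F (c i \<tau>) \<noteq> 0" using A by simp
    then show "line (c i \<tau>) \<notin> V" using T(3) on F(1) by blast
  qed
qed

lemma regular_along_branch:
  assumes i: "i \<in> I" and f: "regular_at X p f"
  obtains A B where "ratfun_at0 (\<lambda>\<tau>. f (line (c i \<tau>))) A B"
proof -
  obtain V d F G where V: "proj_algebraic V" "p \<notin> V" "form d F" "form d G"
    "\<forall>x. line x \<in> X \<longrightarrow> line x \<notin> V \<longrightarrow> G x \<noteq> 0 \<and> f (line x) = F x / G x"
    using f by (rule regular_atE)
  obtain A where A: "\<forall>\<tau>. F (c i \<tau>) = poly A \<tau>" using form_along_branch[OF i V(3)] .
  obtain B where B: "\<forall>\<tau>. G (c i \<tau>) = poly B \<tau>" using form_along_branch[OF i V(4)] .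
  have "eventually (\<lambda>\<tau>. f (line (c i \<tau>)) * poly B \<tau> = poly A \<tau>) near0"
    using branch_avoids_closed[OF i V(1,2)]
  proof (rule eventually_mono)
    fix \<tau> assume "line (c i \<tau>) \<notin> V"
    then show "f (line (c i \<tau>)) * poly B \<tau> = poly A \<tau>"
      using V(5) in_X[OF i, of \<tau>] by (simp flip: A[rule_format] B[rule_format])
  qed
  moreover have "poly B 0 \<noteq> 0" using V(2,5) in_X[OF i, of 0] origin[OF i] by (simp flip: B[rule_format])
  ultimately show ?thesis by (intro that[of A B]) (simp add: ratfun_at0_def)
qed

text \<open>Only finitely many points of the branches have to be removed, and a finite set is
  closed. It avoids \<open>p\<close> because the common coordinate \<open>frac L M\<close> shows
  that a branch passes through \<open>p\<close> only at \<tau> = 0, where the functions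
  agree.\<close>

lemma germ_eqI:
  assumes "\<And>i. i \<in> I \<Longrightarrow> eventually (\<lambda>\<tau>. f (line (c i \<tau>)) = g (line (c i \<tau>))) near0"
  shows "germ_eq X p f g"
proof -
  define S where "S = (\<Union>i\<in>I. (\<lambda>\<tau>. line (c i \<tau>)) ` {\<tau>. f (line (c i \<tau>)) \<noteq> g (line (c i \<tau>))})"
  have "finite S" unfolding S_def using finite_I assms by (auto simp: eventually_near0)
  moreover have "S \<subseteq> proj_space n" unfolding S_def using in_X X by blast
  ultimately have "proj_algebraic (W \<union> S)" by (intro proj_algebraic_Un W(1) proj_algebraic_finite)
  moreover have "p \<notin> S"
  proof
    assume "p \<in> S"
    then obtain i \<tau> where i: "i \<in> I" "p = line (c i \<tau>)" "f (line (c i \<tau>)) \<noteq> g (line (c i \<tau>))"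
      unfolding S_def by blast
    then have "\<tau> = 0" using frac_p frac_branch by metis
    then show False using assms[OF i(1)] i(3) by (simp add: eventually_near0)
  qed
  moreover have "f q = g q" if "q \<in> X - (W \<union> S)" for q
  proof -
    obtain i \<tau> where "i \<in> I" "q = line (c i \<tau>)" using \<open>q \<in> _\<close> W(3) by blast
    then show ?thesis using that unfolding S_def by blast
  qed
  ultimately show ?thesis unfolding germ_eq_def zopen_def
    using p_in_X W(2) by (intro exI[of _ "X - (W \<union> S)"]) blast
qed

lemma germ_eqD:
  assumes "germ_eq X p f g" "i \<in> I"
  shows "eventually (\<lambda>\<tau>. f (line (c i \<tau>)) = g (line (c i \<tau>))) near0"
proof -
  obtain V where V: "proj_algebraic V" "p \<notin> V" "\<forall>q\<in>X - V. f q = g q"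
    using assms(1) unfolding germ_eq_def zopen_def by blast
  show ?thesis using branch_avoids_closed[OF assms(2) V(1,2)]
    by (rule eventually_mono) (use V(3) in_X[OF assms(2)] in blast)
qed

lemma regular_ratfun:
  assumes "poly B 0 \<noteq> 0" shows "regular_at X p (\<lambda>q. poly A (frac L M q) / poly B (frac L M q))"
proof -
  obtain i where i: "i \<in> I" using I_nonempty by blast
  have "regular_at X (line (c i 0)) (\<lambda>q. poly A (frac L M q) / poly B (frac L M q))"
    by (rule regular_at_ratfun[OF X in_X[OF i] form_L form_M])
       (use M_eq[OF i] frac_branch[OF i] assms in auto)
  then show ?thesis using origin[OF i] by simp
qed

lemma regular_frac:
  assumes "form 1 F" shows "regular_at X p (frac F M)"
proof -
  obtain i where i: "i \<in> I" using I_nonempty by blast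
  have "regular_at X (line (c i 0)) (frac F M)"
    by (rule regular_at_frac[OF X in_X[OF i] assms form_M]) (use M_eq[OF i] in auto)
  then show ?thesis using origin[OF i] by simp
qed

text \<open>The coordinate \<open>frac L M\<close> is a uniformizer: a function vanishing at
  \<open>p\<close> is \<open>A / B\<close> along the branch with \<open>A\<close> divisible by
  \<tau>, and the remaining fraction, read as a function of \<open>frac L M\<close>, is
  regular.\<close>

lemma regular_point_if_one_branch:
  assumes I: "I = {i}" shows "regular_point X p"
proof -
  have i: "i \<in> I" using I by simp
  let ?u = "frac L M"
  have "\<exists>h. regular_at X p h \<and> germ_eq X p f (\<lambda>q. ?u q * h q)" if f: "f \<in> max_ideal X p" for f
  proof -
    have fr: "regular_at X p f" "f p = 0" using f unfolding max_ideal_def by auto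
    obtain A B where AB: "ratfun_at0 (\<lambda>\<tau>. f (line (c i \<tau>))) A B" using regular_along_branch[OF i fr(1)] .
    then have B: "poly B 0 \<noteq> 0" and e: "eventually (\<lambda>\<tau>. f (line (c i \<tau>)) * poly B \<tau> = poly A \<tau>) near0"
      unfolding ratfun_at0_def by auto
    have "poly A 0 = 0" using e fr(2) origin[OF i] by (simp add: eventually_near0)
    then obtain A' where A': "A = [:0, 1:] * A'" using poly_eq_0_iff_dvd[of A 0] by (auto elim: dvdE)
    have "germ_eq X p f (\<lambda>q. ?u q * (poly A' (?u q) / poly B (?u q)))"
    proof (rule germ_eqI)
      fix j assume "j \<in> I"
      then have j: "j = i" using I by simp
      show "eventually (\<lambda>\<tau>. f (line (c j \<tau>)) = ?u (line (c j \<tau>)) *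
          (poly A' (?u (line (c j \<tau>))) / poly B (?u (line (c j \<tau>))))) near0"
        using e poly_nonzero_near0[OF B] unfolding j
        by eventually_elim (simp add: frac_branch[OF i] A' field_simps)
    qed
    then show ?thesis using regular_ratfun[OF B, of A'] by blast
  qed
  moreover have "?u \<in> max_ideal X p"
    unfolding max_ideal_def using regular_frac[OF form_L] frac_p by simp
  ultimately show ?thesis unfolding regular_point_def using p_in_X by blast
qed

text \<open>Every factor from the maximal ideal has an expansion without constant term, so a product
  of \<open>j\<close> of them is divisible by the \<open>j\<close>-th power; multiplying by regular
  coefficients and adding preserves this.\<close>

lemma max_ideal_power_vanishes:
  assumes f: "f \<in> max_ideal_power X p j" and i: "i \<in> I"
  shows "vanishes_to_order j (\<lambda>\<tau>. f (line (c i \<tau>)))"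
proof -
  obtain r a g where a: "\<forall>k<(r::nat). regular_at X p (a k)" and g: "\<forall>k<r. \<forall>l<j. g k l \<in> max_ideal X p"
    and e: "germ_eq X p f (\<lambda>q. \<Sum>k<r. a k q * (\<Prod>l<j. g k l q))"
    using f unfolding max_ideal_power_def by blast
  have "vanishes_to_order j (\<lambda>\<tau>. \<Sum>k<r. a k (line (c i \<tau>)) * (\<Prod>l<j. g k l (line (c i \<tau>))))"
  proof (rule vanishes_to_order_sum)
    fix k assume k: "k < r"
    obtain A B where "ratfun_at0 (\<lambda>\<tau>. a k (line (c i \<tau>))) A B"
      using regular_along_branch[OF i] a k by blast
    then have "vanishes_to_order 0 (\<lambda>\<tau>. a k (line (c i \<tau>)))"
      unfolding vanishes_to_order_def by auto
    moreover have "vanishes_to_order j (\<lambda>\<tau>. \<Prod>l<j. g k l (line (c i \<tau>)))"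
    proof (rule vanishes_to_order_prod)
      fix l assume "l < j"
      then have gl: "regular_at X p (g k l)" "g k l p = 0" using g k unfolding max_ideal_def by auto
      obtain A B where AB: "ratfun_at0 (\<lambda>\<tau>. g k l (line (c i \<tau>))) A B"
        using regular_along_branch[OF i gl(1)] .
      then show "vanishes_to_order 1 (\<lambda>\<tau>. g k l (line (c i \<tau>)))"
        unfolding vanishes_to_order_def fps_X_power_dvd_iff
        using gl(2) origin[OF i] by (auto simp: expansion_nth_0[OF AB])
    qed
    ultimately have "vanishes_to_order (0 + j) (\<lambda>\<tau>. a k (line (c i \<tau>)) * (\<Prod>l<j. g k l (line (c i \<tau>))))"
      by (rule vanishes_to_order_mult)
    then show "vanishes_to_order j (\<lambda>\<tau>. a k (line (c i \<tau>)) * (\<Prod>l<j. g k l (line (c i \<tau>))))" by simp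
  qed
  moreover have "eventually (\<lambda>\<tau>. (\<Sum>k<r. a k (line (c i \<tau>)) * (\<Prod>l<j. g k l (line (c i \<tau>)))) = f (line (c i \<tau>))) near0"
    using germ_eqD[OF e i] by (rule eventually_mono) simp
  ultimately show ?thesis by (rule vanishes_to_order_cong)
qed

end

text \<open>\<open>Y1\<close> and \<open>Y2\<close> give the functions that play x and y: each is
  zero on the other branch and, as \<open>Q1\<close> and \<open>Q2\<close> are nonzero at 0, a
  uniformizer on its own. The parameter \<tau> alone could not tell the branches apart.\<close>

locale two_branches = branches X n p "{i1, i2}" c L M W
  for X :: "'k::alg_closed_field ppoint set" and n p and i1 i2 :: 'i and c L M W +
  fixes Y1 Y2 :: "(nat \<Rightarrow> 'k) \<Rightarrow> 'k" and Q1 Q2 :: "'k poly"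
  assumes form_Y: "form 1 Y1" "form 1 Y2"
    and Y1_eq: "Y1 (c i1 \<tau>) = \<tau> * poly Q1 \<tau>" "Y1 (c i2 \<tau>) = 0"
    and Y2_eq: "Y2 (c i1 \<tau>) = 0" "Y2 (c i2 \<tau>) = \<tau> * poly Q2 \<tau>"
    and Q: "poly Q1 0 \<noteq> 0" "poly Q2 0 \<noteq> 0"
begin

abbreviation "E1 f \<equiv> expansion (\<lambda>\<tau>. f (line (c i1 \<tau>)))"
abbreviation "E2 f \<equiv> expansion (\<lambda>\<tau>. f (line (c i2 \<tau>)))"
abbreviation "u \<equiv> frac L M"
abbreviation "y1 \<equiv> frac Y1 M"
abbreviation "y2 \<equiv> frac Y2 M"

lemma y_along:
  "y1 (line (c i1 \<tau>)) = \<tau> * poly Q1 \<tau>" "y1 (line (c i2 \<tau>)) = 0"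
  "y2 (line (c i1 \<tau>)) = 0" "y2 (line (c i2 \<tau>)) = \<tau> * poly Q2 \<tau>"
  by (simp_all add: frac_line[OF form_Y(1) form_M] frac_line[OF form_Y(2) form_M] Y1_eq Y2_eq M_eq)

lemma u_along: "u (line (c i1 \<tau>)) = \<tau>" "u (line (c i2 \<tau>)) = \<tau>"
  by (simp_all add: frac_branch)

lemma y_in_max_ideal: "y1 \<in> max_ideal X p" "y2 \<in> max_ideal X p"
proof -
  have "y1 p = 0" "y2 p = 0" using y_along(2)[of 0] y_along(3)[of 0] origin by auto
  then show "y1 \<in> max_ideal X p" "y2 \<in> max_ideal X p"
    unfolding max_ideal_def using regular_frac form_Y by auto
qed

text \<open>The pair of Taylor expansions along the branches; both constant terms are
  \<open>f p\<close>, so for regular \<open>f\<close> the pair glues.\<close>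

definition "\<psi> f = axes_glue (E1 f) (E2 f)"

lemma on_axis_\<psi>:
  assumes "regular_at X p f" shows "on_x_axis (\<psi> f) = E1 f" "on_y_axis (\<psi> f) = E2 f"
proof -
  obtain A B where "ratfun_at0 (\<lambda>\<tau>. f (line (c i1 \<tau>))) A B" using regular_along_branch[OF _ assms] by blast
  moreover obtain C D where "ratfun_at0 (\<lambda>\<tau>. f (line (c i2 \<tau>))) C D" using regular_along_branch[OF _ assms] by blast
  ultimately have "E1 f $ 0 = E2 f $ 0" using origin by (simp add: expansion_nth_0)
  then show "on_x_axis (\<psi> f) = E1 f" "on_y_axis (\<psi> f) = E2 f"
    unfolding \<psi>_def by (auto simp: on_axis_glue)
qed

text \<open>Rewrites a function of order at least \<open>j\<close> on one branch as a fraction times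
  the \<open>j\<close>-th power of the private coordinate of that branch.\<close>

lemma power_form_along:
  fixes g :: "'k \<Rightarrow> 'k"
  assumes f: "ratfun_at0 g A B" and v: "\<forall>k<j. expansion g $ k = 0" and Q: "poly Q 0 \<noteq> 0"
  obtains A' B' where "poly B' 0 \<noteq> 0"
    "eventually (\<lambda>\<tau>. g \<tau> = poly A' \<tau> / poly B' \<tau> * (\<tau> * poly Q \<tau>) ^ j) near0"
proof -
  have "fps_X ^ j dvd fps_of_poly A"
    using v expansion_eq[OF f] by (metis dvd_mult2 fps_X_power_dvd_iff)
  then have "monom 1 j dvd A" by (simp add: fps_X_power_dvd_iff monom_1_dvd_iff')
  then obtain A' where A': "A = monom 1 j * A'" by (rule dvdE)
  have B: "poly B 0 \<noteq> 0" and e: "eventually (\<lambda>\<tau>. g \<tau> * poly B \<tau> = poly A \<tau>) near0"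
    using f unfolding ratfun_at0_def by auto
  \<comment> \<open>The private coordinate is \<tau> times \<open>Q\<close>, so the factor
    \<open>Q ^ j\<close> is moved into the denominator, where it is harmless because
    \<open>Q\<close> is nonzero at 0.\<close>
  have "eventually (\<lambda>\<tau>. g \<tau> = poly A' \<tau> / poly (B * Q ^ j) \<tau> * (\<tau> * poly Q \<tau>) ^ j) near0"
    using e poly_nonzero_near0[OF B] poly_nonzero_near0[OF Q]
    by eventually_elim (simp add: A' poly_monom power_mult_distrib field_simps)
  then show ?thesis using B Q by (intro that[of "B * Q ^ j" A']) auto
qed

text \<open>For the converse, \<open>f\<close> is a fraction in \<open>u\<close> times
  \<open>y1 ^ j\<close> plus another one times \<open>y2 ^ j\<close>. For \<open>j > 0\<close> each
  summand vanishes on the other branch, so the identity can be checked on one branch at a time. For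
  \<open>j = 0\<close> the powers do not vanish there, but every regular function qualifies.\<close>

lemma max_ideal_power_iff:
  assumes f: "regular_at X p f"
  shows "f \<in> max_ideal_power X p j \<longleftrightarrow> in_fps_power j (\<psi> f)"
proof
  assume "f \<in> max_ideal_power X p j"
  then have "vanishes_to_order j (\<lambda>\<tau>. f (line (c i1 \<tau>)))" "vanishes_to_order j (\<lambda>\<tau>. f (line (c i2 \<tau>)))"
    by (auto intro: max_ideal_power_vanishes)
  then show "in_fps_power j (\<psi> f)"
    unfolding in_fps_power_iff vanishes_to_order_def fps_X_power_dvd_iff by (auto simp: on_axis_\<psi>[OF f])
next
  assume *: "in_fps_power j (\<psi> f)"
  show "f \<in> max_ideal_power X p j"
  proof (cases "j = 0")
    case True
    have "germ_eq X p f f" unfolding germ_eq_def using zopen_self p_in_X by blast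
    then show ?thesis unfolding max_ideal_power_def using f True
      by (intro CollectI exI[of _ 1] exI[of _ "\<lambda>_. f"] exI[of _ "\<lambda>_ _. f"]) simp
  next
    case False
    then have v: "\<forall>k<j. E1 f $ k = 0" "\<forall>k<j. E2 f $ k = 0"
      using * by (auto simp: in_fps_power_iff on_axis_\<psi>[OF f])
    obtain A1 B1 where 1: "ratfun_at0 (\<lambda>\<tau>. f (line (c i1 \<tau>))) A1 B1" using regular_along_branch[OF _ f] by blast
    obtain A2 B2 where 2: "ratfun_at0 (\<lambda>\<tau>. f (line (c i2 \<tau>))) A2 B2" using regular_along_branch[OF _ f] by blast
    obtain C1 D1 where 3: "poly D1 0 \<noteq> 0"
      "eventually (\<lambda>\<tau>. f (line (c i1 \<tau>)) = poly C1 \<tau> / poly D1 \<tau> * (\<tau> * poly Q1 \<tau>) ^ j) near0"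
      using power_form_along[OF 1 v(1) Q(1)] .
    obtain C2 D2 where 4: "poly D2 0 \<noteq> 0"
      "eventually (\<lambda>\<tau>. f (line (c i2 \<tau>)) = poly C2 \<tau> / poly D2 \<tau> * (\<tau> * poly Q2 \<tau>) ^ j) near0"
      using power_form_along[OF 2 v(2) Q(2)] .
    define a where "a k q = (if k = (0::nat) then poly C1 (u q) / poly D1 (u q) else poly C2 (u q) / poly D2 (u q))" for k q
    define g where "g k l = (if k = (0::nat) then y1 else y2)" for k and l :: nat
    have "germ_eq X p f (\<lambda>q. \<Sum>k<2. a k q * (\<Prod>l<j. g k l q))"
    proof (rule germ_eqI)
      fix i assume "i \<in> {i1, i2}"
      moreover have "eventually (\<lambda>\<tau>. f (line (c i1 \<tau>)) = (\<Sum>k<2. a k (line (c i1 \<tau>)) * (\<Prod>l<j. g k l (line (c i1 \<tau>))))) near0"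
        using 3(2) by (rule eventually_mono) (use False in \<open>simp add: numeral_2_eq_2 a_def g_def u_along y_along\<close>)
      moreover have "eventually (\<lambda>\<tau>. f (line (c i2 \<tau>)) = (\<Sum>k<2. a k (line (c i2 \<tau>)) * (\<Prod>l<j. g k l (line (c i2 \<tau>))))) near0"
        using 4(2) by (rule eventually_mono) (use False in \<open>simp add: numeral_2_eq_2 a_def g_def u_along y_along\<close>)
      ultimately show "eventually (\<lambda>\<tau>. f (line (c i \<tau>)) = (\<Sum>k<2. a k (line (c i \<tau>)) * (\<Prod>l<j. g k l (line (c i \<tau>))))) near0"
        by auto
    qed
    moreover have "\<forall>k<2. regular_at X p (a k)"
    proof (intro allI impI)
      fix k :: nat
      have "a k = (if k = 0 then (\<lambda>q. poly C1 (u q) / poly D1 (u q)) else (\<lambda>q. poly C2 (u q) / poly D2 (u q)))"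
        by (simp add: a_def fun_eq_iff)
      then show "regular_at X p (a k)"
        using regular_ratfun[OF 3(1), of C1] regular_ratfun[OF 4(1), of C2] by simp
    qed
    moreover have "\<forall>k<2. \<forall>l<j. g k l \<in> max_ideal X p" unfolding g_def using y_in_max_ideal by simp
    ultimately show ?thesis unfolding max_ideal_power_def
      by (intro CollectI exI[of _ 2] exI[of _ a] exI[of _ g] conjI)
  qed
qed

text \<open>\<open>q\<close> is a truncation of the series obtained from \<open>s\<close> by
  removing the constant term, dividing by the variable and dividing by \<open>Q\<close>. It serves
  to prescribe a jet of a function on one branch by means of its private coordinate.\<close>

lemma expansion_truncated:
  fixes Q :: "'k poly"
  assumes Q: "poly Q 0 \<noteq> 0"
  obtains q where "\<forall>k<j. fps_of_poly ([:s $ 0:] + [:0, 1:] * (Q * q)) $ k = s $ k"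
proof -
  define t where "t = fps_shift 1 s * inverse (fps_of_poly Q)"
  have "fps_of_poly Q $ 0 \<noteq> 0" using Q by (simp add: poly_0_coeff_0)
  then have t: "fps_of_poly Q * t = fps_shift 1 s"
    using inverse_mult_eq_1[of "fps_of_poly Q"] by (simp add: t_def mult.left_commute[of "fps_of_poly Q"] mult.commute[of "fps_of_poly Q"])
  show ?thesis
  proof (rule that[of "truncate_fps j t"], intro allI impI)
    fix k assume k: "k < j"
    have e: "fps_of_poly ([:s $ 0:] + [:0, 1:] * (Q * truncate_fps j t)) =
        fps_const (s $ 0) + fps_X * (fps_of_poly Q * fps_cutoff j t)"
      by (simp only: fps_of_poly_add fps_of_poly_mult fps_of_poly_const fps_of_poly_fps_X fps_of_poly_truncate)
    show "fps_of_poly ([:s $ 0:] + [:0, 1:] * (Q * truncate_fps j t)) $ k = s $ k"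
    proof (cases k)
      case (Suc m)
      have "(fps_of_poly Q * fps_cutoff j t) $ m = (fps_of_poly Q * t) $ m"
        by (rule fps_cutoff_right_mult_nth) (use k Suc in simp)
      then show ?thesis unfolding e t using Suc by simp
    qed (simp add: e)
  qed
qed

lemma node_p: "node X p"
proof -
  have "fps_x * fps_y dvd \<psi> (\<lambda>q. f q + g q) - (\<psi> f + \<psi> g) \<and>
        fps_x * fps_y dvd \<psi> (\<lambda>q. f q * g q) - \<psi> f * \<psi> g \<and>
        (germ_eq X p f g \<longrightarrow> fps_x * fps_y dvd \<psi> f - \<psi> g)"
    if f: "regular_at X p f" and g: "regular_at X p g" for f g
  proof -
    obtain A1 B1 where 1: "ratfun_at0 (\<lambda>\<tau>. f (line (c i1 \<tau>))) A1 B1" using regular_along_branch[OF _ f] by blast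
    obtain A2 B2 where 2: "ratfun_at0 (\<lambda>\<tau>. f (line (c i2 \<tau>))) A2 B2" using regular_along_branch[OF _ f] by blast
    obtain C1 D1 where 3: "ratfun_at0 (\<lambda>\<tau>. g (line (c i1 \<tau>))) C1 D1" using regular_along_branch[OF _ g] by blast
    obtain C2 D2 where 4: "ratfun_at0 (\<lambda>\<tau>. g (line (c i2 \<tau>))) C2 D2" using regular_along_branch[OF _ g] by blast
    have "E1 g = E1 f" "E2 g = E2 f" if "germ_eq X p f g"
      using expansion_cong[OF 1 germ_eqD[OF that]] expansion_cong[OF 2 germ_eqD[OF that]] by auto
    then show ?thesis unfolding xy_dvd_diff_iff on_axis_add on_axis_mult
        on_axis_\<psi>[OF f] on_axis_\<psi>[OF g] on_axis_\<psi>[OF regular_at_add[OF f g]] on_axis_\<psi>[OF regular_at_mult[OF f g]]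
      by (simp add: expansion_add[OF 1 3] expansion_add[OF 2 4] expansion_mult[OF 1 3] expansion_mult[OF 2 4])
  qed
  moreover have "fps_x * fps_y dvd \<psi> (\<lambda>q. k) - fps_const (fps_const k)" for k
    unfolding xy_dvd_diff_iff on_axis_\<psi>[OF regular_at_const[OF p_in_X]] on_axis_const
    by (simp add: expansion_const)
  moreover have "\<exists>f. regular_at X p f \<and> in_fps_power j (\<psi> f - s)" for j s
  proof -
    obtain q1 where q1: "\<forall>k<j. fps_of_poly ([:on_x_axis s $ 0:] + [:0, 1:] * (Q1 * q1)) $ k = on_x_axis s $ k"
      using expansion_truncated[OF Q(1)] .
    obtain q2 where q2: "\<forall>k<j. fps_of_poly ([:on_y_axis s $ 0:] + [:0, 1:] * (Q2 * q2)) $ k = on_y_axis s $ k"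
      using expansion_truncated[OF Q(2)] .
    \<comment> \<open>The two products correct the two branches independently, and the axes of
      \<open>s\<close> share their constant term. The denominators \<open>1\<close> only give the
      factors the shape of \<open>regular_ratfun\<close>.\<close>
    define f where "f q = on_x_axis s $ 0 + (y1 q * (poly q1 (u q) / poly 1 (u q)) + y2 q * (poly q2 (u q) / poly 1 (u q)))" for q
    have f: "regular_at X p f"
      unfolding f_def using regular_frac form_Y
      by (intro regular_at_add regular_at_mult regular_at_const p_in_X regular_ratfun) auto
    have "E1 f = fps_of_poly ([:on_x_axis s $ 0:] + [:0, 1:] * (Q1 * q1))"
      by (rule expansion_poly) (simp add: f_def u_along y_along algebra_simps)
    moreover have "E2 f = fps_of_poly ([:on_y_axis s $ 0:] + [:0, 1:] * (Q2 * q2))"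
      by (rule expansion_poly) (simp add: f_def u_along y_along algebra_simps on_x_axis_def on_y_axis_def)
    ultimately have "in_fps_power j (\<psi> f - s)"
      unfolding in_fps_power_iff on_axis_diff on_axis_\<psi>[OF f] using q1 q2 by auto
    then show ?thesis using f by blast
  qed
  ultimately show ?thesis unfolding node_def using p_in_X max_ideal_power_iff
    by (intro conjI exI[of _ \<psi>]) blast+
qed

end

text \<open>The dimension of the maximal ideal modulo its square is at most one at a regular point
  and two at a node. Concretely, lifts \<open>f\<close>, \<open>g\<close> of x and y modulo order
  two would both be multiples of the generator \<open>u\<close>, and a suitable nontrivial
  combination of them would lie in the square.\<close>

lemma regular_point_not_node:
  fixes X :: "'k::field ppoint set"
  assumes "regular_point X p" shows "\<not> node X p"
proof
  assume "node X p"
  then obtain \<psi> :: "('k ppoint \<Rightarrow> 'k) \<Rightarrow> 'k fps fps" where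
    hom: "\<forall>f g. regular_at X p f \<and> regular_at X p g \<longrightarrow>
        fps_x * fps_y dvd \<psi> (\<lambda>q. f q + g q) - (\<psi> f + \<psi> g) \<and>
        fps_x * fps_y dvd \<psi> (\<lambda>q. f q * g q) - \<psi> f * \<psi> g \<and>
        (germ_eq X p f g \<longrightarrow> fps_x * fps_y dvd \<psi> f - \<psi> g)"
    and const: "\<forall>c. fps_x * fps_y dvd \<psi> (\<lambda>q. c) - fps_const (fps_const c)"
    and pow: "\<forall>j. (\<forall>f. regular_at X p f \<longrightarrow> (f \<in> max_ideal_power X p j \<longleftrightarrow> in_fps_power j (\<psi> f))) \<and>
          (\<forall>s. \<exists>f. regular_at X p f \<and> in_fps_power j (\<psi> f - s))"
    unfolding node_def by blast
  obtain u where p: "p \<in> X" and u: "u \<in> max_ideal X p" and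
    gen: "\<forall>f\<in>max_ideal X p. \<exists>h. regular_at X p h \<and> germ_eq X p f (\<lambda>q. u q * h q)"
    using assms unfolding regular_point_def by blast
  have less2: "(k::nat) < 2 \<longleftrightarrow> k = 0 \<or> k = 1" for k by auto
  obtain f where f: "regular_at X p f" "in_fps_power 2 (\<psi> f - fps_x)" using pow by blast
  obtain g where g: "regular_at X p g" "in_fps_power 2 (\<psi> g - fps_y)" using pow by blast
  have fx: "on_x_axis (\<psi> f) $ 0 = 0" "on_x_axis (\<psi> f) $ 1 = 1" "on_y_axis (\<psi> f) $ 0 = 0" "on_y_axis (\<psi> f) $ 1 = 0"
    using f(2) by (auto simp: in_fps_power_iff on_axis_diff on_axis_const less2)
  have gy: "on_x_axis (\<psi> g) $ 0 = 0" "on_x_axis (\<psi> g) $ 1 = 0" "on_y_axis (\<psi> g) $ 0 = 0" "on_y_axis (\<psi> g) $ 1 = 1"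
    using g(2) by (auto simp: in_fps_power_iff on_axis_diff on_axis_y less2)
  have in_max: "f \<in> max_ideal X p" if f: "regular_at X p f" "in_fps_power 1 (\<psi> f)" for f
  proof -
    have "f \<in> max_ideal_power X p 1" using pow f by blast
    then obtain r a b where b: "\<forall>i<(r::nat). \<forall>l<(1::nat). b i l \<in> max_ideal X p"
      and ge: "germ_eq X p f (\<lambda>q. \<Sum>i<r. a i q * (\<Prod>l<1. b i l q))"
      unfolding max_ideal_power_def by blast
    have "f p = (\<Sum>i<r. a i p * (\<Prod>l<1. b i l p))" using ge unfolding germ_eq_def by blast
    also have "\<dots> = 0" using b by (intro sum.neutral) (auto simp: max_ideal_def)
    finally show ?thesis using f unfolding max_ideal_def by simp
  qed
  have "f \<in> max_ideal X p" by (rule in_max[OF f(1)]) (use fx in \<open>simp add: in_fps_power_iff\<close>)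
  then obtain h where h: "regular_at X p h" "germ_eq X p f (\<lambda>q. u q * h q)" using gen by blast
  have "g \<in> max_ideal X p" by (rule in_max[OF g(1)]) (use gy in \<open>simp add: in_fps_power_iff\<close>)
  then obtain k where k: "regular_at X p k" "germ_eq X p g (\<lambda>q. u q * k q)" using gen by blast
  \<comment> \<open>If the cofactor \<open>\<alpha> * h + \<beta> * k\<close> of \<open>u\<close>
    vanishes at \<open>p\<close>, the combination of \<open>f\<close> and \<open>g\<close> lies in
    the square, so its linear coefficients \<alpha> and \<beta> on the axes vanish.\<close>
  have zero: "\<alpha> = 0 \<and> \<beta> = 0" if ab: "\<alpha> * h p + \<beta> * k p = 0" for \<alpha> \<beta>
  proof -
    define F where "F q = \<alpha> * f q + \<beta> * g q" for q
    define H where "H q = \<alpha> * h q + \<beta> * k q" for q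
    note rc = regular_at_const[OF p]
    have r: "regular_at X p (\<lambda>q. \<alpha> * f q)" "regular_at X p (\<lambda>q. \<beta> * g q)"
      using regular_at_mult[OF rc f(1)] regular_at_mult[OF rc g(1)] by auto
    have F: "regular_at X p F" unfolding F_def by (rule regular_at_add[OF r])
    have H: "H \<in> max_ideal X p"
      unfolding max_ideal_def H_def using ab
      by (auto intro!: regular_at_add regular_at_mult rc h(1) k(1))
    have "germ_eq X p F (\<lambda>q. \<Sum>i<(1::nat). 1 * (\<Prod>l<(2::nat). if l = 0 then u q else H q))"
    proof -
      obtain U where U: "zopen X U" "p \<in> U" "\<forall>q\<in>U. f q = u q * h q" using h(2) unfolding germ_eq_def by blast
      obtain V where V: "zopen X V" "p \<in> V" "\<forall>q\<in>V. g q = u q * k q" using k(2) unfolding germ_eq_def by blast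
      have "\<forall>q\<in>U \<inter> V. F q = (\<Sum>i<(1::nat). 1 * (\<Prod>l<(2::nat). if l = 0 then u q else H q))"
        using U(3) V(3) by (simp add: F_def H_def numeral_2_eq_2 algebra_simps)
      then show ?thesis unfolding germ_eq_def using zopen_Int[OF U(1) V(1)] U(2) V(2) by blast
    qed
    then have "F \<in> max_ideal_power X p 2"
      unfolding max_ideal_power_def using rc u H
      by (intro CollectI exI[of _ 1] exI[of _ "\<lambda>_ _. 1"] exI[of _ "\<lambda>_ l. if l = 0 then u else H"])
         (auto simp: if_distrib[of "\<lambda>f. f _"])
    then have "in_fps_power 2 (\<psi> F)" using pow F by blast
    then have FF: "on_x_axis (\<psi> F) $ 1 = 0" "on_y_axis (\<psi> F) $ 1 = 0" by (auto simp: in_fps_power_iff)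
    have "fps_x * fps_y dvd \<psi> F - (\<psi> (\<lambda>q. \<alpha> * f q) + \<psi> (\<lambda>q. \<beta> * g q))"
      using hom r unfolding F_def by blast
    moreover have "fps_x * fps_y dvd \<psi> (\<lambda>q. \<alpha> * f q) - \<psi> (\<lambda>q. \<alpha>) * \<psi> f" using hom rc f(1) by blast
    moreover have "fps_x * fps_y dvd \<psi> (\<lambda>q. \<beta> * g q) - \<psi> (\<lambda>q. \<beta>) * \<psi> g" using hom rc g(1) by blast
    moreover have "fps_x * fps_y dvd \<psi> (\<lambda>q. \<alpha>) - fps_const (fps_const \<alpha>)" "fps_x * fps_y dvd \<psi> (\<lambda>q. \<beta>) - fps_const (fps_const \<beta>)"
      using const by auto
    ultimately have "on_x_axis (\<psi> F) = fps_const \<alpha> * on_x_axis (\<psi> f) + fps_const \<beta> * on_x_axis (\<psi> g)"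
      "on_y_axis (\<psi> F) = fps_const \<alpha> * on_y_axis (\<psi> f) + fps_const \<beta> * on_y_axis (\<psi> g)"
      unfolding xy_dvd_diff_iff by (simp_all add: on_axis_add on_axis_mult on_axis_const)
    then show ?thesis using FF fx gy by simp
  qed
  \<comment> \<open>The coefficients \<open>k p\<close> and \<open>- h p\<close> form a relation,
    which forces \<open>h p = k p = 0\<close>; then \<open>1\<close> and \<open>0\<close> form a
    relation as well.\<close>
  show False using zero[of "k p" "- h p"] zero[of 1 0] by simp
qed

section \<open>Irreducibility and dimension\<close>

text \<open>An infinite set with the cofinite topology. Irreducibility and dimension one follow from
  this alone, without commutative algebra.\<close>

definition curvelike :: "'k::field ppoint set \<Rightarrow> bool" where
  "curvelike K \<longleftrightarrow> infinite K \<and> (\<exists>n. K \<subseteq> proj_space n) \<and>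
     (\<forall>W. proj_algebraic W \<longrightarrow> K \<subseteq> W \<or> finite (K \<inter> W))"

lemma zclosed_finite:
  assumes "finite Z" "Z \<subseteq> X" "X \<subseteq> proj_space n" shows "zclosed X Z"
proof -
  have "proj_algebraic Z" using assms by (intro proj_algebraic_finite[of Z n]) auto
  moreover have "Z = X \<inter> Z" using assms by blast
  ultimately show ?thesis unfolding zclosed_def by (intro exI[of _ Z] conjI)
qed

lemma zirreducible_point: "zirreducible {p}"
  unfolding zirreducible_def
proof (intro conjI allI impI)
  fix Z W assume "zclosed {p} Z \<and> zclosed {p} W \<and> {p} = Z \<union> W"
  then have "{p} = Z \<union> W" by blast
  then show "{p} = Z \<or> {p} = W" by (metis Un_singleton_iff)
qed simp

lemma zirreducible_finite_imp_point:
  assumes "zirreducible Z" "finite Z" "Z \<subseteq> proj_space n" obtains q where "Z = {q}"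
proof -
  obtain q where q: "q \<in> Z" using assms(1) unfolding zirreducible_def by blast
  have "zclosed Z {q}" "zclosed Z (Z - {q})" "Z = {q} \<union> (Z - {q})"
    using q assms by (auto intro!: zclosed_finite)
  then have "Z = {q} \<or> Z = Z - {q}" using assms(1) unfolding zirreducible_def by blast
  then have "Z = {q}" using q by blast
  then show ?thesis by (rule that)
qed

lemma curvelike_irreducible: "curvelike K \<Longrightarrow> zirreducible K"
  unfolding zirreducible_def
proof (intro conjI allI impI)
  assume K: "curvelike K"
  then show "K \<noteq> {}" unfolding curvelike_def by auto
  fix Z W assume *: "zclosed K Z \<and> zclosed K W \<and> K = Z \<union> W"
  then obtain V V' where V: "proj_algebraic V" "Z = K \<inter> V" "proj_algebraic V'" "W = K \<inter> V'"
    unfolding zclosed_def by blast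
  show "K = Z \<or> K = W"
  proof (rule ccontr)
    assume "\<not> (K = Z \<or> K = W)"
    then have "finite Z" "finite W" using K V unfolding curvelike_def by blast+
    then have "finite (Z \<union> W)" by blast
    then show False using K * unfolding curvelike_def by blast
  qed
qed

text \<open>In a longer chain the middle term would be a proper closed subset, hence finite, and
  being irreducible a single point, with no room for a smaller nonempty term.\<close>

lemma curvelike_has_dimension:
  assumes K: "curvelike K" shows "has_dimension K 1"
proof -
  obtain n where n: "K \<subseteq> proj_space n" using K unfolding curvelike_def by blast
  obtain q where q: "q \<in> K" using K unfolding curvelike_def by fastforce
  have closed_K: "zclosed K K"
    unfolding zclosed_def by (rule exI[of _ "proj_space n"]) (use n proj_algebraic_proj_space in auto)
  have "{q} \<noteq> K" using K unfolding curvelike_def by auto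
  then have "irreducible_chain K 1"
    unfolding irreducible_chain_def
    by (intro exI[of _ "\<lambda>i. if i = (0::nat) then {q} else K"])
       (use q n closed_K curvelike_irreducible[OF K] zirreducible_point in \<open>auto intro!: zclosed_finite\<close>)
  moreover have "\<not> irreducible_chain K (Suc 1)"
  proof
    assume "irreducible_chain K (Suc 1)"
    then obtain Z where Z: "\<And>i. i \<le> Suc 1 \<Longrightarrow> zclosed K (Z i) \<and> zirreducible (Z i)"
      "\<And>i. i < Suc 1 \<Longrightarrow> Z i \<subset> Z (Suc i)" unfolding irreducible_chain_def by blast
    have "Z 2 \<subseteq> K" using Z(1)[of 2] unfolding zclosed_def by auto
    then have ne: "Z 1 \<subseteq> K" "Z 1 \<noteq> K" using Z(2)[of 1] by (auto simp: numeral_2_eq_2)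
    obtain V where V: "proj_algebraic V" "Z 1 = K \<inter> V" using Z(1)[of 1] unfolding zclosed_def by auto
    have "zirreducible (Z 1)" using Z(1)[of 1] by simp
    moreover have "finite (Z 1)"
    proof -
      have "K \<subseteq> V \<or> finite (K \<inter> V)" using K V(1) unfolding curvelike_def by simp
      moreover have "\<not> K \<subseteq> V" using V(2) ne(2) by auto
      ultimately show ?thesis using V(2) by simp
    qed
    moreover have "Z 1 \<subseteq> proj_space n" using ne(1) n by (rule subset_trans)
    ultimately obtain r where "Z 1 = {r}" by (rule zirreducible_finite_imp_point)
    moreover have "Z 0 \<subset> Z 1" using Z(2)[of 0] by simp
    moreover have "Z 0 \<noteq> {}" using Z(1)[of 0] unfolding zirreducible_def by simp
    ultimately show False using subset_singletonD[of "Z 0" r] by (simp add: psubset_eq)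
  qed
  ultimately show ?thesis unfolding has_dimension_def by simp
qed

section \<open>Rational curves\<close>

definition vec2 :: "'k::zero \<Rightarrow> 'k \<Rightarrow> nat \<Rightarrow> 'k" where
  "vec2 s t i = (if i = 0 then s else if i = 1 then t else 0)"

lemma vec2_simps: "vec2 s t 0 = s" "vec2 s t (Suc 0) = t" "vec2 s t 1 = t" "i > 1 \<Longrightarrow> vec2 s t i = 0"
  by (auto simp: vec2_def)

lemma vec2_scale: "vec2 (c * s) (c * t) = (\<lambda>i. c * vec2 s t i :: 'k::field)"
  by (auto simp: vec2_def)

lemma vec2_eta: "(\<forall>i>1. x i = 0) \<Longrightarrow> x = vec2 (x 0) (x 1)"
  by (rule ext) (auto simp: vec2_def)

lemma form_poly_vec2:
  assumes "form d F"
  shows "\<exists>A. \<forall>\<tau>. F (vec2 1 (a + \<tau>)) = poly A \<tau>" "\<exists>A. \<forall>\<tau>. F (vec2 \<tau> b) = poly A \<tau>"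
proof -
  have "\<exists>q. \<forall>\<tau>. vec2 1 (a + \<tau>) i = poly q \<tau>" for i
    by (rule exI[of _ "if i = 0 then 1 else if i = 1 then [:a, 1:] else 0"]) (auto simp: vec2_def)
  then show "\<exists>A. \<forall>\<tau>. F (vec2 1 (a + \<tau>)) = poly A \<tau>" by (rule form_poly_along[OF assms])
  have "\<exists>q. \<forall>\<tau>. vec2 \<tau> b i = poly q \<tau>" for i
    by (rule exI[of _ "if i = 0 then [:0, 1:] else if i = 1 then [:b:] else 0"]) (auto simp: vec2_def)
  then show "\<exists>A. \<forall>\<tau>. F (vec2 \<tau> b) = poly A \<tau>" by (rule form_poly_along[OF assms])
qed

text \<open>The delicate case is a form known to be nonzero only at infinity, \<open>s = 0\<close>.
  If it vanished at all affine points, then with \<open>t\<close> fixed it would be a polynomial in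
  the first variable with all nonzero elements as roots, hence zero.\<close>

lemma binary_form_finite_zeros:
  fixes F :: "(nat \<Rightarrow> 'k::alg_closed_field) \<Rightarrow> 'k"
  assumes F: "form d F" and ne: "F (vec2 s t) \<noteq> 0"
  shows "finite {\<tau>. F (vec2 1 \<tau>) = 0}"
proof -
  obtain A where A: "\<forall>\<tau>. F (vec2 1 (0 + \<tau>)) = poly A \<tau>" using form_poly_vec2(1)[OF F] by blast
  have A: "F (vec2 1 \<tau>) = poly A \<tau>" for \<tau> using A by simp
  have "A \<noteq> 0"
  proof
    assume "A = 0"
    have z: "F (vec2 s t) = 0" if "s \<noteq> 0" for s
    proof -
      have "vec2 s t = (\<lambda>i. s * vec2 1 (t / s) i)" using vec2_scale[of s 1 "t / s"] that by simp
      then show ?thesis using form_scale[OF F, of s "vec2 1 (t / s)"] A \<open>A = 0\<close> by simp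
    qed
    obtain B where B: "\<forall>\<tau>. F (vec2 \<tau> t) = poly B \<tau>" using form_poly_vec2(2)[OF F] by blast
    have "UNIV - {0} \<subseteq> {\<tau>. poly B \<tau> = 0}" using z B by auto
    moreover have "infinite (UNIV - {0 :: 'k})" using infinite_UNIV_alg_closed by simp
    ultimately have "B = 0" using poly_roots_finite[of B] finite_subset by blast
    then show False using ne B by simp
  qed
  then show ?thesis using poly_roots_finite[of A] by (simp add: A)
qed

text \<open>Homogenizing \<open>P\<close> to degree \<open>m\<close> gives all coordinates the same
  degree, so that the map is defined on points. The private coordinate \<open>j\<close> is meant to
  lie beyond \<open>m\<close>.\<close>

definition rational_param :: "nat \<Rightarrow> nat \<Rightarrow> 'k::field poly \<Rightarrow> (nat \<Rightarrow> 'k) \<Rightarrow> nat \<Rightarrow> 'k" where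
  "rational_param m j P x i = (if i \<le> m then x 0 ^ (m - i) * x 1 ^ i
     else if i = j then homogenize P m (x 0) (x 1) else 0)"

definition rational_curve :: "nat \<Rightarrow> nat \<Rightarrow> 'k::field poly \<Rightarrow> 'k ppoint set" where
  "rational_curve m j P = {line (rational_param m j P (vec2 s t)) | s t. s \<noteq> 0 \<or> t \<noteq> 0}"

definition affine_point :: "nat \<Rightarrow> nat \<Rightarrow> 'k::field poly \<Rightarrow> 'k \<Rightarrow> 'k ppoint" where
  "affine_point m j P t = line (rational_param m j P (vec2 1 t))"

definition infinite_point :: "nat \<Rightarrow> nat \<Rightarrow> 'k::field poly \<Rightarrow> 'k ppoint" where
  "infinite_point m j P = line (rational_param m j P (vec2 0 1))"

lemma form_rational_param: "form m (\<lambda>x. rational_param m j P x i)"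
proof -
  consider "i \<le> m" | "i > m" "i = j" | "i > m" "i \<noteq> j" by linarith
  then show ?thesis
  proof cases
    case 1
    have "form ((m - i) * 1 + i * 1) (\<lambda>x :: nat \<Rightarrow> 'a. x 0 ^ (m - i) * x 1 ^ i)"
      by (intro form_mult form_power form_var)
    then show ?thesis using 1 by (simp add: rational_param_def)
  next
    case 2
    have "form (m * 1) (\<lambda>x :: nat \<Rightarrow> 'a. homogenize P m (x 0) (x 1))"
      by (intro form_homogenize form_var)
    then show ?thesis using 2 by (simp add: rational_param_def)
  next
    case 3
    then show ?thesis by (simp add: rational_param_def form_zero)
  qed
qed

lemma rational_curve_eq:
  "rational_curve m j P = insert (infinite_point m j P) (range (affine_point m j P))"
proof -
  note sc = form_scale[OF form_rational_param[of m j P]]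
  have "line (rational_param m j P (vec2 s t)) \<in> insert (infinite_point m j P) (range (affine_point m j P))"
    if "s \<noteq> 0 \<or> t \<noteq> 0" for s t
  proof (cases "s = 0")
    case True
    have "vec2 s t = (\<lambda>i. t * vec2 0 1 i)" using vec2_scale[of t 0 1] True by simp
    then have "rational_param m j P (vec2 s t) = (\<lambda>i. t ^ m * rational_param m j P (vec2 0 1) i)"
      using sc[where c = t and x = "vec2 0 1"] by auto
    then show ?thesis using True that by (simp add: line_eq_scaled infinite_point_def)
  next
    case False
    have "vec2 s t = (\<lambda>i. s * vec2 1 (t / s) i)" using vec2_scale[of s 1 "t / s"] False by simp
    then have "rational_param m j P (vec2 s t) = (\<lambda>i. s ^ m * rational_param m j P (vec2 1 (t / s)) i)"
      using sc[where c = s and x = "vec2 1 (t / s)"] by auto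
    then show ?thesis using False by (simp add: line_eq_scaled affine_point_def)
  qed
  moreover have "infinite_point m j P \<in> rational_curve m j P"
    unfolding infinite_point_def rational_curve_def by (intro CollectI exI[of _ 0] exI[of _ 1]) simp
  moreover have "affine_point m j P t \<in> rational_curve m j P" for t
    unfolding affine_point_def rational_curve_def by (intro CollectI exI[of _ 1] exI[of _ t]) simp
  ultimately show ?thesis unfolding rational_curve_def by blast
qed

lemma rational_param_nonzero:
  assumes "s \<noteq> 0 \<or> t \<noteq> 0" shows "\<exists>i\<le>m. rational_param m j P (vec2 s t) i \<noteq> 0"
proof (cases "s = 0")
  case True
  then show ?thesis using assms
    by (intro exI[of _ m]) (simp add: rational_param_def vec2_simps)
next
  case False
  then show ?thesis by (intro exI[of _ 0]) (simp add: rational_param_def vec2_simps)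
qed

lemma rational_curve_subset: "m < j \<Longrightarrow> rational_curve m j P \<subseteq> proj_space j"
proof
  fix p assume "m < j" "p \<in> rational_curve m j P"
  then obtain s t where p: "p = line (rational_param m j P (vec2 s t))" and st: "s \<noteq> 0 \<or> t \<noteq> 0"
    unfolding rational_curve_def by blast
  have "\<forall>i>j. rational_param m j P (vec2 s t) i = 0" using \<open>m < j\<close> by (simp add: rational_param_def)
  then show "p \<in> proj_space j"
    unfolding p line_in_proj_space using rational_param_nonzero[OF st, of m j P] by blast
qed

lemma rational_param_affine:
  assumes "degree P \<le> m"
  shows "i \<le> m \<Longrightarrow> rational_param m j P (vec2 1 t) i = t ^ i"
    "m < j \<Longrightarrow> rational_param m j P (vec2 1 t) j = poly P t"
    "m < i \<Longrightarrow> i \<noteq> j \<Longrightarrow> rational_param m j P (vec2 1 t) i = 0"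
  using assms by (simp_all add: rational_param_def vec2_simps homogenize_one)

lemma rational_param_infinite:
  shows "i \<le> m \<Longrightarrow> rational_param m j P (vec2 0 1) i = (if i = m then 1 else 0)"
    "m < j \<Longrightarrow> rational_param m j P (vec2 0 1) j = coeff P m"
    "m < i \<Longrightarrow> i \<noteq> j \<Longrightarrow> rational_param m j P (vec2 0 1) i = 0"
  by (simp_all add: rational_param_def vec2_simps homogenize_zero_left)

text \<open>Coordinate 0 is 1 on both sides, which fixes the scalar; coordinate 1 recovers the
  parameter, which is where \<open>0 < m\<close> enters. A private coordinate is zero on every curve
  with another index, so equality forces both polynomials to vanish.\<close>

lemma affine_point_eqD:
  assumes m: "0 < m" and P: "degree P \<le> m" "degree P' \<le> m" and j: "m < j" "m < j'"
    and eq: "affine_point m j P t = affine_point m j' P' t'"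
  shows "t = t'" "j \<noteq> j' \<Longrightarrow> poly P t = 0 \<and> poly P' t = 0"
proof -
  obtain c where c: "c \<noteq> 0" "rational_param m j P (vec2 1 t) = (\<lambda>i. c * rational_param m j' P' (vec2 1 t') i)"
    using eq unfolding affine_point_def by (rule line_eqE)
  then have e: "rational_param m j P (vec2 1 t) i = c * rational_param m j' P' (vec2 1 t') i" for i by simp
  have "c = 1" using e[of 0] P by (simp add: rational_param_affine)
  then show "t = t'" using e[of 1] P m by (simp add: rational_param_affine)
  then show "poly P t = 0 \<and> poly P' t = 0" if "j \<noteq> j'"
    using e[of j] e[of j'] P j that \<open>c = 1\<close> by (simp add: rational_param_affine)
qed

lemma affine_point_eqI:
  assumes P: "degree P \<le> m" "degree P' \<le> m" and j: "m < j" "m < j'" and z: "poly P t = 0" "poly P' t = 0"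
  shows "affine_point m j P t = affine_point m j' P' t"
proof -
  have "rational_param m j P (vec2 1 t) i = rational_param m j' P' (vec2 1 t) i" for i
    using j z by (cases "i \<le> m"; cases "i = j"; cases "i = j'")
      (auto simp: rational_param_affine[OF P(1)] rational_param_affine[OF P(2)])
  then show ?thesis unfolding affine_point_def by presburger
qed

lemma affine_point_neq_infinite_point:
  assumes m: "0 < m" and P: "degree P \<le> m"
  shows "affine_point m j P t \<noteq> infinite_point m j' P'"
proof
  assume "affine_point m j P t = infinite_point m j' P'"
  then obtain c where "rational_param m j P (vec2 1 t) = (\<lambda>i. c * rational_param m j' P' (vec2 0 1) i)"
    unfolding affine_point_def infinite_point_def by (rule line_eqE)
  from fun_cong[OF this, of 0] show False using m P by (simp add: rational_param_affine rational_param_infinite)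
qed

text \<open>All points at infinity agree in the coordinates up to \<open>m\<close>; only the
  coefficients at degree \<open>m\<close>, seen in the private coordinates, can separate
  them.\<close>

lemma infinite_point_eqD:
  assumes j: "m < j" "m < j'" "j \<noteq> j'" and eq: "infinite_point m j P = infinite_point m j' P'"
  shows "coeff P m = 0" "coeff P' m = 0"
proof -
  obtain c where c: "c \<noteq> 0" "rational_param m j P (vec2 0 1) = (\<lambda>i. c * rational_param m j' P' (vec2 0 1) i)"
    using eq unfolding infinite_point_def by (rule line_eqE)
  from fun_cong[OF c(2), of j] fun_cong[OF c(2), of j'] j c(1)
  show "coeff P m = 0" "coeff P' m = 0" by (auto simp: rational_param_infinite)
qed

text \<open>If \<open>W\<close> does not contain the curve, one of its equations pulls back along
  the parametrization to a binary form that is not identically zero.\<close>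

lemma curvelike_rational_curve:
  fixes P :: "'k::alg_closed_field poly"
  assumes m: "0 < m" and P: "degree P \<le> m" and j: "m < j"
  shows "curvelike (rational_curve m j P)"
proof -
  have "inj (affine_point m j P)" using affine_point_eqD(1)[OF m P P j j] by (rule injI)
  then have "infinite (range (affine_point m j P))"
    using infinite_UNIV_alg_closed finite_imageD by blast
  then have "infinite (rational_curve m j P)" unfolding rational_curve_eq by simp
  moreover have "rational_curve m j P \<subseteq> W \<or> finite (rational_curve m j P \<inter> W)" if W: "proj_algebraic W" for W
  proof (cases "rational_curve m j P \<subseteq> W")
    case False
    then obtain s t where st: "s \<noteq> 0 \<or> t \<noteq> 0" "line (rational_param m j P (vec2 s t)) \<notin> W"
      unfolding rational_curve_def by blast
    obtain l T where T: "W \<subseteq> proj_space l" "\<forall>F\<in>T. \<exists>d. form d F"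
      "\<forall>n x. line x \<in> proj_space n \<longrightarrow> (line x \<in> W \<longleftrightarrow> (\<forall>F\<in>T. F x = 0))"
      using W by (rule proj_algebraicE)
    have on: "line (rational_param m j P (vec2 s t)) \<in> proj_space j" if "s \<noteq> 0 \<or> t \<noteq> 0" for s t
      using rational_curve_subset[OF j, of P] that unfolding rational_curve_def by blast
    obtain F where F: "F \<in> T" "F (rational_param m j P (vec2 s t)) \<noteq> 0" using st T(3) on by blast
    obtain d where d: "form d F" using T(2) F(1) by blast
    have "form (d * m) (\<lambda>x. F (rational_param m j P x))"
      by (rule form_compose[OF d form_rational_param])
    from binary_form_finite_zeros[OF this F(2)]
    have "finite {\<tau>. F (rational_param m j P (vec2 1 \<tau>)) = 0}" .
    moreover have "{\<tau>. affine_point m j P \<tau> \<in> W} \<subseteq> {\<tau>. F (rational_param m j P (vec2 1 \<tau>)) = 0}"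
    proof (intro subsetI CollectI)
      fix \<tau> assume "\<tau> \<in> {\<tau>. affine_point m j P \<tau> \<in> W}"
      then have "line (rational_param m j P (vec2 1 \<tau>)) \<in> W" by (simp add: affine_point_def)
      then show "F (rational_param m j P (vec2 1 \<tau>)) = 0" using T(3) F(1) on[of 1 \<tau>] by simp
    qed
    ultimately have "finite {\<tau>. affine_point m j P \<tau> \<in> W}" by (rule finite_subset[rotated])
    moreover have "rational_curve m j P \<inter> W \<subseteq>
        insert (infinite_point m j P) (affine_point m j P ` {\<tau>. affine_point m j P \<tau> \<in> W})"
      unfolding rational_curve_eq by blast
    ultimately show ?thesis by (meson finite_imageI finite_insert finite_subset)
  qed simp
  ultimately show ?thesis unfolding curvelike_def using rational_curve_subset[OF j] by blast
qed

text \<open>\<open>T1\<close> determines the points with \<open>x 0\<close> nonzero and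
  \<open>T2\<close> the remaining one. As \<open>P\<close> has degree at most \<open>m\<close>, the
  private coordinate is a linear combination of the monomials, which is \<open>T4\<close>: the curve
  is a graph over a rational normal curve.\<close>

lemma proj_algebraic_rational_curve:
  assumes m: "0 < m" and P: "degree P \<le> m" and j: "m < j"
  shows "proj_algebraic (rational_curve m j P)"
proof -
  define T1 where "T1 = {\<lambda>x :: nat \<Rightarrow> 'a. x 0 * x (Suc i) - x 1 * x i | i. i < m}"
  define T2 where "T2 = {\<lambda>x :: nat \<Rightarrow> 'a. x (Suc i) * x (Suc i) - x i * x (Suc (Suc i)) | i. Suc i < m}"
  define T3 where "T3 = {\<lambda>x :: nat \<Rightarrow> 'a. x i | i. m < i \<and> i < j}"
  define T4 where "T4 = {\<lambda>x :: nat \<Rightarrow> 'a. x j - (\<Sum>i\<le>m. coeff P i * x i)}"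
  show ?thesis
  proof (rule proj_algebraicI[OF rational_curve_subset[OF j], of "T1 \<union> T2 \<union> T3 \<union> T4"])
    fix F assume "F \<in> T1 \<union> T2 \<union> T3 \<union> T4"
    moreover have "form (1 + 1) (\<lambda>x :: nat \<Rightarrow> 'a. x a * x b - x c * x d)" for a b c d
      by (intro form_diff form_mult form_var)
    moreover have "form 1 (\<lambda>x :: nat \<Rightarrow> 'a. x j - (\<Sum>i\<le>m. coeff P i * x i))"
      by (intro form_diff form_var form_sum form_cmult)
    ultimately show "\<exists>d. form d F" unfolding T1_def T2_def T3_def T4_def using form_var by blast
  next
    fix x :: "nat \<Rightarrow> 'a" assume x: "line x \<in> proj_space j"
    let ?R = "rational_param m j P"
    show "line x \<in> rational_curve m j P \<longleftrightarrow> (\<forall>F\<in>T1 \<union> T2 \<union> T3 \<union> T4. F x = 0)"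
    proof
      assume "line x \<in> rational_curve m j P"
      then obtain s t where "line x = line (?R (vec2 s t))" unfolding rational_curve_def by blast
      then obtain c where xc: "x = (\<lambda>i. c * ?R (vec2 s t) i)" by (rule line_eqE)
      have xi: "x i = c * (s ^ (m - i) * t ^ i)" if "i \<le> m" for i
        using that by (simp add: xc rational_param_def vec2_simps)
      have "x 0 * x (Suc i) = x 1 * x i" if "i < m" for i
      proof -
        have "s ^ m * s ^ (m - Suc i) = s ^ (m - 1) * s ^ (m - i)"
          using that by (simp add: power_add[symmetric])
        then have "(c * c * t ^ Suc i) * (s ^ m * s ^ (m - Suc i)) = (c * c * t ^ Suc i) * (s ^ (m - 1) * s ^ (m - i))"
          by simp
        then show ?thesis using that m by (simp add: xi mult_ac)
      qed
      moreover have "x (Suc i) * x (Suc i) = x i * x (Suc (Suc i))" if "Suc i < m" for i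
      proof -
        have "s ^ (m - Suc i) * s ^ (m - Suc i) = s ^ (m - i) * s ^ (m - Suc (Suc i))"
          using that by (simp add: power_add[symmetric])
        then have "(c * c * t ^ Suc i * t ^ Suc i) * (s ^ (m - Suc i) * s ^ (m - Suc i)) =
            (c * c * t ^ Suc i * t ^ Suc i) * (s ^ (m - i) * s ^ (m - Suc (Suc i)))" by simp
        then show ?thesis using that by (simp add: xi mult_ac)
      qed
      moreover have "x i = 0" if "m < i" "i < j" for i using that by (simp add: xc rational_param_def)
      moreover have "x j = (\<Sum>i\<le>m. coeff P i * x i)"
        using j by (simp add: xc rational_param_def vec2_simps homogenize_def sum_distrib_left mult_ac)
      ultimately show "\<forall>F\<in>T1 \<union> T2 \<union> T3 \<union> T4. F x = 0" unfolding T1_def T2_def T3_def T4_def by auto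
    next
      assume z: "\<forall>F\<in>T1 \<union> T2 \<union> T3 \<union> T4. F x = 0"
      have e1: "x 0 * x (Suc i) = x 1 * x i" if "i < m" for i
      proof -
        have "(\<lambda>x. x 0 * x (Suc i) - x 1 * x i) \<in> T1 \<union> T2 \<union> T3 \<union> T4"
          unfolding T1_def using that by blast
        from bspec[OF z this] show ?thesis by simp
      qed
      have e2: "x (Suc i) * x (Suc i) = x i * x (Suc (Suc i))" if "Suc i < m" for i
      proof -
        have "(\<lambda>x. x (Suc i) * x (Suc i) - x i * x (Suc (Suc i))) \<in> T1 \<union> T2 \<union> T3 \<union> T4"
          unfolding T2_def using that by blast
        from bspec[OF z this] show ?thesis by simp
      qed
      have e3: "x i = 0" if "m < i" "i < j" for i
      proof -
        have "(\<lambda>x. x i) \<in> T1 \<union> T2 \<union> T3 \<union> T4"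
          unfolding T3_def using that by blast
        from bspec[OF z this] show ?thesis by simp
      qed
      have e4: "x j = (\<Sum>i\<le>m. coeff P i * x i)" using z unfolding T4_def by simp
      have x0: "x i = 0" if "i > j" for i using x that by (simp add: line_in_proj_space)
      show "line x \<in> rational_curve m j P"
      proof (cases "x 0 = 0")
        case False
        define t where "t = x 1 / x 0"
        have xi: "x i = x 0 * t ^ i" if "i \<le> m" for i
          using that
        proof (induction i)
          case (Suc i)
          then have "x 0 * x (Suc i) = x 0 * (x 0 * t ^ Suc i)"
            using e1[of i] False by (simp add: t_def)
          then show ?case using False by simp
        qed simp
        have xj: "x j = x 0 * poly P t"
        proof -
          have "(\<Sum>i\<le>m. coeff P i * x i) = (\<Sum>i\<le>m. x 0 * (coeff P i * t ^ i))"
          proof (rule sum.cong)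
            fix i assume "i \<in> {..m}"
            then have "x i = x 0 * t ^ i" using xi[of i] by simp
            then show "coeff P i * x i = x 0 * (coeff P i * t ^ i)" by (simp only: mult_ac)
          qed simp
          also have "\<dots> = x 0 * homogenize P m 1 t" by (simp add: homogenize_def sum_distrib_left)
          finally show ?thesis using e4 P by (simp add: homogenize_one)
        qed
        have "x = (\<lambda>i. x 0 * ?R (vec2 1 t) i)"
        proof
          fix i
          consider "i \<le> m" | "i = j" | "m < i" "i < j" | "m < i" "j < i" using j by linarith
          then show "x i = x 0 * ?R (vec2 1 t) i"
            by cases (use j xi[of i] xj e3[of i] x0[of i] in \<open>auto simp: rational_param_affine[OF P]\<close>)
        qed
        then have "line x = line (\<lambda>i. x 0 * ?R (vec2 1 t) i)" by (rule arg_cong)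
        then have "line x = affine_point m j P t"
          unfolding affine_point_def line_eq_scaled[OF False] .
        then show ?thesis unfolding rational_curve_eq by blast
      next
        case True
        \<comment> \<open>With \<open>x 0 = 0\<close>, the equations \<open>T2\<close> force the
          coordinates before \<open>m\<close> to vanish one after the other, which leaves only the
          point at infinity.\<close>
        have xi: "x i = 0" if "i < m" for i
          using that
        proof (induction i)
          case (Suc i)
          then show ?case using e2[of i] by simp
        qed (use True in simp)
        have xj: "x j = x m * coeff P m"
        proof -
          have "(\<Sum>i\<le>m. coeff P i * x i) = (\<Sum>i\<le>m. if i = m then coeff P m * x m else 0)"
            by (rule sum.cong) (auto simp: xi)
          then show ?thesis using e4 by (simp add: mult.commute)
        qed
        have eq: "x = (\<lambda>i. x m * ?R (vec2 0 1) i)"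
        proof
          fix i
          consider "i < m" | "i = m" | "i = j" | "m < i" "i < j" | "m < i" "j < i" using j by linarith
          then show "x i = x m * ?R (vec2 0 1) i"
            by cases (use j xi xj e3[of i] x0[of i] in \<open>auto simp: rational_param_infinite\<close>)
        qed
        have "x m \<noteq> 0"
        proof
          assume "x m = 0"
          then have "x i = 0" for i using fun_cong[OF eq, of i] by simp
          then show False using x by (simp add: line_in_proj_space)
        qed
        moreover have "line x = line (\<lambda>i. x m * ?R (vec2 0 1) i)" using eq by (rule arg_cong)
        ultimately have "line x = infinite_point m j P"
          unfolding infinite_point_def by (simp add: line_eq_scaled)
        then show ?thesis unfolding rational_curve_eq by blast
      qed
    qed
  qed
qed

text \<open>With \<open>m = 1\<close> and \<open>P = 0\<close> the parametrization is the identity,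
  so the results on rational curves also cover the projective line.\<close>

lemma proj_line_eq: "proj_space 1 = rational_curve 1 2 0"
proof -
  have R: "rational_param 1 2 0 (vec2 s t) = vec2 s t" for s t :: 'a
  proof
    fix i :: nat
    consider "i = 0" | "i = 1" | "i > 1" by linarith
    then show "rational_param 1 2 0 (vec2 s t) i = vec2 s t i"
      by cases (auto simp: rational_param_def vec2_def homogenize_def)
  qed
  show ?thesis
  proof (intro set_eqI iffI)
    fix p :: "'a ppoint" assume "p \<in> proj_space 1"
    then obtain x where x: "p = line x" "\<exists>i. x i \<noteq> 0" "\<forall>i>1. x i = 0" by (rule proj_spaceE)
    have "x = vec2 (x 0) (x 1)" using x(3) by (rule vec2_eta)
    moreover from this have "x 0 \<noteq> 0 \<or> x 1 \<noteq> 0" using x(2) by (metis vec2_def)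
    ultimately show "p \<in> rational_curve 1 2 0" unfolding rational_curve_def R using x(1)
      by (intro CollectI exI[of _ "x 0"] exI[of _ "x 1"]) simp
  next
    fix p :: "'a ppoint" assume "p \<in> rational_curve 1 2 0"
    then obtain s t where "p = line (vec2 s t)" "s \<noteq> 0 \<or> t \<noteq> 0" unfolding rational_curve_def R by blast
    then show "p \<in> proj_space 1"
      by (auto simp: line_in_proj_space vec2_simps intro: exI[of _ 0] exI[of _ 1])
  qed
qed

section \<open>Rational curves glued along common points\<close>

lemma zirreducible_in_member_of_finite_union:
  assumes "finite I" "zirreducible C" "C \<subseteq> (\<Union>i\<in>I. W i)" "\<And>i. i \<in> I \<Longrightarrow> proj_algebraic (W i)"
  shows "\<exists>i\<in>I. C \<subseteq> W i"
  using assms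
proof (induction I rule: finite_induct)
  case empty
  then show ?case unfolding zirreducible_def by simp
next
  case (insert i I)
  have "zclosed C (C \<inter> W i)" unfolding zclosed_def using insert.prems(3) by auto
  moreover have "zclosed C (C \<inter> (\<Union>i\<in>I. W i))"
    unfolding zclosed_def using proj_algebraic_UN[OF insert.hyps(1)] insert.prems(3) by auto
  moreover have "C = (C \<inter> W i) \<union> (C \<inter> (\<Union>i\<in>I. W i))" using insert.prems(2) by auto
  ultimately have "C = C \<inter> W i \<or> C = C \<inter> (\<Union>i\<in>I. W i)"
    using insert.prems(1) unfolding zirreducible_def by meson
  then show ?case
  proof
    assume "C = C \<inter> (\<Union>i\<in>I. W i)"
    then have "C \<subseteq> (\<Union>i\<in>I. W i)" by blast
    then show ?thesis using insert.IH insert.prems(1,3) by simp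
  qed auto
qed

lemma line_rational_param_scaled:
  assumes "c \<noteq> 0"
  shows "line (rational_param m j P (vec2 (c * s) (c * t))) = line (rational_param m j P (vec2 s t))"
proof -
  have "rational_param m j P (vec2 (c * s) (c * t)) = (\<lambda>i. c ^ m * rational_param m j P (vec2 s t) i)"
    unfolding vec2_scale using form_scale[OF form_rational_param] by blast
  then show ?thesis using assms by (simp add: line_eq_scaled)
qed

lemma poly_rational_param:
  "\<exists>q. \<forall>\<tau>. rational_param m j P (vec2 1 (t + \<tau>)) i = poly q \<tau>"
  "\<exists>q. \<forall>\<tau>. rational_param m j P (vec2 \<tau> t) i = poly q \<tau>"
  using form_poly_vec2[OF form_rational_param[of m j P i]] by blast+

text \<open>\<open>coeff_P\<close> separates the points at infinity, \<open>no_triple_root\<close>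
  bounds the number of branches by two, and \<open>simple_root\<close> makes the branches
  transversal. \<open>coeff_P\<close> only speaks of the presence of a second vertex, so that the
  projective line with \<open>P = 0\<close> is an instance.\<close>

locale glued_rational_curves =
  fixes V :: "'v set" and idx :: "'v \<Rightarrow> nat" and m :: nat and P :: "'v \<Rightarrow> 'k::alg_closed_field poly"
  assumes finite_V: "finite V" and V_nonempty: "V \<noteq> {}"
    and idx: "inj_on idx V" and m_less: "v \<in> V \<Longrightarrow> m < idx v" and m_pos: "0 < m"
    and degree_P: "v \<in> V \<Longrightarrow> degree (P v) \<le> m"
    and coeff_P: "v \<in> V \<Longrightarrow> w \<in> V \<Longrightarrow> v \<noteq> w \<Longrightarrow> coeff (P v) m \<noteq> 0"
    and no_triple_root: "v \<in> V \<Longrightarrow> w \<in> V \<Longrightarrow> u \<in> V \<Longrightarrow> v \<noteq> w \<Longrightarrow> u \<noteq> v \<Longrightarrow> u \<noteq> w \<Longrightarrow>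
      poly (P v) t = 0 \<Longrightarrow> poly (P w) t = 0 \<Longrightarrow> poly (P u) t \<noteq> 0"
    and simple_root: "v \<in> V \<Longrightarrow> w \<in> V \<Longrightarrow> v \<noteq> w \<Longrightarrow> poly (P v) t = 0 \<Longrightarrow> poly (P w) t = 0 \<Longrightarrow>
      \<exists>Q. P v = [:- t, 1:] * Q \<and> poly Q t \<noteq> 0"
begin

abbreviation R :: "'v \<Rightarrow> (nat \<Rightarrow> 'k) \<Rightarrow> nat \<Rightarrow> 'k" where "R v \<equiv> rational_param m (idx v) (P v)"
abbreviation K :: "'v \<Rightarrow> 'k ppoint set" where "K v \<equiv> rational_curve m (idx v) (P v)"
abbreviation a :: "'v \<Rightarrow> 'k \<Rightarrow> 'k ppoint" where "a v \<equiv> affine_point m (idx v) (P v)"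
abbreviation b :: "'v \<Rightarrow> 'k ppoint" where "b v \<equiv> infinite_point m (idx v) (P v)"

definition X :: "'k ppoint set" where "X = (\<Union>v\<in>V. K v)"

definition n :: nat where "n = Max (idx ` V)"

lemma K_subset: "v \<in> V \<Longrightarrow> K v \<subseteq> proj_space n"
proof -
  assume v: "v \<in> V"
  then have "idx v \<le> n" unfolding n_def using finite_V by simp
  then show ?thesis using rational_curve_subset[OF m_less[OF v], of "P v"] proj_space_mono by blast
qed

lemma X_subset: "X \<subseteq> proj_space n" unfolding X_def using K_subset by blast

lemma algebraic_K: "v \<in> V \<Longrightarrow> proj_algebraic (K v)"
  by (intro proj_algebraic_rational_curve m_pos degree_P m_less)

lemma algebraic_X: "proj_algebraic X"
  unfolding X_def by (intro proj_algebraic_UN finite_V algebraic_K)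

lemma curvelike_K: "v \<in> V \<Longrightarrow> curvelike (K v)"
  by (intro curvelike_rational_curve m_pos degree_P m_less)

section \<open>Incidence of points and components\<close>

lemma affine_eq_iff:
  assumes "v \<in> V" "w \<in> V"
  shows "a v t = a w t' \<longleftrightarrow> t = t' \<and> (v = w \<or> poly (P v) t = 0 \<and> poly (P w) t = 0)"
proof
  assume eq: "a v t = a w t'"
  note * = affine_point_eqD[OF m_pos degree_P[OF assms(1)] degree_P[OF assms(2)]
      m_less[OF assms(1)] m_less[OF assms(2)] eq]
  then have "t = t'" by simp
  then show "t = t' \<and> (v = w \<or> poly (P v) t = 0 \<and> poly (P w) t = 0)"
    using *(2) idx assms by (auto dest: inj_onD)
next
  assume "t = t' \<and> (v = w \<or> poly (P v) t = 0 \<and> poly (P w) t = 0)"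
  then show "a v t = a w t'"
    using affine_point_eqI[OF degree_P[OF assms(1)] degree_P[OF assms(2)] m_less[OF assms(1)] m_less[OF assms(2)]]
    by metis
qed

lemma affine_neq_infinite: "v \<in> V \<Longrightarrow> a v t \<noteq> b w"
  by (rule affine_point_neq_infinite_point[OF m_pos degree_P])

lemma infinite_eq_iff:
  assumes "v \<in> V" "w \<in> V" shows "b v = b w \<longleftrightarrow> v = w"
proof
  assume eq: "b v = b w"
  show "v = w"
  proof (rule ccontr)
    assume "v \<noteq> w"
    then have "idx v \<noteq> idx w" using idx assms by (auto dest: inj_onD)
    from infinite_point_eqD(1)[OF m_less[OF assms(1)] m_less[OF assms(2)] this eq]
    show False using coeff_P[OF assms \<open>v \<noteq> w\<close>] by simp
  qed
qed simp

lemma affine_in_K_iff: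
  assumes "v \<in> V" "w \<in> V"
  shows "a v t \<in> K w \<longleftrightarrow> v = w \<or> poly (P v) t = 0 \<and> poly (P w) t = 0"
  unfolding rational_curve_eq using affine_eq_iff[OF assms, of t] affine_neq_infinite[OF assms(1), of t w] by auto

lemma infinite_in_K_iff:
  assumes "v \<in> V" "w \<in> V" shows "b v \<in> K w \<longleftrightarrow> v = w"
  unfolding rational_curve_eq using infinite_eq_iff[OF assms] affine_neq_infinite[OF assms(2), of _ v] by auto

lemma affine_in_X: "v \<in> V \<Longrightarrow> a v t \<in> X" and infinite_in_X: "v \<in> V \<Longrightarrow> b v \<in> X"
  unfolding X_def rational_curve_eq by auto

text \<open>Covers smooth points and nodes alike, with one or two vertices in \<open>I\<close>. The
  components outside \<open>I\<close> and the hyperplane \<open>x 0 = 0\<close>, which contains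
  exactly the points at infinity, are removed; \<tau> is the affine coordinate centred at
  \<open>t\<close>.\<close>

lemma branches_affine:
  assumes I: "I \<subseteq> V" "I \<noteq> {}" and p: "\<And>i. i \<in> I \<Longrightarrow> a i t = p"
    and out: "\<And>w. w \<in> V - I \<Longrightarrow> p \<notin> K w"
  shows "\<exists>W. branches X n p I (\<lambda>i \<tau>. R i (vec2 1 (t + \<tau>))) (\<lambda>x. x 1 - t * x 0) (\<lambda>x. x 0) W"
proof -
  obtain H where H: "proj_algebraic H" "\<And>x. line x \<in> X \<Longrightarrow> line x \<in> H \<longleftrightarrow> x 0 = 0"
    using proj_algebraic_hypersurface[OF form_var[of 0] X_subset] by blast
  let ?W = "(\<Union>w\<in>V - I. K w) \<union> H"
  have R0: "R i (vec2 1 s) 0 = 1" "R i (vec2 1 s) 1 = s" if "i \<in> I" for i s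
    using that I m_pos by (simp_all add: rational_param_def vec2_simps)
  have aH: "a i s \<notin> H" if "i \<in> I" for i s
    using H(2)[of "R i (vec2 1 s)"] affine_in_X[of i s] R0(1)[OF that] that I
    unfolding affine_point_def by auto
  have bH: "b i \<in> H" if "i \<in> I" for i
    using H(2)[of "R i (vec2 0 1)"] infinite_in_X[of i] that I m_pos
    unfolding infinite_point_def by (auto simp: rational_param_infinite)
  have "branches X n p I (\<lambda>i \<tau>. R i (vec2 1 (t + \<tau>))) (\<lambda>x. x 1 - t * x 0) (\<lambda>x. x 0) ?W"
  proof
    show "finite I" using I(1) finite_V by (rule finite_subset)
    show "\<exists>q. \<forall>\<tau>. R i (vec2 1 (t + \<tau>)) j = poly q \<tau>" for i j by (rule poly_rational_param)
    show "line (R i (vec2 1 (t + \<tau>))) \<in> X" if "i \<in> I" for i \<tau>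
      using affine_in_X[of i "t + \<tau>"] that I unfolding affine_point_def by blast
    show "line (R i (vec2 1 (t + 0))) = p" if "i \<in> I" for i
      using p[OF that] unfolding affine_point_def by simp
    show "form 1 (\<lambda>x. x 1 - t * x 0)" by (intro form_diff form_cmult form_var)
    show "R i (vec2 1 (t + \<tau>)) 0 = 1" "R i (vec2 1 (t + \<tau>)) 1 - t * R i (vec2 1 (t + \<tau>)) 0 = \<tau>"
      if "i \<in> I" for i \<tau> using R0[OF that] by simp_all
    show "proj_algebraic ?W"
      using I finite_V algebraic_K by (intro proj_algebraic_Un proj_algebraic_UN H(1)) auto
    show "p \<notin> ?W" using out aH p I(2) by blast
    show "X - ?W \<subseteq> (\<Union>i\<in>I. range (\<lambda>\<tau>. line (R i (vec2 1 (t + \<tau>)))))"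
    proof
      fix q assume q: "q \<in> X - ?W"
      then obtain i where i: "i \<in> I" "q \<in> K i" unfolding X_def by blast
      then obtain s where "q = a i s" using q bH unfolding rational_curve_eq by blast
      then have "q = line (R i (vec2 1 (t + (s - t))))" unfolding affine_point_def by simp
      then show "q \<in> (\<Union>i\<in>I. range (\<lambda>\<tau>. line (R i (vec2 1 (t + \<tau>)))))" using i(1) by blast
    qed
  qed (use X_subset I form_var in auto)
  then show ?thesis by blast
qed

lemma regular_affine:
  assumes v: "v \<in> V" and only: "\<And>w. w \<in> V \<Longrightarrow> w \<noteq> v \<Longrightarrow> \<not> (poly (P v) t = 0 \<and> poly (P w) t = 0)"
  shows "regular_point X (a v t)"
proof -
  have "a v t \<notin> K w" if "w \<in> V - {v}" for w
    using only[of w] that affine_in_K_iff[OF v, of w t] by auto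
  then obtain W where "branches X n (a v t) {v} (\<lambda>i \<tau>. R i (vec2 1 (t + \<tau>))) (\<lambda>x. x 1 - t * x 0) (\<lambda>x. x 0) W"
    using branches_affine[of "{v}" t "a v t"] v by auto
  then interpret branches X n "a v t" "{v}" "\<lambda>i \<tau>. R i (vec2 1 (t + \<tau>))" "\<lambda>x. x 1 - t * x 0" "\<lambda>x. x 0" W .
  show ?thesis by (rule regular_point_if_one_branch) simp
qed

text \<open>The chart \<open>x 0 = 1\<close> misses this point, so the local coordinate is
  \<open>x (m - 1) / x m\<close>, which equals \<open>s / t\<close> on the curve.\<close>

lemma regular_infinite:
  assumes v: "v \<in> V" shows "regular_point X (b v)"
proof -
  obtain H where H: "proj_algebraic H" "\<And>x. line x \<in> X \<Longrightarrow> line x \<in> H \<longleftrightarrow> x m = 0"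
    using proj_algebraic_hypersurface[OF form_var[of m] X_subset] by blast
  let ?W = "(\<Union>w\<in>V - {v}. K w) \<union> H"
  have Rm: "R v (vec2 s t) m = t ^ m" "R v (vec2 s 1) (m - 1) = s" for s t
    using m_pos by (simp_all add: rational_param_def vec2_simps)
  have inK: "line (R v (vec2 s t)) \<in> X" if "s \<noteq> 0 \<or> t \<noteq> 0" for s t
    unfolding X_def rational_curve_def using v that by blast
  interpret branches X n "b v" "{v}" "\<lambda>i \<tau>. R i (vec2 \<tau> 1)" "\<lambda>x. x (m - 1)" "\<lambda>x. x m" ?W
  proof
    show "\<exists>q. \<forall>\<tau>. R i (vec2 \<tau> 1) j = poly q \<tau>" for i j by (rule poly_rational_param)
    show "proj_algebraic ?W"
      using finite_V algebraic_K by (intro proj_algebraic_Un proj_algebraic_UN H(1)) auto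
    have "b v \<notin> H" using H(2)[of "R v (vec2 0 1)"] inK[of 0 1] Rm(1)[of 0 1]
      unfolding infinite_point_def by simp
    then show "b v \<notin> ?W" using infinite_in_K_iff[OF v] by blast
    show "X - ?W \<subseteq> (\<Union>i\<in>{v}. range (\<lambda>\<tau>. line (R i (vec2 \<tau> 1))))"
    proof
      fix q assume q: "q \<in> X - ?W"
      then have "q \<in> K v" unfolding X_def by blast
      then obtain s t where st: "q = line (R v (vec2 s t))" unfolding rational_curve_def by blast
      have "t \<noteq> 0" using H(2)[of "R v (vec2 s t)"] q Rm(1)[of s t] st m_pos by auto
      then have "q = line (R v (vec2 (s / t) 1))"
        using line_rational_param_scaled[of t m "idx v" "P v" "s / t" 1] st by simp
      then show "q \<in> (\<Union>i\<in>{v}. range (\<lambda>\<tau>. line (R i (vec2 \<tau> 1))))" by blast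
    qed
  qed (use X_subset form_var inK Rm in \<open>auto simp: infinite_point_def\<close>)
  show ?thesis by (rule regular_point_if_one_branch) simp
qed

text \<open>The two private coordinates provide \<open>Y1\<close> and \<open>Y2\<close>; a simple
  root of \<open>P\<close> is exactly what makes the own coordinate a uniformizer.\<close>

lemma node_affine:
  assumes v: "v \<in> V" and w: "w \<in> V" "w \<noteq> v" and z: "poly (P v) t = 0" "poly (P w) t = 0"
  shows "node X (a v t)"
proof -
  have awv: "a w t = a v t" using affine_eq_iff[OF w(1) v] z by simp
  have "a v t \<notin> K u" if "u \<in> V - {v, w}" for u
    using that affine_in_K_iff[OF v, of u t] no_triple_root[OF v w(1), of u t] w z by auto
  then have "\<exists>W. branches X n (a v t) {v, w} (\<lambda>i \<tau>. R i (vec2 1 (t + \<tau>))) (\<lambda>x. x 1 - t * x 0) (\<lambda>x. x 0) W"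
    using v w(1) awv by (intro branches_affine) auto
  then obtain W where W: "branches X n (a v t) {v, w} (\<lambda>i \<tau>. R i (vec2 1 (t + \<tau>))) (\<lambda>x. x 1 - t * x 0) (\<lambda>x. x 0) W"
    by (rule exE)
  obtain Q1 where Q1: "P v = [:- t, 1:] * Q1" "poly Q1 t \<noteq> 0"
    using simple_root[OF v w(1) w(2)[symmetric] z] by blast
  obtain Q2 where Q2: "P w = [:- t, 1:] * Q2" "poly Q2 t \<noteq> 0"
    using simple_root[OF w(1) v w(2) z(2,1)] by blast
  have "idx v \<noteq> idx w" using idx v w by (auto dest: inj_onD)
  \<comment> \<open>Composition with \<open>[:t, 1:]\<close> moves the root to \<tau> = 0: the
    linear factor of \<open>P\<close> becomes \<tau> and the cofactor stays nonzero there.\<close>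
  then have Y: "R v (vec2 1 (t + \<tau>)) (idx v) = \<tau> * poly (pcompose Q1 [:t, 1:]) \<tau>" "R w (vec2 1 (t + \<tau>)) (idx v) = 0"
    "R v (vec2 1 (t + \<tau>)) (idx w) = 0" "R w (vec2 1 (t + \<tau>)) (idx w) = \<tau> * poly (pcompose Q2 [:t, 1:]) \<tau>" for \<tau>
    using m_less[OF v] m_less[OF w(1)] degree_P[OF v] degree_P[OF w(1)]
    by (simp_all add: rational_param_affine) (simp_all add: Q1(1) Q2(1) poly_pcompose algebra_simps)
  interpret two_branches X n "a v t" v w "\<lambda>i \<tau>. R i (vec2 1 (t + \<tau>))" "\<lambda>x. x 1 - t * x 0" "\<lambda>x. x 0" W
    "\<lambda>x. x (idx v)" "\<lambda>x. x (idx w)" "pcompose Q1 [:t, 1:]" "pcompose Q2 [:t, 1:]"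
    by (rule two_branches.intro[OF W], rule two_branches_axioms.intro)
       (simp_all add: Y Q1(2) Q2(2) form_var poly_pcompose del: One_nat_def)
  show ?thesis by (rule node_p)
qed

lemma node_affine_iff:
  assumes v: "v \<in> V"
  shows "node X (a v t) \<longleftrightarrow> (\<exists>w\<in>V. w \<noteq> v \<and> poly (P v) t = 0 \<and> poly (P w) t = 0)"
  using node_affine[OF v] regular_point_not_node[OF regular_affine[OF v]] by blast

lemma not_node_infinite: "v \<in> V \<Longrightarrow> \<not> node X (b v)"
  by (rule regular_point_not_node[OF regular_infinite])

text \<open>The point at infinity of a component lies on no other component.\<close>

lemma K_subset_K_iff:
  assumes "v \<in> V" "w \<in> V" shows "K v \<subseteq> K w \<longleftrightarrow> v = w"
proof
  assume "K v \<subseteq> K w"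
  moreover have "b v \<in> K v" by (simp add: rational_curve_eq)
  ultimately show "v = w" using infinite_in_K_iff[OF assms] by blast
qed simp

lemma inj_on_K: "inj_on K V"
  by (rule inj_onI) (use K_subset_K_iff in auto)

lemma components_X: "components X = K ` V"
proof (intro set_eqI iffI)
  have sub: "\<exists>v\<in>V. D \<subseteq> K v" if "D \<subseteq> X" "zirreducible D" for D
    using zirreducible_in_member_of_finite_union[OF finite_V that(2)] that(1) algebraic_K unfolding X_def by blast
  have irr: "zirreducible (K v)" "K v \<subseteq> X" if "v \<in> V" for v
    using that curvelike_irreducible[OF curvelike_K] unfolding X_def by auto
  fix C
  {
    assume "C \<in> components X"
    then have C: "C \<subseteq> X" "zirreducible C" "\<forall>D. C \<subseteq> D \<and> D \<subseteq> X \<and> zirreducible D \<longrightarrow> D = C"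
      unfolding components_def by auto
    obtain v where v: "v \<in> V" "C \<subseteq> K v" using sub[OF C(1,2)] by blast
    then have "K v = C" using C(3) irr[OF v(1)] by simp
    then show "C \<in> K ` V" using v(1) by blast
  }
  assume "C \<in> K ` V"
  then obtain v where v: "v \<in> V" "C = K v" by blast
  have "D = C" if D: "C \<subseteq> D" "D \<subseteq> X" "zirreducible D" for D
  proof -
    obtain w where w: "w \<in> V" "D \<subseteq> K w" using sub[OF D(2,3)] by blast
    then have "v = w" using D(1) v K_subset_K_iff[OF v(1) w(1)] by blast
    then show ?thesis using w D(1) v(2) by blast
  qed
  then show "C \<in> components X" unfolding components_def using irr[OF v(1)] v(2) by simp
qed

lemma X_cases:
  assumes "q \<in> X" obtains v t where "v \<in> V" "q = a v t" | v where "v \<in> V" "q = b v"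
  using assms unfolding X_def rational_curve_eq by blast

lemma regular_or_node: "q \<in> X \<Longrightarrow> regular_point X q \<or> node X q"
  by (erule X_cases) (use regular_affine node_affine regular_infinite in blast)+

lemma curve_X: "curve X"
  unfolding curve_def
proof (intro conjI ballI)
  show "X \<noteq> {}" using V_nonempty infinite_in_X by blast
  show "has_dimension C 1" if "C \<in> components X" for C
    using that curvelike_has_dimension[OF curvelike_K] unfolding components_X by blast
qed (simp_all add: algebraic_X regular_or_node)

end

section \<open>The projective line\<close>

lemma sum_apply: "(\<Sum>i\<in>I. f i) x = (\<Sum>i\<in>I. f i x)"
  by (induction I rule: infinite_finite_induct) auto

text \<open>With a single vertex nothing is glued, so every point of the glued curve is
  regular.\<close>

lemma nonsingular_curve_proj_line: "nonsingular_curve (proj_space 1 :: 'k::alg_closed_field ppoint set)"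
proof -
  interpret glued_rational_curves "{()}" "\<lambda>_. 2" 1 "\<lambda>_. 0 :: 'k poly"
    by unfold_locales auto
  have X: "X = proj_space 1" unfolding X_def proj_line_eq by simp
  have "regular_point X q" if "q \<in> X" for q
    using that by (rule X_cases) (use regular_affine regular_infinite in \<open>simp_all only: singleton_iff\<close>)
  have KX: "K () = proj_space 1" by (simp only: proj_line_eq)
  have c: "curvelike (proj_space 1 :: 'k ppoint set)" using curvelike_K[of "()"] unfolding KX by simp
  show ?thesis unfolding nonsingular_curve_def
    using \<open>\<And>q. q \<in> X \<Longrightarrow> regular_point X q\<close> proj_algebraic_proj_space
      curvelike_irreducible[OF c] curvelike_has_dimension[OF c] unfolding X by blast
qed

lemma proj_line_cases:
  assumes "q \<in> proj_space 1"
  obtains t where "q = line (vec2 1 t)" | "q = line (vec2 0 1)"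
proof -
  obtain x where x: "q = line x" "\<exists>i. x i \<noteq> 0" "\<forall>i>1. x i = 0" using assms by (rule proj_spaceE)
  define s t where "s = x 0" and "t = x 1"
  have e: "x = vec2 s t" unfolding s_def t_def using x(3) by (rule vec2_eta)
  show ?thesis
  proof (cases "s = 0")
    case True
    then have "t \<noteq> 0" using x(2) unfolding e by (auto simp: vec2_def split: if_splits)
    moreover have "vec2 s t = (\<lambda>i. t * vec2 0 1 i)" using vec2_scale[of t 0 1] True by simp
    ultimately show ?thesis using that(2) x(1) e by (simp add: line_eq_scaled)
  next
    case False
    moreover have "vec2 s t = (\<lambda>i. s * vec2 1 (t / s) i)" using vec2_scale[of s 1 "t / s"] False by simp
    ultimately show ?thesis using that(1)[of "t / s"] x(1) e by (simp add: line_eq_scaled)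
  qed
qed

lemma line_vec2_eq_iff:
  "line (vec2 1 s) = line (vec2 1 t) \<longleftrightarrow> s = t" "line (vec2 1 s) \<noteq> line (vec2 0 1)"
proof -
  show "line (vec2 1 s) = line (vec2 1 t) \<longleftrightarrow> s = t"
  proof
    assume "line (vec2 1 s) = line (vec2 1 t)"
    then obtain c where "vec2 1 s = (\<lambda>i. c * vec2 1 t i)" by (rule line_eqE)
    from fun_cong[OF this, of 0] fun_cong[OF this, of 1] show "s = t" by (simp add: vec2_simps)
  qed simp
  show "line (vec2 1 s) \<noteq> line (vec2 0 1)"
  proof
    assume "line (vec2 1 s) = line (vec2 0 1)"
    then obtain c where "vec2 1 s = (\<lambda>i. c * vec2 0 1 i)" by (rule line_eqE)
    from fun_cong[OF this, of 0] show False by (simp add: vec2_simps)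
  qed
qed

lemma line_vec2_in_proj_line: "line (vec2 1 t) \<in> proj_space 1" "line (vec2 0 1) \<in> proj_space 1"
  by (auto simp: line_in_proj_space vec2_simps intro: exI[of _ 0] exI[of _ 1])

section \<open>Hilbert function and genus of the projective line\<close>

lemma vector_space_functions: "vector_space (\<lambda>(c::'k::field) (F :: 'a \<Rightarrow> 'k) x. c * F x)"
  by unfold_locales (auto simp: fun_eq_iff algebra_simps)

lemma monomial_on_proj_line:
  fixes x :: "nat \<Rightarrow> 'k::field"
  assumes N: "1 \<le> N" and d: "(\<Sum>j\<le>N. e j) = d"
  shows "(\<exists>j\<in>{2..N}. e j \<noteq> 0) \<Longrightarrow> (\<forall>i>1. x i = 0) \<Longrightarrow> (\<Prod>j\<le>N. x j ^ e j) = 0"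
    "\<not> (\<exists>j\<in>{2..N}. e j \<noteq> 0) \<Longrightarrow> e 1 \<le> d \<and> (\<Prod>j\<le>N. x j ^ e j) = x 0 ^ (d - e 1) * x 1 ^ e 1"
proof -
  have I: "{..N} = insert 0 (insert 1 {2..N})" using N by auto
  show "(\<Prod>j\<le>N. x j ^ e j) = 0" if j: "\<exists>j\<in>{2..N}. e j \<noteq> 0" and x: "\<forall>i>1. x i = 0"
  proof -
    obtain j where "j \<in> {2..N}" "e j \<noteq> 0" using j by blast
    then show ?thesis using x by (intro prod_zero) (auto intro!: bexI[of _ j])
  qed
  assume *: "\<not> (\<exists>j\<in>{2..N}. e j \<noteq> 0)"
  then have "(\<Sum>j\<in>{2..N}. e j) = 0" by simp
  then have "d = e 0 + e 1" using d unfolding I by simp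
  moreover have "(\<Prod>j\<in>{2..N}. x j ^ e j) = 1" using * by (intro prod.neutral) auto
  ultimately show "e 1 \<le> d \<and> (\<Prod>j\<le>N. x j ^ e j) = x 0 ^ (d - e 1) * x 1 ^ e 1"
    unfolding I by simp
qed

text \<open>The monomials of degree \<open>d\<close> in \<open>x 0\<close> and \<open>x 1\<close>,
  cut off outside the cone, are a basis.\<close>

lemma hilbert_function_proj_line:
  "hilbert_function (proj_space 1 :: 'k::alg_closed_field ppoint set) d = d + 1"
proof -
  let ?X = "proj_space 1 :: 'k ppoint set"
  interpret vector_space "\<lambda>(c::'k) (F :: (nat \<Rightarrow> 'k) \<Rightarrow> 'k) x. c * F x"
    by (rule vector_space_functions)
  define S where "S = {(\<lambda>x. if line x \<in> ?X then F x else 0) | F. form d F}"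
  define e where "e i = (\<lambda>x :: nat \<Rightarrow> 'k. if line x \<in> ?X then x 0 ^ (d - i) * x 1 ^ i else 0)" for i
  have e1: "e i (vec2 1 t) = t ^ i" for i t
    using line_vec2_in_proj_line(1)[of t] by (simp add: e_def vec2_simps)
  have inj: "inj_on e {..d}"
  proof (rule inj_onI)
    fix i j assume "e i = e j"
    then have "t ^ i = t ^ j" for t :: 'k using e1 by metis
    then have "monom (1 :: 'k) i = monom 1 j"
      by (intro poly_eq_if_near0) (simp add: poly_monom)
    then show "i = j" by (metis degree_monom_eq one_neq_zero)
  qed
  have "e i \<in> S" if "i \<le> d" for i
  proof -
    have "form ((d - i) * 1 + i * 1) (\<lambda>x :: nat \<Rightarrow> 'k. x 0 ^ (d - i) * x 1 ^ i)"
      by (intro form_mult form_power form_var)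
    then have "form d (\<lambda>x :: nat \<Rightarrow> 'k. x 0 ^ (d - i) * x 1 ^ i)" using that by simp
    then show ?thesis unfolding S_def e_def
      by (intro CollectI exI[of _ "\<lambda>x :: nat \<Rightarrow> 'k. x 0 ^ (d - i) * x 1 ^ i"]) simp
  qed
  then have BS: "e ` {..d} \<subseteq> S" by blast
  have SB: "S \<subseteq> span (e ` {..d})"
  proof
    fix f assume "f \<in> S"
    then obtain F where F: "form d F" and f: "f = (\<lambda>x. if line x \<in> ?X then F x else 0)"
      unfolding S_def by blast
    obtain N0 where "\<forall>N\<ge>N0. form_upto N d F" using form_imp_form_upto[OF F] by blast
    \<comment> \<open>At least the variables \<open>x 0\<close> and \<open>x 1\<close> are kept in
      the range. Monomials that contain a further variable vanish on the line.\<close>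
    then have "form_upto (max N0 1) d F" by simp
    then obtain N where N: "1 \<le> N" "form_upto N d F" by (meson max.cobounded2)
    then obtain A ex c where A: "finite (A :: (nat \<Rightarrow> nat) set)" "\<forall>a\<in>A. (\<Sum>j\<le>N. ex a j) = d"
      "F = (\<lambda>x. \<Sum>a\<in>A. c a * (\<Prod>j\<le>N. x j ^ (ex a j :: nat)))"
      unfolding form_upto_def by blast
    define g where "g a = (\<lambda>x :: nat \<Rightarrow> 'k. if line x \<in> ?X then \<Prod>j\<le>N. x j ^ ex a j else 0)" for a
    have "g a \<in> span (e ` {..d})" if a: "a \<in> A" for a
    proof (cases "\<exists>j\<in>{2..N}. ex a j \<noteq> 0")
      case True
      have "g a = 0"
        unfolding g_def using monomial_on_proj_line(1)[OF N(1) _ True] A(2) a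
        by (auto simp: fun_eq_iff line_in_proj_space)
      then show ?thesis by (simp add: span_zero)
    next
      case False
      have "ex a 1 \<le> d" "g a = e (ex a 1)"
        unfolding g_def e_def using monomial_on_proj_line(2)[OF N(1) _ False] A(2) a by (auto simp: fun_eq_iff)
      then show ?thesis by (auto intro: span_base)
    qed
    then have "(\<Sum>a\<in>A. (\<lambda>x. c a * g a x)) \<in> span (e ` {..d})"
      by (intro span_sum span_scale)
    moreover have "f = (\<Sum>a\<in>A. (\<lambda>x. c a * g a x))"
      unfolding f A(3) g_def by (auto simp: fun_eq_iff sum_apply)
    ultimately show "f \<in> span (e ` {..d})" by simp
  qed
  have ind: "independent (e ` {..d})"
  proof
    assume "dependent (e ` {..d})"
    then have "\<exists>u. (\<exists>v\<in>e ` {..d}. u v \<noteq> 0) \<and> (\<Sum>v\<in>e ` {..d}. (\<lambda>x. u v * v x)) = 0"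
      by (subst (asm) dependent_finite) simp_all
    then obtain u where u: "\<exists>v\<in>e ` {..d}. u v \<noteq> 0" "(\<Sum>v\<in>e ` {..d}. (\<lambda>x. u v * v x)) = 0"
      by (elim exE conjE)
    \<comment> \<open>Evaluation at the vectors \<open>vec2 1 t\<close> turns a linear relation
      between the monomials into a polynomial in \<open>t\<close> that vanishes everywhere.\<close>
    define q where "q = (\<Sum>i\<le>d. monom (u (e i)) i)"
    have "poly q t = 0" for t
    proof -
      have "(\<Sum>i\<le>d. (\<lambda>x. u (e i) * e i x)) = 0" using u(2) by (simp add: sum.reindex[OF inj])
      from fun_cong[OF this, of "vec2 1 t"] show ?thesis
        by (simp add: q_def poly_sum poly_monom sum_apply e1)
    qed
    then have "q = 0" by (intro poly_eq_if_near0) simp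
    moreover have "coeff q i = u (e i)" if "i \<le> d" for i
      using that by (simp add: q_def coeff_sum)
    ultimately have "u (e i) = 0" if "i \<le> d" for i using that by (metis coeff_0)
    then show False using u(1) by auto
  qed
  have "dim S = card (e ` {..d})" by (rule dim_unique[OF BS SB ind refl])
  also have "\<dots> = d + 1" by (simp add: card_image[OF inj])
  finally show ?thesis unfolding hilbert_function_def S_def .
qed

lemma has_genus_proj_line: "has_genus (proj_space 1 :: 'k::alg_closed_field ppoint set) 0"
  unfolding has_genus_def hilbert_function_proj_line by (intro exI[of _ 1]) simp

section \<open>Parametrizations as normalizations of the components\<close>

context glued_rational_curves
begin

abbreviation \<nu> :: "'v \<Rightarrow> 'k ppoint \<Rightarrow> 'k ppoint" where "\<nu> v \<equiv> pmap (R v)"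

lemma \<nu>_eq: "\<nu> v (line (vec2 1 t)) = a v t" "\<nu> v (line (vec2 0 1)) = b v"
  by (simp_all add: pmap_line[OF form_rational_param] affine_point_def infinite_point_def)

lemma \<nu>_in_K: "q \<in> proj_space 1 \<Longrightarrow> \<nu> v q \<in> K v"
  by (erule proj_line_cases) (simp_all add: \<nu>_eq rational_curve_eq)

text \<open>Birationality only asks for an isomorphism over a nonempty open set. Over the affine
  part \<open>U\<close> the inverse is the projection to the coordinates 0 and 1, which for
  \<open>m > 1\<close> both vanish at the point at infinity.\<close>

lemma normalization_\<nu>:
  assumes v: "v \<in> V" shows "normalization (K v) (proj_space 1) (\<nu> v)"
proof -
  let ?L = "proj_space 1 :: 'k ppoint set"
  obtain H where H: "proj_algebraic H" "\<And>x. line x \<in> K v \<Longrightarrow> line x \<in> H \<longleftrightarrow> x 0 = 0"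
    using proj_algebraic_hypersurface[OF form_var[of 0] K_subset[OF v]] by blast
  have aK: "a v t \<in> K v" "b v \<in> K v" for t by (simp_all add: rational_curve_eq)
  have aH: "a v t \<notin> H" for t
    using H(2) aK(1)[of t] unfolding affine_point_def by (simp add: rational_param_def vec2_simps)
  have bH: "b v \<in> H"
    using H(2) aK(2) m_pos unfolding infinite_point_def by (simp add: rational_param_infinite)
  define U where "U = K v - H"
  define D where "D = {q \<in> ?L. \<nu> v q \<in> U}"
  have U: "U = range (a v)" unfolding U_def using aH bH by (auto simp: rational_curve_eq)
  have D: "D = range (\<lambda>t. line (vec2 1 t))"
  proof (intro set_eqI iffI)
    fix q :: "'k ppoint" assume "q \<in> D"
    then have q: "q \<in> ?L" "\<nu> v q \<in> U" unfolding D_def by auto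
    from q(1) show "q \<in> range (\<lambda>t. line (vec2 1 t))"
    proof (rule proj_line_cases)
      assume "q = line (vec2 0 1)"
      then show ?thesis using q(2) affine_neq_infinite[OF v] unfolding U by (auto simp: \<nu>_eq)
    qed simp
  next
    fix q :: "'k ppoint" assume "q \<in> range (\<lambda>t. line (vec2 1 t))"
    then show "q \<in> D" unfolding D_def U using line_vec2_in_proj_line(1) by (auto simp: \<nu>_eq)
  qed
  have bij: "bij_betw (\<nu> v) D U"
    unfolding bij_betw_def
  proof
    show "inj_on (\<nu> v) D" unfolding D using affine_eq_iff[OF v v] by (auto simp: inj_on_def \<nu>_eq)
    show "\<nu> v ` D = U" unfolding D U by (auto simp: \<nu>_eq image_image)
  qed
  have mor: "morphism D' E (\<nu> v)" if "D' \<subseteq> ?L" "E \<subseteq> K v" "\<And>q. q \<in> D' \<Longrightarrow> \<nu> v q \<in> E" for D' E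
  proof (rule morphism_pmap[OF form_rational_param that(1)])
    show "E \<subseteq> proj_space n" using that(2) K_subset[OF v] by blast
    show "line (R v x) \<in> E" if "line x \<in> D'" for x
      using that \<open>\<And>q. q \<in> D' \<Longrightarrow> \<nu> v q \<in> E\<close>[of "line x"] by (simp add: pmap_line[OF form_rational_param])
  qed
  let ?\<Psi> = "\<lambda>x :: nat \<Rightarrow> 'k. vec2 (x 0) (x 1)"
  have form_\<Psi>: "form 1 (\<lambda>x. ?\<Psi> x i)" for i
    by (cases "i = 0"; cases "i = 1") (simp_all add: vec2_def form_var[unfolded One_nat_def] form_zero)
  have \<Psi>a: "pmap ?\<Psi> (a v t) = line (vec2 1 t)" for t
  proof -
    have "R v (vec2 1 t) 0 = 1" "R v (vec2 1 t) 1 = t"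
      using m_pos by (simp_all add: rational_param_def vec2_simps)
    then show ?thesis unfolding affine_point_def pmap_line[OF form_\<Psi>] by simp
  qed
  have "morphism U D (pmap ?\<Psi>)"
  proof (rule morphism_pmap[OF form_\<Psi>])
    show "U \<subseteq> proj_space n" unfolding U_def using K_subset[OF v] by blast
    show "D \<subseteq> proj_space 1" unfolding D_def by blast
    show "line (?\<Psi> x) \<in> D" if x: "line x \<in> U" for x
    proof -
      obtain t where "line x = a v t" using x U by blast
      moreover have "pmap ?\<Psi> (line x) = line (?\<Psi> x)" by (rule pmap_line[OF form_\<Psi>])
      ultimately have "line (?\<Psi> x) = line (vec2 1 t)" using \<Psi>a[of t] by metis
      then show ?thesis unfolding D by blast
    qed
  qed
  moreover have "pmap ?\<Psi> q = inv_into D (\<nu> v) q" if "q \<in> U" for q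
  proof -
    obtain t where t: "q = a v t" using \<open>q \<in> U\<close> U by blast
    have "inv_into D (\<nu> v) (\<nu> v (line (vec2 1 t))) = line (vec2 1 t)"
      by (rule inv_into_f_f) (use bij D in \<open>auto simp: bij_betw_def\<close>)
    then show ?thesis unfolding t \<Psi>a \<nu>_eq by simp
  qed
  ultimately have "morphism U D (inv_into D (\<nu> v))" by (rule morphism_cong)
  moreover have "morphism D U (\<nu> v)" by (rule mor) (auto simp: D_def U_def)
  ultimately have "isomorphism D U (\<nu> v)" unfolding isomorphism_def using bij by blast
  moreover have "zopen (K v) U" unfolding zopen_def U_def using H(1) by blast
  moreover have "U \<noteq> {}" unfolding U by blast
  moreover have "morphism ?L (K v) (\<nu> v)" by (rule mor) (auto intro: \<nu>_in_K)
  ultimately show ?thesis unfolding normalization_def D_def using nonsingular_curve_proj_line by blast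
qed

lemma node_\<nu>_iff:
  assumes v: "v \<in> V" and q: "q \<in> proj_space 1"
  shows "node X (\<nu> v q) \<longleftrightarrow>
    (\<exists>t. q = line (vec2 1 t) \<and> (\<exists>w\<in>V. w \<noteq> v \<and> poly (P v) t = 0 \<and> poly (P w) t = 0))"
  using q
proof (rule proj_line_cases)
  fix t assume "q = line (vec2 1 t)"
  then show ?thesis using node_affine_iff[OF v] by (auto simp: \<nu>_eq line_vec2_eq_iff)
next
  assume q: "q = line (vec2 0 1)"
  then show ?thesis using not_node_infinite[OF v] line_vec2_eq_iff(2) by (metis \<nu>_eq(2))
qed

end

section \<open>Curves with a given dual graph\<close>

lemma exists_inj_on_finite:
  assumes "finite S" "infinite (UNIV :: 'b set)" shows "\<exists>f :: 'a \<Rightarrow> 'b. inj_on f S"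
proof -
  obtain T :: "'b set" where "finite T" "card T = card S"
    using infinite_arbitrarily_large[OF assms(2)] by blast
  then obtain f where "bij_betw f S T" using finite_same_card_bij[OF assms(1)] by metis
  then show ?thesis unfolding bij_betw_def by blast
qed

text \<open>
  The edge of a half-edge \<open>h\<close> is glued at the parameter \<open>t h\<close>. The root \<open>r v\<close> only serves to
  give all polynomials the same degree.
\<close>

lemma vertex_polynomials_exist:
  fixes G :: "('v, 'h) wgraph"
  assumes G: "finite_graph G" and loopless: "loopless G"
  obtains t :: "'h \<Rightarrow> 'k::alg_closed_field" and P :: "'v \<Rightarrow> 'k poly" and m :: nat
  where "0 < m" "\<forall>v\<in>verts G. degree (P v) = m"
    "\<forall>h\<in>halves G. \<forall>h'\<in>halves G. t h = t h' \<longleftrightarrow> h' = h \<or> h' = opp G h"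
    "\<forall>v\<in>verts G. \<forall>w\<in>verts G. v \<noteq> w \<longrightarrow>
      (\<forall>x. poly (P v) x = 0 \<and> poly (P w) x = 0 \<longleftrightarrow> (\<exists>h\<in>half_edges G v w. x = t h))"
    "\<forall>h\<in>halves G. \<exists>Q. P (base G h) = [:- t h, 1:] * Q \<and> poly Q (t h) \<noteq> 0"
proof -
  let ?V = "verts G" and ?H = "halves G"
  have fin: "finite ?V" "finite ?H" using G unfolding finite_graph_def by auto
  have opp: "opp G h \<in> ?H" "opp G (opp G h) = h" "base G h \<in> ?V" if "h \<in> ?H" for h
    using G that unfolding finite_graph_def by auto
  \<comment> \<open>Edges enter as the sets of their two halves, so both halves receive the same
    parameter; the disjoint sum keeps the filler roots of the vertices away from all edge
    parameters.\<close>
  define S :: "('h set + 'v) set" where "S = (\<lambda>h. Inl {h, opp G h}) ` ?H \<union> Inr ` ?V"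
  have "finite S" unfolding S_def using fin by simp
  then obtain f :: "'h set + 'v \<Rightarrow> 'k" where f: "inj_on f S"
    using exists_inj_on_finite[OF _ infinite_UNIV_alg_closed] by blast
  define t where "t h = f (Inl {h, opp G h})" for h
  define r where "r v = f (Inr v)" for v
  have t_eq: "t h = t h' \<longleftrightarrow> h' = h \<or> h' = opp G h" if "h \<in> ?H" "h' \<in> ?H" for h h'
  proof -
    have "t h = t h' \<longleftrightarrow> {h, opp G h} = {h', opp G h'}"
      unfolding t_def using inj_on_eq_iff[OF f] that by (auto simp: S_def)
    then show ?thesis using opp(2)[OF that(1)] opp(2)[OF that(2)] by (auto simp: doubleton_eq_iff)
  qed
  have r_eq: "r v = r w \<longleftrightarrow> v = w" if "v \<in> ?V" "w \<in> ?V" for v w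
    unfolding r_def using inj_on_eq_iff[OF f, of "Inr v" "Inr w"] that by (auto simp: S_def)
  have r_neq_t: "r v \<noteq> t h" if "v \<in> ?V" "h \<in> ?H" for v h
    unfolding r_def t_def using inj_on_eq_iff[OF f, of "Inr v" "Inl {h, opp G h}"] that by (auto simp: S_def)
  define E where "E v = t ` {h \<in> ?H. base G h = v}" for v
  \<comment> \<open>The extra one makes \<open>m\<close> positive even without edges and larger than
    the number of edges at any vertex, so every filler root occurs with positive multiplicity. It is
    a root of one polynomial only, so the multiplicity does no harm.\<close>
  define m where "m = card ?H + 1"
  define P where "P v = (\<Prod>x\<in>E v. [:- x, 1:]) * [:- r v, 1:] ^ (m - card (E v))" for v
  have E: "finite (E v)" "card (E v) < m" for v
  proof -
    show "finite (E v)" unfolding E_def using fin by simp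
    have "card (E v) \<le> card {h \<in> ?H. base G h = v}" unfolding E_def using fin by (intro card_image_le) simp
    also have "\<dots> \<le> card ?H" using fin by (intro card_mono) auto
    finally show "card (E v) < m" unfolding m_def by simp
  qed
  have deg: "degree (P v) = m" for v
  proof -
    have "degree (\<Prod>x\<in>E v. [:- x, 1:]) = card (E v)" by (subst degree_prod_eq_sum_degree) auto
    moreover have "(\<Prod>x\<in>E v. [:- x, 1:]) \<noteq> 0" using E(1) by simp
    moreover have "degree ([:- r v, 1:] ^ (m - card (E v))) = m - card (E v)" by (simp add: degree_power_eq)
    ultimately show ?thesis unfolding P_def using E(2)[of v] by (subst degree_mult_eq) auto
  qed
  have root: "poly (P v) x = 0 \<longleftrightarrow> x \<in> E v \<or> x = r v" for v x
    unfolding P_def using E[of v] by (auto simp: poly_prod prod_zero_iff)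
  show ?thesis
  proof (rule that[of m P t]; (intro ballI allI impI)?)
    show "0 < m" unfolding m_def by simp
    show "degree (P v) = m" for v by (rule deg)
    show "t h = t h' \<longleftrightarrow> h' = h \<or> h' = opp G h" if "h \<in> ?H" "h' \<in> ?H" for h h' by (rule t_eq[OF that])
  next
    fix v w x assume vw: "v \<in> ?V" "w \<in> ?V" "v \<noteq> w"
    show "poly (P v) x = 0 \<and> poly (P w) x = 0 \<longleftrightarrow> (\<exists>h\<in>half_edges G v w. x = t h)"
    proof
      assume "poly (P v) x = 0 \<and> poly (P w) x = 0"
      moreover have "r v \<notin> E w" "r w \<notin> E v"
        using r_neq_t[OF vw(1)] r_neq_t[OF vw(2)] unfolding E_def by auto
      ultimately have "x \<in> E v" "x \<in> E w"
        using r_eq[OF vw(1,2)] vw(3) unfolding root by auto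
      then obtain h h' where h: "h \<in> ?H" "base G h = v" "x = t h" and h': "h' \<in> ?H" "base G h' = w" "x = t h'"
        unfolding E_def by auto
      \<comment> \<open>Equal parameters leave \<open>h\<close> and its opposite; the former is
        excluded because \<open>v\<close> and \<open>w\<close> differ.\<close>
      then have "h' = opp G h" using t_eq[OF h(1) h'(1)] vw(3) by auto
      then show "\<exists>h\<in>half_edges G v w. x = t h" using h h' unfolding half_edges_def by auto
    next
      assume "\<exists>h\<in>half_edges G v w. x = t h"
      then obtain h where h: "h \<in> ?H" "base G h = v" "base G (opp G h) = w" "x = t h"
        unfolding half_edges_def by auto
      then have "x = t (opp G h)" using t_eq[OF h(1) opp(1)[OF h(1)]] by simp
      then have "x \<in> E w" unfolding E_def using h(3) opp(1)[OF h(1)] by blast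
      moreover have "x \<in> E v" unfolding E_def using h(1,2,4) by blast
      ultimately show "poly (P v) x = 0 \<and> poly (P w) x = 0" unfolding root by blast
    qed
  next
    fix h assume h: "h \<in> ?H"
    let ?v = "base G h"
    define Q where "Q = (\<Prod>x\<in>E ?v - {t h}. [:- x, 1:]) * [:- r ?v, 1:] ^ (m - card (E ?v))"
    have th: "t h \<in> E ?v" unfolding E_def using h by blast
    have "P ?v = [:- t h, 1:] * Q"
      unfolding P_def Q_def prod.remove[OF E(1) th] by (simp only: mult.assoc)
    moreover have "poly Q (t h) \<noteq> 0"
      using r_neq_t[OF opp(3)[OF h] h] E(1)[of ?v] unfolding Q_def
      by (auto simp: poly_prod prod_zero_iff)
    ultimately show "\<exists>Q. P ?v = [:- t h, 1:] * Q \<and> poly Q (t h) \<noteq> 0" by blast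
  qed
qed

theorem lemma5p5:
  fixes G :: "('v, 'h) wgraph"
  assumes "finite_graph G" and "connected_graph G" and "weightless G" and "loopless G"
  shows "\<exists>\<X> \<in> (M_alg G :: 'k::alg_closed_field ppoint set set set). \<exists>X \<in> \<X>. special G X"
proof -
  let ?L = "proj_space 1 :: 'k ppoint set"
  have fin: "finite (verts G)"
    and opp: "\<And>h. h \<in> halves G \<Longrightarrow> opp G h \<in> halves G \<and> opp G (opp G h) = h \<and> base G h \<in> verts G"
    using assms(1) unfolding finite_graph_def by auto
  have ne: "base G (opp G h) \<noteq> base G h" if "h \<in> halves G" for h
    using assms(4) that unfolding loopless_def by blast
  obtain t :: "'h \<Rightarrow> 'k" and P :: "'v \<Rightarrow> 'k poly" and m :: nat where m: "0 < m"
    and deg: "\<forall>v\<in>verts G. degree (P v) = m"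
    and t: "\<forall>h\<in>halves G. \<forall>h'\<in>halves G. t h = t h' \<longleftrightarrow> h' = h \<or> h' = opp G h"
    and root: "\<forall>v\<in>verts G. \<forall>w\<in>verts G. v \<noteq> w \<longrightarrow>
      (\<forall>x. poly (P v) x = 0 \<and> poly (P w) x = 0 \<longleftrightarrow> (\<exists>h\<in>half_edges G v w. x = t h))"
    and simple: "\<forall>h\<in>halves G. \<exists>Q. P (base G h) = [:- t h, 1:] * Q \<and> poly Q (t h) \<noteq> 0"
    using vertex_polynomials_exist[OF assms(1,4)] .
  obtain e :: "'v \<Rightarrow> nat" where e: "inj_on e (verts G)"
    using exists_inj_on_finite[OF fin infinite_UNIV_nat] by blast
  \<comment> \<open>The private positions start right after the common coordinates \<open>0\<close>
    to \<open>m\<close>.\<close>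
  define idx where "idx v = m + 1 + e v" for v
  interpret glued_rational_curves "verts G" idx m P
  proof
    show "verts G \<noteq> {}" using assms(2) unfolding connected_graph_def by blast
    show "inj_on idx (verts G)" using e by (auto simp: idx_def inj_on_def)
  next
    fix v w assume "v \<in> verts G" "w \<in> verts G" "v \<noteq> w"
    then show "coeff (P v) m \<noteq> 0" using deg m by (metis degree_0 leading_coeff_0_iff less_irrefl)
  next
    fix v w u x assume vwu: "v \<in> verts G" "w \<in> verts G" "u \<in> verts G" "v \<noteq> w" "u \<noteq> v" "u \<noteq> w"
      and x: "poly (P v) x = 0" "poly (P w) x = 0"
    obtain h where h: "h \<in> half_edges G v w" "x = t h" using root vwu x by blast
    show "poly (P u) x \<noteq> 0"
    proof
      assume "poly (P u) x = 0"
      then obtain h' where h': "h' \<in> half_edges G v u" "x = t h'" using root vwu x by metis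
      \<comment> \<open>In the first case \<open>u = w\<close>, and in the second \<open>h'\<close>
        is adjacent to \<open>w\<close>, so \<open>v = w\<close>; both are excluded.\<close>
      then have "h' = h \<or> h' = opp G h" using t h unfolding half_edges_def by auto
      then show False using h h' vwu unfolding half_edges_def by auto
    qed
  next
    fix v w x assume "v \<in> verts G" "w \<in> verts G" "v \<noteq> w" "poly (P v) x = 0" "poly (P w) x = 0"
    then obtain h where "h \<in> half_edges G v w" "x = t h" using root by blast
    then show "\<exists>Q. P v = [:- x, 1:] * Q \<and> poly Q x \<noteq> 0" using simple unfolding half_edges_def by blast
  qed (use fin m deg in \<open>auto simp: idx_def\<close>)
  \<comment> \<open>The marked point depends on \<open>h\<close> only through the parameter of its
    edge, so both ends of an edge are marked at one and the same point of the common projective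
    line.\<close>
  define p where "p h = line (vec2 1 (t h))" for h
  have p_opp: "p (opp G h) = p h" if "h \<in> halves G" for h
  proof -
    have "t h = t (opp G h)" using t that opp by blast
    then show ?thesis unfolding p_def by simp
  qed
  have \<nu>p: "\<nu> v (p h) = a v (t h)" for v h unfolding p_def by (rule \<nu>_eq)
  have marking: "dual_graph_marking G X K (\<lambda>_. ?L) \<nu> p"
    unfolding dual_graph_marking_def
  proof (intro conjI ballI)
    show "bij_betw K (verts G) (components X)"
      unfolding bij_betw_def using inj_on_K components_X by blast
    show "normalization (K v) ?L (\<nu> v)" if "v \<in> verts G" for v by (rule normalization_\<nu>[OF that])
    show "has_genus ?L (weight G v)" if "v \<in> verts G" for v
      using has_genus_proj_line assms(3) that unfolding weightless_def by simp
    show "bij_betw (\<lambda>h. (base G h, p h)) (halves G) {(v, q). v \<in> verts G \<and> q \<in> ?L \<and> node X (\<nu> v q)}"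
      unfolding bij_betw_def
    proof
      show "inj_on (\<lambda>h. (base G h, p h)) (halves G)"
      proof (rule inj_onI)
        fix h h' assume h: "h \<in> halves G" "h' \<in> halves G" "(base G h, p h) = (base G h', p h')"
        then have "t h = t h'" by (simp add: p_def line_vec2_eq_iff)
        then have "h' = h \<or> h' = opp G h" using t h by blast
        \<comment> \<open>The two halves of an edge carry the same point, but without loops they
          have different bases.\<close>
        then show "h = h'" using ne[OF h(1)] h(3) by auto
      qed
      show "(\<lambda>h. (base G h, p h)) ` halves G = {(v, q). v \<in> verts G \<and> q \<in> ?L \<and> node X (\<nu> v q)}"
      proof (intro set_eqI iffI)
        fix z assume "z \<in> (\<lambda>h. (base G h, p h)) ` halves G"
        then obtain h where h: "h \<in> halves G" "z = (base G h, p h)" by blast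
        let ?v = "base G h" and ?w = "base G (opp G h)"
        have vw: "?v \<in> verts G" "?w \<in> verts G" "?w \<noteq> ?v" using h opp ne by auto
        have "h \<in> half_edges G ?v ?w" using h unfolding half_edges_def by simp
        then have "poly (P ?v) (t h) = 0" "poly (P ?w) (t h) = 0" using root vw by metis+
        then have "node X (\<nu> ?v (p h))" unfolding \<nu>p using node_affine[OF vw] by blast
        moreover have "p h \<in> ?L" unfolding p_def by (rule line_vec2_in_proj_line)
        ultimately show "z \<in> {(v, q). v \<in> verts G \<and> q \<in> ?L \<and> node X (\<nu> v q)}" using h vw by simp
      next
        fix z assume "z \<in> {(v, q). v \<in> verts G \<and> q \<in> ?L \<and> node X (\<nu> v q)}"
        then obtain v q where z: "z = (v, q)" "v \<in> verts G" "q \<in> ?L" "node X (\<nu> v q)" by blast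
        then obtain x w where x: "q = line (vec2 1 x)" "w \<in> verts G" "w \<noteq> v" "poly (P v) x = 0" "poly (P w) x = 0"
          using node_\<nu>_iff[OF z(2,3)] by blast
        then obtain h where "h \<in> half_edges G v w" "x = t h" using root z(2) by metis
        then have "h \<in> halves G" "z = (base G h, p h)" using z x unfolding half_edges_def p_def by auto
        then show "z \<in> (\<lambda>h. (base G h, p h)) ` halves G" by blast
      qed
    qed
    show "\<nu> (base G h) (p h) = \<nu> (base G h') (p h') \<longleftrightarrow> h' = h \<or> h' = opp G h"
      if h: "h \<in> halves G" "h' \<in> halves G" for h h'
    proof -
      \<comment> \<open>As every half-edge sits at a root of its own polynomial, two of the marked
        points coincide on the curve as soon as their parameters agree.\<close>
      have "poly (P (base G g)) (t g) = 0" if "g \<in> halves G" for g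
        using simple that by fastforce
      then have "a (base G h) (t h) = a (base G h') (t h') \<longleftrightarrow> t h = t h'"
        using affine_eq_iff[of "base G h" "base G h'" "t h" "t h'"] h opp by metis
      then show ?thesis unfolding \<nu>p using t h by blast
    qed
  qed
  have "special G X"
    unfolding special_def
  proof (rule exI[of _ K], rule exI[of _ "\<lambda>_. ?L"], rule exI[of _ \<nu>], rule exI[of _ p],
      intro conjI exI[of _ "\<lambda>_ _ q. q"] ballI)
    show "dual_graph_marking G X K (\<lambda>_. ?L) \<nu> p" by (rule marking)
    fix v w assume "v \<in> verts G" "w \<in> verts G"
    have sub: "p ` half_edges G v w \<subseteq> p ` half_edges G w v" for v w
    proof
      fix q assume "q \<in> p ` half_edges G v w"
      then obtain h where h: "h \<in> half_edges G v w" "q = p h" by blast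
      then have "opp G h \<in> half_edges G w v" "q = p (opp G h)"
        using opp p_opp unfolding half_edges_def by auto
      then show "q \<in> p ` half_edges G w v" by blast
    qed
    show "pointed_isomorphism ?L (p ` half_edges G v w) ?L (p ` half_edges G w v) (\<lambda>q. q)"
      unfolding pointed_isomorphism_def
      using isomorphism_id[of ?L] subset_antisym[OF sub[of v w] sub[of w v]] by simp
    show "p h = p (opp G h)" if "h \<in> half_edges G v w" for h
      using p_opp[of h] that unfolding half_edges_def by auto
    show "inv_into ?L (\<lambda>q. q) q = q" if "q \<in> ?L" for q
      using f_inv_into_f[of q "\<lambda>q. q" ?L] that by simp
  qed (rule refl)
  moreover have "X \<in> curves_with_dual_graph G"
    unfolding curves_with_dual_graph_def using curve_X marking by blast
  ultimately show ?thesis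
  proof (intro bexI)
    let ?r = "{(X, Y). curve X \<and> curve Y \<and> (\<exists>\<phi>. isomorphism X Y \<phi>)} :: ('k ppoint set \<times> 'k ppoint set) set"
    show "X \<in> ?r `` {X}" using curve_X isomorphism_id by blast
    show "?r `` {X} \<in> M_alg G"
      unfolding M_alg_def using \<open>X \<in> curves_with_dual_graph G\<close> by (rule quotientI)
  qed
qed

end
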